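(* Assume that all of the following hold. (1) There exists $\gamma>0$ such that $p(n)=O(n^\gamma)$ as $n\to\infty$. (2) For all $n\in\mathbb{N}$ and $a\in\Gamma(n)$, $\mathrm{Var}(X_a)=1$; and there exists $v^2>0$ such that $\mathrm{Var}(X_a\mid X_{\Gamma(n)\setminus\{a\}})\ge v^2$ for all $n\in\mathbb{N}$ and $a\in\Gamma(n)$. (3) There exists $0\le\kappa<1$ such that $\max_{a\in\Gamma(n)}|\mathrm{ne}_a|=O(n^\kappa)$ as $n\to\infty$. (4) There exists $\vartheta<\infty$ such that for all $n\in\mathbb{N}$ and all neighboring nodes $a,b\in\Gamma(n)$, $\|\theta^{a,\mathrm{ne}_b\setminus\{a\}}\|_1\le\vartheta$. (5) There exist $\delta>0$ and $\xi>\kappa$ (with $\kappa$ as in (3)) such that for all $n\in\mathbb{N}$ and every $(a,b)\in E$, $|\pi_{ab}|\ge\delta n^{-(1-\xi)/2}$. (6) There exists $\delta'<1$ such that for all $n\in\mathbb{N}$ and all $a,b\in\Gamma(n)$ with $b\ne a$ and $b\notin\mathrm{ne}_a$, $|S_a(b)|<\delta'$. Let the penalty parameter $\lambda=\lambda_n$ satisfy $\lambda_n\sim d\,n^{-(1-\varepsilon)/2}$ with some $\kappa<\varepsilon<\xi$ and $d>0$. Let $\hat E^{\lambda}$ denote either of the two edge set estimates $$\hat E^{\lambda,\wedge}=\{(a,b):a\in\hat{\mathrm{ne}}_b^{\lambda}\text{ and }b\in\hat{\mathrm{ne}}_a^{\lambda}\},\qquad \hat E^{\lambda,\vee}=\{(a,b):a\in\hat{\mathrm{ne}}_b^{\lambda}\text{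 or }b\in\hat{\mathrm{ne}}_a^{\lambda}\}.$$ Then, for some $c>0$, $$P(\hat E^{\lambda}=E)=1-O(\exp(-cn^\varepsilon))\qquad\text{as }n\to\infty.$$
   Context: For each $n\in\mathbb{N}$ let $\Gamma(n)=\{1,\dots,p(n)\}$ be a finite set of nodes and let $X=(X_k)_{k\in\Gamma(n)}\sim\mathcal{N}(0,\Sigma(n))$ with $\Sigma(n)$ nonsingular; write $K=\Sigma^{-1}(n)$. The dependence on $n$ of the objects below is suppressed. $\mathbf{X}$ is the $n\times p(n)$ random matrix whose rows are $n$ independent observations of $X$; $\mathbf{X}_a\in\mathbb{R}^n$ is its column for node $a$; $\|\cdot\|_2$ is the Euclidean norm on $\mathbb{R}^n$, and $\|\theta\|_1=\sum_{b\in\Gamma(n)}|\theta_b|$. Graph: the edge set $E\subseteq\Gamma(n)\times\Gamma(n)$ consists of the pairs $(a,b)$, $a\ne b$, such that $X_a$ and $X_b$ are conditionally dependent given all remaining variables (equivalently $K_{ab}\neq0$). The neighborhood of $a$ is $\mathrm{ne}_a=\{b\in\Gamma(n)\setminus\{a\}:(a,b)\in E\}$; $a,b$ are neighboring if $b\in\mathrm{ne}_a$. The partial correlation is $\pi_{ab}=-K_{ab}/\sqrt{K_{aa}K_{bb}}$, the correlation of $X_a$ and $X_b$ after eliminating the linear effects of all remaining variables. Optimal prediction: for $\mathcal{A}\subseteq\Gamma(n)\setminus\{a\}$, $\theta^{a,\mathcal{A}}=\arg\min\{E(X_a-\sum_{k\in\Gamma(n)}\theta_kX_k)^2:\theta\in\mathbb{R}^{p(n)},\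 \theta_k=0\ \forall k\notin\mathcal{A}\}$. For $a,b\in\Gamma(n)$ with $b\notin\mathrm{ne}_a\cup\{a\}$, $S_a(b)=\sum_{k\in\mathrm{ne}_a}\mathrm{sign}(\theta_k^{a,\mathrm{ne}_a})\,\theta_k^{b,\mathrm{ne}_a}$. Lasso: $\hat\theta^{a,\lambda}$ is any minimizer of $n^{-1}\|\mathbf{X}_a-\mathbf{X}\theta\|_2^2+\lambda\|\theta\|_1$ over $\theta\in\mathbb{R}^{p(n)}$ with $\theta_a=0$ (if it is not unique, the result is for any solution), and $\hat{\mathrm{ne}}_a^{\lambda}=\{b\in\Gamma(n):\hat\theta_b^{a,\lambda}\ne0\}$. $\lambda_n\sim d\,n^{-(1-\varepsilon)/2}$ means that the ratio tends to $1$.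
   Formalization: The formal theorem adds ε ≤ 1. This follows from (5) if E is nonempty for infinitely many n; if E is eventually empty, the claim fails for ε > 1 (e.g. p=2, Σ=I, κ=0, ξ=3, ε=2, λ_n=√n). P(Ê=E) is taken for solutions for which {Ê=E} is an event. *)

theory Defs
  imports "HOL-Probability.Probability"
begin

text \<open>
  Vectors indexed by a finite set of nodes V are functions on V, and matrices are functions
  on V \<times> V; values outside V are irrelevant. A random vector X indexed by V is a family of
  real random variables X a, for a in V, on a probability space M.
\<close>

definition nodes :: "nat \<Rightarrow> nat set" where
  "nodes p = {1..p}"

definition matrix_inverse_on :: "'i set \<Rightarrow> ('i \<Rightarrow> 'i \<Rightarrow> real) \<Rightarrow> ('i \<Rightarrow> 'i \<Rightarrow> real) \<Rightarrow> bool" where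
  "matrix_inverse_on V S K \<longleftrightarrow>
     (\<forall>a\<in>V. \<forall>b\<in>V. (\<Sum>k\<in>V. S a k * K k b) = of_bool (a = b)
                    \<and> (\<Sum>k\<in>V. K a k * S k b) = of_bool (a = b))"

text \<open>The law N(0,v) on the real line, including the degenerate case v = 0.\<close>

definition centered_normal :: "real \<Rightarrow> real measure" where
  "centered_normal v =
     (if v = 0 then return borel 0 else density lborel (\<lambda>x. ennreal (normal_density 0 (sqrt v) x)))"

text \<open>X is distributed as N(0,S): every linear combination t'X has the law N(0,t'St).\<close>

definition gaussian_vector ::
    "'w measure \<Rightarrow> 'i set \<Rightarrow> ('i \<Rightarrow> 'w \<Rightarrow> real) \<Rightarrow> ('i \<Rightarrow> 'i \<Rightarrow> real) \<Rightarrow> bool" where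
  "gaussian_vector M V X S \<longleftrightarrow>
     (\<forall>a\<in>V. X a \<in> borel_measurable M) \<and>
     (\<forall>a\<in>V. \<forall>b\<in>V. S a b = S b a) \<and>
     (\<forall>t :: 'i \<Rightarrow> real.
        0 \<le> (\<Sum>a\<in>V. \<Sum>b\<in>V. t a * S a b * t b) \<and>
        distr M borel (\<lambda>\<omega>. \<Sum>a\<in>V. t a * X a \<omega>)
          = centered_normal (\<Sum>a\<in>V. \<Sum>b\<in>V. t a * S a b * t b))"

definition joint :: "'i set \<Rightarrow> ('i \<Rightarrow> 'w \<Rightarrow> real) \<Rightarrow> 'w \<Rightarrow> 'i \<Rightarrow> real" where
  "joint V X \<omega> = (\<lambda>a\<in>V. X a \<omega>)"

text \<open>The rows D 1, ..., D n of the data matrix are n independent observations of X.\<close>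

definition iid_observations ::
    "'w measure \<Rightarrow> 'i set \<Rightarrow> ('i \<Rightarrow> 'w \<Rightarrow> real) \<Rightarrow> nat \<Rightarrow> (nat \<Rightarrow> 'i \<Rightarrow> 'w \<Rightarrow> real) \<Rightarrow> bool" where
  "iid_observations M V X n D \<longleftrightarrow>
     prob_space.indep_vars M (\<lambda>_. PiM V (\<lambda>_. borel)) (\<lambda>i. joint V (D i)) {1..n} \<and>
     (\<forall>i\<in>{1..n}. distr M (PiM V (\<lambda>_. borel)) (joint V (D i))
                 = distr M (PiM V (\<lambda>_. borel)) (joint V X))"

definition generated_algebra :: "'w measure \<Rightarrow> 'i set \<Rightarrow> ('i \<Rightarrow> 'w \<Rightarrow> real) \<Rightarrow> 'w measure" where
  "generated_algebra M J X = vimage_algebra (space M) (joint J X) (PiM J (\<lambda>_. borel))"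

definition cond_indep ::
    "'w measure \<Rightarrow> 'w measure \<Rightarrow> ('w \<Rightarrow> real) \<Rightarrow> ('w \<Rightarrow> real) \<Rightarrow> bool" where
  "cond_indep M F Y Z \<longleftrightarrow>
     (\<forall>A\<in>sets borel. \<forall>B\<in>sets borel. AE \<omega> in M.
        real_cond_exp M F (\<lambda>x. indicator A (Y x) * indicator B (Z x)) \<omega>
        = real_cond_exp M F (\<lambda>x. indicator A (Y x)) \<omega>
          * real_cond_exp M F (\<lambda>x. indicator B (Z x)) \<omega>)"

definition cond_variance :: "'w measure \<Rightarrow> 'w measure \<Rightarrow> ('w \<Rightarrow> real) \<Rightarrow> 'w \<Rightarrow> real" where
  "cond_variance M F Y = real_cond_exp M F (\<lambda>x. (Y x - real_cond_exp M F Y x)\<^sup>2)"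

definition edges :: "'w measure \<Rightarrow> 'i set \<Rightarrow> ('i \<Rightarrow> 'w \<Rightarrow> real) \<Rightarrow> ('i \<times> 'i) set" where
  "edges M V X = {(a, b). a \<in> V \<and> b \<in> V \<and> a \<noteq> b \<and>
     \<not> cond_indep M (generated_algebra M (V - {a, b}) X) (X a) (X b)}"

definition ne :: "'w measure \<Rightarrow> 'i set \<Rightarrow> ('i \<Rightarrow> 'w \<Rightarrow> real) \<Rightarrow> 'i \<Rightarrow> 'i set" where
  "ne M V X a = {b \<in> V - {a}. (a, b) \<in> edges M V X}"

definition partial_corr :: "('i \<Rightarrow> 'i \<Rightarrow> real) \<Rightarrow> 'i \<Rightarrow> 'i \<Rightarrow> real" where
  "partial_corr K a b = - K a b / sqrt (K a a * K b b)"

text \<open>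
  The coefficients of the optimal linear prediction of X a from the variables in A;
  the minimizer is unique when the covariance matrix is nonsingular.
\<close>

definition opt_coef ::
    "'w measure \<Rightarrow> 'i set \<Rightarrow> ('i \<Rightarrow> 'w \<Rightarrow> real) \<Rightarrow> 'i \<Rightarrow> 'i set \<Rightarrow> 'i \<Rightarrow> real" where
  "opt_coef M V X a A =
     arg_min (\<lambda>\<theta>. prob_space.expectation M (\<lambda>\<omega>. (X a \<omega> - (\<Sum>k\<in>V. \<theta> k * X k \<omega>))\<^sup>2))
             (\<lambda>\<theta>. \<forall>k. k \<notin> A \<longrightarrow> \<theta> k = 0)"

definition l1_norm :: "'i set \<Rightarrow> ('i \<Rightarrow> real) \<Rightarrow> real" where
  "l1_norm V \<theta> = (\<Sum>b\<in>V. \<bar>\<theta> b\<bar>)"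

definition sign_stat ::
    "'w measure \<Rightarrow> 'i set \<Rightarrow> ('i \<Rightarrow> 'w \<Rightarrow> real) \<Rightarrow> 'i \<Rightarrow> 'i \<Rightarrow> real" where
  "sign_stat M V X a b =
     (\<Sum>k\<in>ne M V X a. sgn (opt_coef M V X a (ne M V X a) k) * opt_coef M V X b (ne M V X a) k)"

text \<open>In the Lasso, D is a realized data matrix, with n rows and columns indexed by V.\<close>

definition lasso_objective ::
    "nat \<Rightarrow> 'i set \<Rightarrow> (nat \<Rightarrow> 'i \<Rightarrow> real) \<Rightarrow> real \<Rightarrow> 'i \<Rightarrow> ('i \<Rightarrow> real) \<Rightarrow> real" where
  "lasso_objective n V D lam a \<theta> =
     (L2_set (\<lambda>i. D i a - (\<Sum>k\<in>V. D i k * \<theta> k)) {1..n})\<^sup>2 / real n + lam * l1_norm V \<theta>"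

definition lasso_solution ::
    "nat \<Rightarrow> 'i set \<Rightarrow> (nat \<Rightarrow> 'i \<Rightarrow> real) \<Rightarrow> real \<Rightarrow> 'i \<Rightarrow> ('i \<Rightarrow> real) \<Rightarrow> bool" where
  "lasso_solution n V D lam a = is_arg_min (lasso_objective n V D lam a) (\<lambda>\<theta>. \<theta> a = 0)"

definition lasso_support :: "'i set \<Rightarrow> ('i \<Rightarrow> real) \<Rightarrow> 'i set" where
  "lasso_support V \<theta> = {b \<in> V. \<theta> b \<noteq> 0}"

definition edges_and :: "'i set \<Rightarrow> ('i \<Rightarrow> 'i set) \<Rightarrow> ('i \<times> 'i) set" where
  "edges_and V N = {(a, b). a \<in> V \<and> b \<in> V \<and> a \<in> N b \<and> b \<in> N a}"

definition edges_or :: "'i set \<Rightarrow> ('i \<Rightarrow> 'i set) \<Rightarrow> ('i \<times> 'i) set" where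
  "edges_or V N = {(a, b). a \<in> V \<and> b \<in> V \<and> (a \<in> N b \<or> b \<in> N a)}"

end

theory Submission
  imports Defs "HOL-Real_Asymp.Real_Asymp"
begin

text \<open>
  Fix a node \<open>a\<close> with neighbourhood \<open>N\<close> and write \<open>X a = (\<Sum>k\<in>N. \<beta> k * X k) + W\<close> with \<open>W\<close> uncorrelated
  with all other variables. For \<open>b \<noteq> a\<close> let \<open>Z\<close> be \<open>X b\<close> minus its projection \<open>\<Sum>k\<in>N - {b}. \<tau> k * X k\<close>;
  then \<open>Z\<close> is uncorrelated with \<open>W\<close> and with \<open>X k\<close> for \<open>k \<in> N - {b}\<close>. Suppose that the data respect this
  up to a small \<open>\<rho>\<close>: \<open>\<bar>\<langle>u, Z\<rangle>\<bar> \<le> \<rho> * sqrt n * \<bar>u\<bar>\<close> for every \<open>u\<close> in the span of the corresponding data columns.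
  Consider the Lasso with coefficients restricted to \<open>N\<close>, and let \<open>R\<close> be its residual vector.

  No false negatives. For \<open>b \<in> N\<close> the residual is \<open>R = \<Delta> Z + u\<close> with \<open>u\<close> in that span and \<open>\<Delta>\<close> the error
  of the coefficient of \<open>b\<close>. Stationarity bounds all scores of \<open>R\<close> against \<open>N\<close> by \<open>n \<lambda> / 2\<close>, and \<open>\<tau>\<close>
  has \<open>l1\<close> norm at most \<open>\<theta>\<close>, so \<open>\<bar>\<langle>R, Z\<rangle>\<bar> \<le> (1 + \<theta>) n \<lambda> / 2\<close>. On the other hand \<open>\<langle>R, Z\<rangle>\<close> is close to
  \<open>\<Delta> \<bar>Z\<bar>\<^sup>2\<close>, and \<open>\<bar>\<Delta>\<bar> \<ge> \<bar>\<beta> b\<bar>\<close> if the fitted coefficient had the wrong sign. As \<open>\<beta> b\<close> is of larger order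
  than \<open>\<lambda>\<close> (partial correlations are bounded below and \<open>\<epsilon> < \<xi>\<close>), all signs are correct.

  No false positives. With all signs on \<open>N\<close> correct, the score of \<open>b \<notin> N\<close> equals
  \<open>n \<lambda> / 2\<close> times \<open>sign_stat\<close> of \<open>a\<close> and \<open>b\<close>, plus \<open>\<langle>R, Z\<rangle>\<close>, and this sum is below \<open>n \<lambda> / 2\<close> in absolute value. So the
  restricted solution carries a strict dual certificate, and every solution of the full problem
  is supported on \<open>N\<close>, hence is itself a restricted solution with support exactly \<open>N\<close>
  (\<open>lasso_recovers_neighbourhood\<close>).

  Probability. By polarization \<open>\<langle>u, Z\<rangle>\<close> is a difference of two sums of squares of one linear
  combination of the variables over the \<open>n\<close> rows. Each such combination is normal, so a relative deviation
  \<open>\<eta>\<close> has probability at most \<open>2 * exp (- n * \<eta>\<^sup>2 / 16)\<close>, which is \<open>exp (- c * n powr \<epsilon>)\<close> for \<open>\<eta>\<close> proportional to \<open>\<lambda>\<close>. Uniformity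
  over the span, whose dimension is at most \<open>s + 1\<close> with \<open>s = O(n powr \<kappa>)\<close>, comes from a grid in an
  orthonormal basis (\<open>grid_cross_bound\<close>); its \<open>exp (O(n powr \<kappa> * ln n))\<close> points, and the \<open>(p n)\<^sup>2\<close> pairs of
  nodes, are negligible because \<open>\<kappa> < \<epsilon>\<close> (\<open>union_bound_negligible\<close>). In this way only the laws of single
  linear combinations enter, and never the joint law of \<open>Z\<close> and the design.

  Graph and precision matrix. A linear combination that is uncorrelated with the variables in \<open>C\<close>
  can be reflected without changing its joint law with them, since all linear combinations keep their
  laws (\<open>cramer_wold\<close>); so its conditional expectation given them is zero. Hence conditional
  expectations are linear projections. It follows that conditional independence of \<open>X a\<close> and \<open>X b\<close>
  forces \<open>K a b = 0\<close> (\<open>prec_zero_if_cond_indep\<close>), and that the conditional variance of \<open>X a\<close> is \<open>1 / K a a\<close>.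
\<close>

section \<open>Finite Euclidean norms\<close>

lemma L2_set_power2: "(L2_set f A)\<^sup>2 = (\<Sum>i\<in>A. (f i)\<^sup>2)"
  by (simp add: L2_set_def sum_nonneg)

lemma L2_set_cmult: "L2_set (\<lambda>i. a * f i) A = \<bar>a\<bar> * L2_set f A"
  by (simp add: L2_set_def power_mult_distrib sum_distrib_left[symmetric] real_sqrt_mult)

lemma inner_le_L2_set: "\<bar>\<Sum>i\<in>A. f i * g i\<bar> \<le> L2_set f A * L2_set g A"
proof -
  have "\<bar>\<Sum>i\<in>A. f i * g i\<bar> \<le> (\<Sum>i\<in>A. \<bar>f i\<bar> * \<bar>g i\<bar>)"
    by (rule order_trans[OF sum_abs]) (simp add: abs_mult)
  thus ?thesis using L2_set_mult_ineq by (rule order_trans)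
qed

lemma L2_set_diff_le: "L2_set (\<lambda>i. f i - g i) A \<le> L2_set f A + L2_set g A"
  using L2_set_triangle_ineq[of f "\<lambda>i. - g i" A] by (simp add: L2_set_def)

section \<open>Optimality conditions of the Lasso\<close>

definition residual :: "'i set \<Rightarrow> (nat \<Rightarrow> 'i \<Rightarrow> real) \<Rightarrow> 'i \<Rightarrow> ('i \<Rightarrow> real) \<Rightarrow> nat \<Rightarrow> real" where
  "residual V D a \<theta> i = D i a - (\<Sum>k\<in>V. D i k * \<theta> k)"

text \<open>
  Up to the factor \<open>- 2 / n\<close> this is the gradient of the quadratic part of the objective at \<open>\<theta>\<close>.
\<close>

definition score ::
    "nat \<Rightarrow> 'i set \<Rightarrow> (nat \<Rightarrow> 'i \<Rightarrow> real) \<Rightarrow> 'i \<Rightarrow> ('i \<Rightarrow> real) \<Rightarrow> 'i \<Rightarrow> real" where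
  "score n V D a \<theta> k = (\<Sum>i\<in>{1..n}. residual V D a \<theta> i * D i k)"

definition restricted_solution ::
    "nat \<Rightarrow> 'i set \<Rightarrow> (nat \<Rightarrow> 'i \<Rightarrow> real) \<Rightarrow> real \<Rightarrow> 'i \<Rightarrow> 'i set \<Rightarrow> ('i \<Rightarrow> real) \<Rightarrow> bool" where
  "restricted_solution n V D lam a A = is_arg_min (lasso_objective n V D lam a) (\<lambda>\<theta>. \<forall>k. k \<notin> A \<longrightarrow> \<theta> k = 0)"

lemma lasso_objective_alt:
  "lasso_objective n V D lam a \<theta> = (\<Sum>i\<in>{1..n}. (residual V D a \<theta> i)\<^sup>2) / real n + lam * l1_norm V \<theta>"
  by (simp add: lasso_objective_def L2_set_power2 residual_def)

text \<open>
  The loss is quadratic, so its expansion about \<open>\<theta>\<close> is exact. Perturbing one coordinate gives the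
  stationarity conditions; dropping the nonnegative first sum gives the dual certificate.
\<close>

lemma lasso_objective_diff:
  "lasso_objective n V D lam a \<psi> - lasso_objective n V D lam a \<theta>
     = (\<Sum>i\<in>{1..n}. (\<Sum>k\<in>V. D i k * (\<psi> k - \<theta> k))\<^sup>2) / real n
       + (\<Sum>k\<in>V. lam * (\<bar>\<psi> k\<bar> - \<bar>\<theta> k\<bar>) - 2 / real n * score n V D a \<theta> k * (\<psi> k - \<theta> k))"
proof -
  have r: "residual V D a \<psi> i = residual V D a \<theta> i - (\<Sum>k\<in>V. D i k * (\<psi> k - \<theta> k))" for i
    by (simp add: residual_def sum_subtractf algebra_simps)
  have "(\<Sum>i\<in>{1..n}. (residual V D a \<psi> i)\<^sup>2)
      = (\<Sum>i\<in>{1..n}. (residual V D a \<theta> i)\<^sup>2) + (\<Sum>i\<in>{1..n}. (\<Sum>k\<in>V. D i k * (\<psi> k - \<theta> k))\<^sup>2)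
        - 2 * (\<Sum>i\<in>{1..n}. residual V D a \<theta> i * (\<Sum>k\<in>V. D i k * (\<psi> k - \<theta> k)))"
    by (simp add: r power2_diff sum.distrib sum_subtractf sum_distrib_left mult.assoc)
  also have "(\<Sum>i\<in>{1..n}. residual V D a \<theta> i * (\<Sum>k\<in>V. D i k * (\<psi> k - \<theta> k)))
      = (\<Sum>k\<in>V. score n V D a \<theta> k * (\<psi> k - \<theta> k))"
    unfolding score_def sum_distrib_left sum_distrib_right
    by (subst sum.swap) (simp add: mult.assoc)
  finally have e: "(\<Sum>i\<in>{1..n}. (residual V D a \<psi> i)\<^sup>2)
      = (\<Sum>i\<in>{1..n}. (residual V D a \<theta> i)\<^sup>2) + (\<Sum>i\<in>{1..n}. (\<Sum>k\<in>V. D i k * (\<psi> k - \<theta> k))\<^sup>2)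
        - 2 * (\<Sum>k\<in>V. score n V D a \<theta> k * (\<psi> k - \<theta> k))" .
  show ?thesis
    unfolding lasso_objective_alt e l1_norm_def
    by (simp add: add_divide_distrib diff_divide_distrib sum_subtractf sum_distrib_left
        right_diff_distrib mult.assoc sum_divide_distrib)
qed

lemma le_0_if_le_mult_small:
  fixes y c e :: real
  assumes "e > 0" "\<And>h. 0 < h \<Longrightarrow> h < e \<Longrightarrow> y \<le> h * c"
  shows "y \<le> 0"
proof (rule ccontr)
  assume "\<not> y \<le> 0"
  hence y: "y > 0" by simp
  define h where "h = min (e / 2) (y / (2 * (\<bar>c\<bar> + 1)))"
  have h: "0 < h" using y assms(1) by (auto simp: h_def)
  have he: "h < e" using min.cobounded1[of "e / 2"] assms(1) unfolding h_def by (smt (verit) field_sum_of_halves)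
  have "h * c \<le> h * (\<bar>c\<bar> + 1)" using h by (intro mult_left_mono) auto
  also have "\<dots> \<le> y / (2 * (\<bar>c\<bar> + 1)) * (\<bar>c\<bar> + 1)"
    by (intro mult_right_mono) (auto simp: h_def)
  also have "\<dots> = y / 2" using abs_ge_zero[of c] by (simp add: field_simps)
  finally show False using assms(2)[OF h he] y by simp
qed

text \<open>
  One-sided derivatives at \<open>h = 0\<close>: the penalty has slopes \<open>\<plusminus> lam\<close> at its kink, and both one-sided
  slopes are \<open>lam * sgn x\<close> away from it.
\<close>

lemma soft_threshold_stationary:
  fixes x c g lam :: real
  assumes "\<And>h. 0 \<le> h\<^sup>2 * c - h * g + lam * (\<bar>x + h\<bar> - \<bar>x\<bar>)" and lam: "lam \<ge> 0"
  shows "\<bar>g\<bar> \<le> lam" and "x \<noteq> 0 \<Longrightarrow> g = lam * sgn x"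
proof -
  have up: "s * g - lam \<le> h * c" if "0 < h" "s = 1 \<or> s = -1" for h s
  proof -
    have "lam * (\<bar>x + s * h\<bar> - \<bar>x\<bar>) \<le> lam * h"
      using that lam by (intro mult_left_mono) auto
    hence "0 \<le> h * (h * c - s * g + lam)"
      using assms(1)[of "s * h"] that by (auto simp: power2_eq_square algebra_simps)
    thus ?thesis using that by (simp add: zero_le_mult_iff)
  qed
  have "s * g - lam \<le> 0" if "s = 1 \<or> s = -1" for s
    using le_0_if_le_mult_small[of 1 "s * g - lam" c] up that by simp
  from this[of 1] this[of "-1"] show g: "\<bar>g\<bar> \<le> lam" by auto
  assume x: "x \<noteq> 0"
  have "lam - sgn x * g \<le> h * c" if h: "0 < h" "h < \<bar>x\<bar>" for h
  proof -
    have "\<bar>x + - sgn x * h\<bar> - \<bar>x\<bar> = - h" using h by (cases "x > 0") auto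
    hence "0 \<le> h * (h * c + sgn x * g - lam)"
      using assms(1)[of "- sgn x * h"] x
      by (auto simp: power2_eq_square algebra_simps sgn_if split: if_splits)
    thus ?thesis using h by (simp add: zero_le_mult_iff)
  qed
  hence "lam - sgn x * g \<le> 0"
    using le_0_if_le_mult_small[of "\<bar>x\<bar>" "lam - sgn x * g" c] x by auto
  thus "g = lam * sgn x" using g x by (auto simp: sgn_if split: if_splits)
qed

lemma restricted_solution_KKT:
  assumes sol: "restricted_solution n V D lam a A \<theta>" and "finite V" "A \<subseteq> V" "k \<in> A" "lam \<ge> 0"
  shows "\<bar>2 / real n * score n V D a \<theta> k\<bar> \<le> lam"
    and "\<theta> k \<noteq> 0 \<Longrightarrow> 2 / real n * score n V D a \<theta> k = lam * sgn (\<theta> k)"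
proof -
  have "0 \<le> h\<^sup>2 * ((\<Sum>i\<in>{1..n}. (D i k)\<^sup>2) / real n) - h * (2 / real n * score n V D a \<theta> k)
           + lam * (\<bar>\<theta> k + h\<bar> - \<bar>\<theta> k\<bar>)" for h
  proof -
    define \<psi> where "\<psi> = \<theta>(k := \<theta> k + h)"
    have kV: "k \<in> V" using assms by auto
    have "\<forall>j. j \<notin> A \<longrightarrow> \<psi> j = 0"
      using sol assms by (auto simp: \<psi>_def restricted_solution_def is_arg_min_linorder)
    hence "0 \<le> lasso_objective n V D lam a \<psi> - lasso_objective n V D lam a \<theta>"
      using sol by (auto simp: restricted_solution_def is_arg_min_linorder)
    also have "\<dots> = (\<Sum>i\<in>{1..n}. (D i k * h)\<^sup>2) / real n
        + (lam * (\<bar>\<theta> k + h\<bar> - \<bar>\<theta> k\<bar>) - 2 / real n * score n V D a \<theta> k * h)"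
    proof -
      have 1: "(\<Sum>j\<in>V. D i j * (\<psi> j - \<theta> j)) = D i k * h" for i
        using sum.remove[OF assms(2) kV, of "\<lambda>j. D i j * (\<psi> j - \<theta> j)"]
        by (simp add: \<psi>_def)
      have 2: "(\<Sum>j\<in>V. lam * (\<bar>\<psi> j\<bar> - \<bar>\<theta> j\<bar>) - 2 / real n * score n V D a \<theta> j * (\<psi> j - \<theta> j))
          = lam * (\<bar>\<theta> k + h\<bar> - \<bar>\<theta> k\<bar>) - 2 / real n * score n V D a \<theta> k * h"
        by (subst sum.remove[OF assms(2) kV]) (simp add: \<psi>_def)
      show ?thesis unfolding lasso_objective_diff 1 2 ..
    qed
    finally show ?thesis
      by (simp add: power_mult_distrib sum_distrib_left sum_distrib_right mult.commute)
  qed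
  from soft_threshold_stationary[OF this \<open>lam \<ge> 0\<close>]
  show "\<bar>2 / real n * score n V D a \<theta> k\<bar> \<le> lam"
    and "\<theta> k \<noteq> 0 \<Longrightarrow> 2 / real n * score n V D a \<theta> k = lam * sgn (\<theta> k)" by auto
qed

text \<open>
  Outside the box \<open>\<bar>\<theta> k\<bar> \<le> c\<close> the penalty alone exceeds the objective at zero, so a minimizer over this
  compact box is a global one.
\<close>

lemma restricted_solution_exists:
  assumes lam: "lam > 0" and fin: "finite V" and "A \<subseteq> V"
  shows "\<exists>\<theta>. restricted_solution n V D lam a A \<theta>"
proof -
  define c where "c = lasso_objective n V D lam a (\<lambda>_. 0) / lam"
  have obj0: "lasso_objective n V D lam a (\<lambda>_. 0) \<ge> 0"
    by (simp add: lasso_objective_def l1_norm_def)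
  hence c0: "c \<ge> 0" using lam by (simp add: c_def)
  define T where "T = PiE UNIV (\<lambda>k. if k \<in> A then {-c..c} else {0::real})"
  have "compactin (product_topology (\<lambda>_. euclidean) UNIV) T"
    unfolding T_def by (subst compactin_PiE) auto
  hence T: "compact T"
    by (simp add: euclidean_product_topology)
  have zT: "(\<lambda>_. 0) \<in> T" using c0 by (auto simp: T_def)
  have "continuous_on T (\<lambda>\<theta>. lasso_objective n V D lam a \<theta>)"
    unfolding lasso_objective_def L2_set_power2 l1_norm_def divide_inverse
    by (intro continuous_intros continuous_on_product_then_coordinatewise[OF continuous_on_id])
  then obtain \<theta> where \<theta>: "\<theta> \<in> T" "\<forall>\<psi>\<in>T. lasso_objective n V D lam a \<theta> \<le> lasso_objective n V D lam a \<psi>"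
    using continuous_attains_inf[OF T] zT by blast
  have "lasso_objective n V D lam a \<theta> \<le> lasso_objective n V D lam a \<psi>" if \<psi>: "\<forall>k. k \<notin> A \<longrightarrow> \<psi> k = 0" for \<psi>
  proof (cases "\<psi> \<in> T")
    case True
    thus ?thesis using \<theta> by auto
  next
    case False
    have "\<exists>k\<in>A. \<bar>\<psi> k\<bar> > c"
    proof (rule ccontr)
      assume "\<not> ?thesis"
      hence "\<bar>\<psi> k\<bar> \<le> c" if "k \<in> A" for k using that by (simp add: not_less)
      hence "\<psi> \<in> T" using \<psi> by (auto simp: T_def abs_le_iff minus_le_iff)
      with False show False by simp
    qed
    then obtain k where k: "k \<in> A" "\<bar>\<psi> k\<bar> > c" by blast
    have "\<bar>\<psi> k\<bar> \<le> l1_norm V \<psi>"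
      unfolding l1_norm_def using k assms by (intro member_le_sum) auto
    hence "lam * c \<le> lam * l1_norm V \<psi>" using k lam by (intro mult_left_mono) auto
    also have "\<dots> \<le> lasso_objective n V D lam a \<psi>"
      by (simp add: lasso_objective_def)
    finally have "lasso_objective n V D lam a (\<lambda>_. 0) \<le> lasso_objective n V D lam a \<psi>"
      using lam by (simp add: c_def)
    thus ?thesis using \<theta> zT by fastforce
  qed
  moreover have "\<forall>k. k \<notin> A \<longrightarrow> \<theta> k = 0"
    using \<theta>(1) by (auto simp: T_def PiE_iff split: if_splits)
  ultimately show ?thesis
    by (auto simp: restricted_solution_def is_arg_min_linorder)
qed

text \<open>
  The sum in \<open>lasso_objective_diff\<close> has nonnegative terms, and the term of \<open>b\<close> is at least
  \<open>(lam - \<bar>g b\<bar>) * \<bar>\<psi> b\<bar>\<close> with a positive factor. A minimizer \<open>\<psi>\<close> makes the sum nonpositive.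
\<close>

lemma lasso_solution_vanishes:
  assumes res: "restricted_solution n V D lam a A \<theta>" and lam: "lam > 0" and fin: "finite V"
    and A: "A \<subseteq> V" "a \<notin> A"
    and strict: "\<And>b. b \<in> V \<Longrightarrow> b \<notin> A \<Longrightarrow> b \<noteq> a \<Longrightarrow> \<bar>2 / real n * score n V D a \<theta> b\<bar> < lam"
    and sol: "lasso_solution n V D lam a \<psi>" and b: "b \<in> V" "b \<notin> A"
  shows "\<psi> b = 0"
proof (cases "b = a")
  case True
  thus ?thesis using sol by (simp add: lasso_solution_def is_arg_min_def)
next
  case False
  define g where "g k = 2 / real n * score n V D a \<theta> k" for k
  define s where "s k = lam * (\<bar>\<psi> k\<bar> - \<bar>\<theta> k\<bar>) - g k * (\<psi> k - \<theta> k)" for k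
  have \<theta>0: "\<theta> k = 0" if "k \<notin> A" for k
    using res that by (auto simp: restricted_solution_def is_arg_min_def)
  have \<psi>a: "\<psi> a = 0" using sol by (simp add: lasso_solution_def is_arg_min_def)
  have abs: "g k * \<psi> k \<le> \<bar>g k\<bar> * \<bar>\<psi> k\<bar>" for k
    by (metis abs_ge_self abs_mult)
  have s0: "s k \<ge> 0" if k: "k \<in> V" for k
  proof (cases "k \<in> A")
    case True
    have 1: "\<bar>g k\<bar> \<le> lam" "\<theta> k \<noteq> 0 \<Longrightarrow> g k = lam * sgn (\<theta> k)"
      using restricted_solution_KKT[OF res fin A(1) True] lam by (auto simp: g_def)
    have "g k * \<theta> k = lam * \<bar>\<theta> k\<bar>"
      using 1(2) by (cases "\<theta> k = 0") (auto simp: mult.assoc abs_sgn mult.commute)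
    moreover have "\<bar>g k\<bar> * \<bar>\<psi> k\<bar> \<le> lam * \<bar>\<psi> k\<bar>" using 1 by (intro mult_right_mono) auto
    ultimately show ?thesis using abs[of k] by (simp add: s_def algebra_simps)
  next
    case False
    show ?thesis
    proof (cases "k = a")
      case True
      thus ?thesis using \<psi>a \<theta>0[of a] A by (simp add: s_def)
    next
      case ka: False
      have "\<bar>g k\<bar> * \<bar>\<psi> k\<bar> \<le> lam * \<bar>\<psi> k\<bar>"
        using strict[OF k False ka] by (intro mult_right_mono) (auto simp: g_def)
      thus ?thesis using abs[of k] \<theta>0[OF False] by (simp add: s_def)
    qed
  qed
  have "lasso_objective n V D lam a \<psi> \<le> lasso_objective n V D lam a \<theta>"
    using sol \<theta>0[OF A(2)] by (auto simp: lasso_solution_def is_arg_min_linorder)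
  moreover have "lasso_objective n V D lam a \<psi> - lasso_objective n V D lam a \<theta> \<ge> (\<Sum>k\<in>V. s k)"
    unfolding lasso_objective_diff s_def g_def by (auto intro!: divide_nonneg_nonneg sum_nonneg)
  ultimately have "(\<Sum>k\<in>V. s k) \<le> 0" by simp
  moreover have "s b \<le> (\<Sum>k\<in>V. s k)" using s0 b fin by (intro member_le_sum) auto
  ultimately have "s b \<le> 0" by simp
  hence "(lam - \<bar>g b\<bar>) * \<bar>\<psi> b\<bar> \<le> 0"
    using abs[of b] \<theta>0[OF b(2)] by (simp add: s_def algebra_simps)
  moreover have "lam - \<bar>g b\<bar> > 0" using strict[OF b False] by (simp add: g_def)
  ultimately show ?thesis by (simp add: mult_le_0_iff)
qed

text \<open>
  The deterministic core. Here \<open>w\<close> and \<open>z b\<close> are the vectors of observations of the residual of node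
  \<open>a\<close> given the others and of the residual of node \<open>b\<close> given \<open>N - {b}\<close>. The condition on \<open>\<beta>\<close> says that the true
  coefficients dominate both the penalty and the noise \<open>\<rho>\<close>; the condition \<open>gap\<close> leaves room for the noise
  in the strict dual certificate.
\<close>

lemma lasso_recovers_neighbourhood:
  fixes \<beta> :: "'i \<Rightarrow> real" and \<tau> :: "'i \<Rightarrow> 'i \<Rightarrow> real" and D :: "nat \<Rightarrow> 'i \<Rightarrow> real"
    and N V :: "'i set" and a :: 'i and n :: nat
  defines "w \<equiv> \<lambda>i. D i a - (\<Sum>k\<in>N. \<beta> k * D i k)"
    and "z \<equiv> \<lambda>b i. D i b - (\<Sum>k\<in>N - {b}. \<tau> b k * D i k)"
  assumes n: "n \<ge> 1" and lam: "lam > 0" and V: "finite V" "N \<subseteq> V" "a \<in> V" "a \<notin> N" and \<rho>: "\<rho> \<ge> 0"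
    and cross: "\<And>b c. b \<in> V \<Longrightarrow> b \<noteq> a \<Longrightarrow>
      \<bar>\<Sum>i\<in>{1..n}. (w i + (\<Sum>k\<in>N - {b}. c k * D i k)) * z b i\<bar>
        \<le> \<rho> * sqrt n * L2_set (\<lambda>i. w i + (\<Sum>k\<in>N - {b}. c k * D i k)) {1..n}"
    and Da: "L2_set (\<lambda>i. D i a) {1..n} \<le> 2 * sqrt n"
    and z_low: "\<And>b. b \<in> N \<Longrightarrow> \<mu> * real n \<le> (L2_set (z b) {1..n})\<^sup>2"
    and z_up: "\<And>b. b \<in> N \<Longrightarrow> L2_set (z b) {1..n} \<le> 2 * sqrt n"
    and \<beta>: "\<And>b. b \<in> N \<Longrightarrow> lam / 2 * (1 + \<theta>) + 2 * \<rho> < \<bar>\<beta> b\<bar> * (\<mu> - 2 * \<rho>)"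
    and \<tau>: "\<And>b. b \<in> N \<Longrightarrow> (\<Sum>k\<in>N - {b}. \<bar>\<tau> b k\<bar>) \<le> \<theta>"
    and S: "\<And>b. b \<in> V \<Longrightarrow> b \<notin> N \<Longrightarrow> b \<noteq> a \<Longrightarrow> \<bar>\<Sum>k\<in>N. sgn (\<beta> k) * \<tau> b k\<bar> \<le> \<delta>"
    and gap: "4 * \<rho> < (1 - \<delta>) * lam"
    and sol: "lasso_solution n V D lam a \<psi>"
  shows "lasso_support V \<psi> = N"
proof -
  have finN: "finite N" using V finite_subset by blast
  have np: "real n > 0" using n by simp
  have ss: "sqrt (real n) * (sqrt (real n) * x) = real n * x" for x
    by (simp flip: mult.assoc)
  have restricted: "(\<Sum>k\<in>V. D i k * \<phi> k) = (\<Sum>k\<in>N. \<phi> k * D i k)" if "\<And>k. k \<notin> N \<Longrightarrow> \<phi> k = 0" for \<phi> i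
    using V that by (intro sum.mono_neutral_cong_right) (auto simp: mult.commute)
  {
    fix \<phi> assume res: "restricted_solution n V D lam a N \<phi>"
    have \<phi>0: "\<phi> k = 0" if "k \<notin> N" for k
      using res that by (auto simp: restricted_solution_def is_arg_min_def)
    define r where "r = residual V D a \<phi>"
    have r_eq: "r i = D i a - (\<Sum>k\<in>N. \<phi> k * D i k)" for i
      using restricted[OF \<phi>0] by (simp add: r_def residual_def)
    have r_norm: "L2_set r {1..n} \<le> 2 * sqrt n"
    proof -
      have "lasso_objective n V D lam a \<phi> \<le> lasso_objective n V D lam a (\<lambda>_. 0)"
        using res by (auto simp: restricted_solution_def is_arg_min_linorder)
      moreover have "(L2_set r {1..n})\<^sup>2 / real n \<le> lasso_objective n V D lam a \<phi>"
        using lam by (simp add: lasso_objective_def r_def residual_def[abs_def] l1_norm_def sum_nonneg)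
      ultimately have "(L2_set r {1..n})\<^sup>2 / real n \<le> (L2_set (\<lambda>i. D i a) {1..n})\<^sup>2 / real n"
        by (simp add: lasso_objective_def l1_norm_def)
      hence "L2_set r {1..n} \<le> L2_set (\<lambda>i. D i a) {1..n}"
        using np by (intro power2_le_imp_le[of "L2_set r {1..n}"]) (auto simp: divide_le_cancel)
      thus ?thesis using Da by simp
    qed
    have score_z: "score n V D a \<phi> b = (\<Sum>k\<in>N - {b}. \<tau> b k * score n V D a \<phi> k) + (\<Sum>i\<in>{1..n}. r i * z b i)" for b
    proof -
      have "(\<Sum>i\<in>{1..n}. r i * z b i) = score n V D a \<phi> b - (\<Sum>i\<in>{1..n}. \<Sum>k\<in>N - {b}. \<tau> b k * (r i * D i k))"
        unfolding z_def score_def r_def[symmetric] right_diff_distrib sum_subtractf sum_distrib_left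
        by (simp add: mult.left_commute)
      also have "(\<Sum>i\<in>{1..n}. \<Sum>k\<in>N - {b}. \<tau> b k * (r i * D i k)) = (\<Sum>k\<in>N - {b}. \<tau> b k * score n V D a \<phi> k)"
        unfolding score_def r_def[symmetric] sum_distrib_left by (rule sum.swap)
      finally show ?thesis by simp
    qed
    have KKT: "\<bar>score n V D a \<phi> k\<bar> \<le> lam / 2 * real n"
      "\<phi> k \<noteq> 0 \<Longrightarrow> score n V D a \<phi> k = lam / 2 * real n * sgn (\<phi> k)" if "k \<in> N" for k
      using restricted_solution_KKT[OF res V(1,2) that] lam np by (auto simp: field_simps abs_mult)
    have sgn: "sgn (\<phi> b) = sgn (\<beta> b)" if b: "b \<in> N" for b
    proof (rule ccontr)
      assume neq: "sgn (\<phi> b) \<noteq> sgn (\<beta> b)"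
      have \<theta>0: "\<theta> \<ge> 0" by (rule order_trans[OF sum_nonneg \<tau>[OF b]]) auto
      have pos: "\<bar>\<beta> b\<bar> * (\<mu> - 2 * \<rho>) > 0"
        using \<beta>[OF b] lam \<rho> \<theta>0 by (smt (verit) divide_nonneg_pos mult_nonneg_nonneg)
      hence \<mu>: "\<mu> - 2 * \<rho> > 0" by (simp add: zero_less_mult_iff)
      define \<Delta> where "\<Delta> = \<beta> b - \<phi> b"
      \<comment> \<open>The fitted coefficient is zero or on the other side of zero than \<open>\<beta> b\<close>.\<close>
      have \<Delta>: "\<bar>\<Delta>\<bar> \<ge> \<bar>\<beta> b\<bar>" using neq pos by (auto simp: \<Delta>_def sgn_if split: if_splits)
      define u where "u i = w i + (\<Sum>k\<in>N - {b}. (\<beta> k - \<phi> k + \<Delta> * \<tau> b k) * D i k)" for i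
      have r_u: "r i = \<Delta> * z b i + u i" for i
        unfolding r_eq u_def z_def w_def \<Delta>_def
        by (simp add: sum.remove[OF finN b] algebra_simps sum.distrib sum_subtractf sum_distrib_left)
      have bV: "b \<in> V" "b \<noteq> a" using b V by auto
      define Z where "Z = L2_set (z b) {1..n}"
      define U where "U = L2_set u {1..n}"
      have "U \<le> L2_set r {1..n} + L2_set (\<lambda>i. \<Delta> * z b i) {1..n}"
        using L2_set_diff_le[of r "\<lambda>i. \<Delta> * z b i" "{1..n}"] by (simp add: U_def r_u)
      also have "\<dots> \<le> 2 * sqrt n + \<bar>\<Delta>\<bar> * (2 * sqrt n)"
        unfolding L2_set_cmult by (intro add_mono r_norm mult_left_mono z_up b) auto
      finally have U: "U \<le> 2 * sqrt n * (1 + \<bar>\<Delta>\<bar>)" by (simp add: algebra_simps)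
      have "\<bar>\<Sum>i\<in>{1..n}. u i * z b i\<bar> \<le> \<rho> * sqrt n * U"
        unfolding U_def u_def by (rule cross[OF bV])
      also have "\<dots> \<le> \<rho> * sqrt n * (2 * sqrt n * (1 + \<bar>\<Delta>\<bar>))"
        using \<rho> by (intro mult_left_mono U) auto
      also have "\<dots> = 2 * \<rho> * (1 + \<bar>\<Delta>\<bar>) * real n" by (simp add: algebra_simps ss)
      finally have uz: "\<bar>\<Sum>i\<in>{1..n}. u i * z b i\<bar> \<le> 2 * \<rho> * (1 + \<bar>\<Delta>\<bar>) * real n" .
      have "\<bar>\<Sum>k\<in>N - {b}. \<tau> b k * score n V D a \<phi> k\<bar> \<le> (\<Sum>k\<in>N - {b}. \<bar>\<tau> b k\<bar> * (lam / 2 * real n))"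
        by (intro order_trans[OF sum_abs] sum_mono, unfold abs_mult) (intro mult_left_mono KKT(1); auto)
      also have "\<dots> \<le> \<theta> * (lam / 2 * real n)"
        unfolding sum_distrib_right[symmetric] using lam \<tau>[OF b] by (intro mult_right_mono) auto
      finally have "\<bar>\<Sum>i\<in>{1..n}. r i * z b i\<bar> \<le> \<theta> * (lam / 2 * real n) + lam / 2 * real n"
        using score_z[of b] KKT(1)[OF b] by linarith
      hence rz: "\<bar>\<Sum>i\<in>{1..n}. r i * z b i\<bar> \<le> lam / 2 * (1 + \<theta>) * real n" by (simp add: algebra_simps)
      have "(\<Sum>i\<in>{1..n}. r i * z b i) = \<Delta> * Z\<^sup>2 + (\<Sum>i\<in>{1..n}. u i * z b i)"
        unfolding Z_def L2_set_power2 r_u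
        by (simp add: algebra_simps sum.distrib sum_distrib_left power2_eq_square)
      hence "\<bar>\<Delta>\<bar> * Z\<^sup>2 \<le> \<bar>\<Sum>i\<in>{1..n}. r i * z b i\<bar> + \<bar>\<Sum>i\<in>{1..n}. u i * z b i\<bar>"
        using abs_mult[of \<Delta> "Z\<^sup>2"] by simp
      moreover have "\<bar>\<Delta>\<bar> * (\<mu> * real n) \<le> \<bar>\<Delta>\<bar> * Z\<^sup>2"
        unfolding Z_def by (intro mult_left_mono z_low b) auto
      ultimately have "\<bar>\<Delta>\<bar> * (\<mu> * real n) \<le> lam / 2 * (1 + \<theta>) * real n + 2 * \<rho> * (1 + \<bar>\<Delta>\<bar>) * real n"
        using rz uz by linarith
      hence "(\<bar>\<Delta>\<bar> * (\<mu> - 2 * \<rho>)) * real n \<le> (lam / 2 * (1 + \<theta>) + 2 * \<rho>) * real n"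
        by (simp add: algebra_simps)
      hence "\<bar>\<Delta>\<bar> * (\<mu> - 2 * \<rho>) \<le> lam / 2 * (1 + \<theta>) + 2 * \<rho>" using np by (simp only: mult_le_cancel_right_pos)
      moreover have "\<bar>\<beta> b\<bar> * (\<mu> - 2 * \<rho>) \<le> \<bar>\<Delta>\<bar> * (\<mu> - 2 * \<rho>)" using \<mu> \<Delta> by (intro mult_right_mono) auto
      ultimately show False using \<beta>[OF b] by simp
    qed
    have \<beta>nz: "\<beta> b \<noteq> 0" if b: "b \<in> N" for b
    proof -
      have "\<theta> \<ge> 0" by (rule order_trans[OF sum_nonneg \<tau>[OF b]]) auto
      hence "0 \<le> lam / 2 * (1 + \<theta>) + 2 * \<rho>" using lam \<rho> by simp
      thus ?thesis using \<beta>[OF b] by auto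
    qed
    have nz: "\<phi> b \<noteq> 0" if b: "b \<in> N" for b
      using sgn[OF b] \<beta>nz[OF b] by (auto simp: sgn_if split: if_splits)
    have strict: "\<bar>2 / real n * score n V D a \<phi> b\<bar> < lam" if b: "b \<in> V" "b \<notin> N" "b \<noteq> a" for b
    proof -
      have r_u: "r i = w i + (\<Sum>k\<in>N - {b}. (\<beta> k - \<phi> k) * D i k)" for i
        using b unfolding r_eq w_def by (simp add: algebra_simps sum_subtractf)
      have "\<bar>\<Sum>i\<in>{1..n}. r i * z b i\<bar> \<le> \<rho> * sqrt n * L2_set r {1..n}"
        unfolding r_u by (rule cross[OF b(1,3)])
      also have "\<dots> \<le> \<rho> * sqrt n * (2 * sqrt n)" using \<rho> by (intro mult_left_mono r_norm) auto
      finally have rz: "\<bar>\<Sum>i\<in>{1..n}. r i * z b i\<bar> \<le> 2 * \<rho> * real n" by (simp add: algebra_simps ss)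
      have "(\<Sum>k\<in>N - {b}. \<tau> b k * score n V D a \<phi> k) = (\<Sum>k\<in>N. lam / 2 * real n * (sgn (\<beta> k) * \<tau> b k))"
        using b KKT(2) nz sgn by (intro sum.cong) auto
      also have "\<bar>\<dots>\<bar> = lam / 2 * real n * \<bar>\<Sum>k\<in>N. sgn (\<beta> k) * \<tau> b k\<bar>"
        unfolding sum_distrib_left[symmetric] using lam by (simp add: abs_mult)
      also have "\<dots> \<le> lam / 2 * real n * \<delta>" using lam by (intro mult_left_mono S b) auto
      finally have "\<bar>score n V D a \<phi> b\<bar> \<le> (lam / 2 * \<delta> + 2 * \<rho>) * real n"
        using rz score_z[of b] by (simp add: algebra_simps)
      also have "\<dots> < (lam / 2) * real n"
        using gap np by (intro mult_strict_right_mono) (auto simp: algebra_simps)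
      finally show ?thesis using np by (simp add: abs_mult field_simps)
    qed
    note nz strict
  } note facts = this
  obtain \<phi> where \<phi>: "restricted_solution n V D lam a N \<phi>"
    using restricted_solution_exists[OF lam V(1,2)] by blast
  have \<psi>0: "\<psi> k = 0" if "k \<in> V" "k \<notin> N" for k
    by (rule lasso_solution_vanishes[OF \<phi> lam V(1,2,4) facts(2)[OF \<phi>] sol that])
  define \<psi>' where "\<psi>' = (\<lambda>k. if k \<in> N then \<psi> k else 0)"
  have same: "\<psi>' k = \<psi> k" if "k \<in> V" for k using \<psi>0 that by (auto simp: \<psi>'_def)
  have obj: "lasso_objective n V D lam a \<psi>' = lasso_objective n V D lam a \<psi>"
    using same by (simp add: lasso_objective_def l1_norm_def cong: sum.cong)
  have "restricted_solution n V D lam a N \<psi>'"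
    using sol V(4) by (auto simp: restricted_solution_def lasso_solution_def is_arg_min_linorder obj) (simp add: \<psi>'_def)
  from facts(1)[OF this] have "\<psi> k \<noteq> 0" if "k \<in> N" for k
    using that by (auto simp: \<psi>'_def)
  thus ?thesis using \<psi>0 V(2) by (auto simp: lasso_support_def)
qed

section \<open>A uniform bound over the span of a few columns\<close>

text \<open>
  Spacing \<open>1 / (4 * m)\<close> puts every point of the unit ball within Euclidean distance
  \<open>sqrt m / (4 * m) \<le> 1 / 4\<close> of the grid.
\<close>

definition grid :: "nat \<Rightarrow> (nat \<Rightarrow> real) set" where
  "grid m = PiE {..<m} (\<lambda>_. (\<lambda>j::int. of_int j / (4 * real m)) ` {- 4 * int m..4 * int m})"

lemma finite_grid: "finite (grid m)"
  unfolding grid_def by (intro finite_PiE) auto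

lemma card_grid_le: "card (grid m) \<le> (8 * m + 1) ^ m"
proof -
  have "card ((\<lambda>j::int. of_int j / (4 * real m)) ` {- 4 * int m..4 * int m}) \<le> card {- 4 * int m..4 * int m}"
    by (intro card_image_le) auto
  also have "\<dots> = 8 * m + 1" by simp
  finally show ?thesis
    unfolding grid_def by (subst card_PiE) (auto intro!: power_mono)
qed

lemma grid_approximates:
  assumes "L2_set c {..<m} \<le> 1"
  shows "\<exists>g\<in>grid m. L2_set (\<lambda>j. c j - g j) {..<m} \<le> 1 / 4"
proof -
  define g where "g = (\<lambda>j\<in>{..<m}. of_int \<lfloor>4 * real m * c j\<rfloor> / (4 * real m))"
  have cj: "\<bar>c j\<bar> \<le> 1" if "j < m" for j
    using member_le_L2_set[of "{..<m}" j "\<lambda>j. \<bar>c j\<bar>"] that order_trans[OF _ assms] by (simp add: L2_set_def)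
  have g: "g \<in> grid m"
    unfolding grid_def g_def
  proof (intro restrict_PiE_iff[THEN iffD2] ballI imageI)
    fix j assume "j \<in> {..<m}"
    hence "\<bar>c j\<bar> \<le> 1" using cj by auto
    hence "- (4 * real m) \<le> 4 * real m * c j" "4 * real m * c j \<le> 4 * real m * 1"
      using mult_left_mono[of "-1" "c j" "4 * real m"] mult_left_mono[of "c j" 1 "4 * real m"] by auto
    thus "\<lfloor>4 * real m * c j\<rfloor> \<in> {- 4 * int m..4 * int m}"
      by (auto simp: le_floor_iff floor_le_iff)
  qed
  have e: "\<bar>c j - g j\<bar> \<le> 1 / (4 * real m)" if j: "j < m" for j
  proof -
    have "\<bar>4 * real m * c j - of_int \<lfloor>4 * real m * c j\<rfloor>\<bar> \<le> 1" by linarith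
    moreover have "4 * real m * (c j - g j) = 4 * real m * c j - of_int \<lfloor>4 * real m * c j\<rfloor>"
      using j by (simp add: g_def field_simps)
    ultimately have "\<bar>4 * real m * (c j - g j)\<bar> \<le> 1" by simp
    hence "4 * real m * \<bar>c j - g j\<bar> \<le> 1" by (simp add: abs_mult)
    thus ?thesis using j by (simp add: field_simps)
  qed
  have "L2_set (\<lambda>j. c j - g j) {..<m} \<le> (\<Sum>j<m. \<bar>c j - g j\<bar>)" by (rule L2_set_le_sum_abs)
  also have "\<dots> \<le> (\<Sum>j<m. 1 / (4 * real m))" using e by (intro sum_mono) auto
  also have "\<dots> \<le> 1 / 4" by (cases "m = 0") auto
  finally show ?thesis using g by blast
qed

text \<open>
  The columns of \<open>F\<close> stand for data from an orthonormal system and \<open>z\<close> for data from a unit vector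
  orthogonal to it, so that \<open>n\<close> times the squared norm of the coefficients is the expected squared
  norm. On the grid, polarization bounds the linear form \<open>c \<mapsto> \<langle>F c, z\<rangle>\<close> by \<open>3 / 2 * \<eta> * n\<close>; replacing a
  point of the unit ball by the nearest grid point costs a quarter of the supremum, for this form as for
  the seminorm \<open>c \<mapsto> \<bar>F c\<bar>\<close>. This yields an upper bound for the form and a lower bound \<open>sqrt n / 10\<close> for the
  seminorm on the unit sphere, whose quotient is the claim.
\<close>

lemma grid_cross_bound:
  fixes F :: "'r \<Rightarrow> nat \<Rightarrow> real" and z :: "'r \<Rightarrow> real" and n \<eta> :: real
  assumes n: "n > 0" and \<eta>: "0 \<le> \<eta>" "\<eta> \<le> 1 / 4"
    and norm: "\<And>g. g \<in> grid m \<Longrightarrow>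
      \<bar>(\<Sum>i\<in>I. (\<Sum>j<m. g j * F i j)\<^sup>2) - n * (\<Sum>j<m. (g j)\<^sup>2)\<bar> \<le> \<eta> * (n * (\<Sum>j<m. (g j)\<^sup>2))"
    and plus: "\<And>g. g \<in> grid m \<Longrightarrow>
      \<bar>(\<Sum>i\<in>I. ((\<Sum>j<m. g j * F i j) + z i)\<^sup>2) - n * ((\<Sum>j<m. (g j)\<^sup>2) + 1)\<bar> \<le> \<eta> * (n * ((\<Sum>j<m. (g j)\<^sup>2) + 1))"
    and minus: "\<And>g. g \<in> grid m \<Longrightarrow>
      \<bar>(\<Sum>i\<in>I. ((\<Sum>j<m. g j * F i j) - z i)\<^sup>2) - n * ((\<Sum>j<m. (g j)\<^sup>2) + 1)\<bar> \<le> \<eta> * (n * ((\<Sum>j<m. (g j)\<^sup>2) + 1))"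
  shows "\<bar>\<Sum>i\<in>I. (\<Sum>j<m. c j * F i j) * z i\<bar> \<le> 20 * \<eta> * sqrt n * L2_set (\<lambda>i. \<Sum>j<m. c j * F i j) I"
proof -
  define N where "N c = L2_set (\<lambda>i. \<Sum>j<m. c j * F i j) I" for c
  define nc where "nc c = L2_set c {..<m}" for c :: "nat \<Rightarrow> real"
  define l where "l j = (\<Sum>i\<in>I. F i j * z i)" for j
  have l: "(\<Sum>i\<in>I. (\<Sum>j<m. c j * F i j) * z i) = (\<Sum>j<m. c j * l j)" for c
    unfolding l_def sum_distrib_left sum_distrib_right
    by (subst sum.swap) (simp add: mult.assoc)
  have nc2: "(nc c)\<^sup>2 = (\<Sum>j<m. (c j)\<^sup>2)" for c by (simp add: nc_def L2_set_power2)
  have N_cmult: "N (\<lambda>j. a * c j) = \<bar>a\<bar> * N c" for a c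
    unfolding N_def L2_set_cmult[symmetric] by (simp add: sum_distrib_left mult.assoc)
  have nc_cmult: "nc (\<lambda>j. a * c j) = \<bar>a\<bar> * nc c" for a c
    unfolding nc_def L2_set_cmult ..
  have N_add: "N (\<lambda>j. b j + c j) \<le> N b + N c" for b c
    unfolding N_def using L2_set_triangle_ineq[of "\<lambda>i. \<Sum>j<m. b j * F i j" "\<lambda>i. \<Sum>j<m. c j * F i j" I]
    by (simp add: algebra_simps sum.distrib)
  have nc_add: "nc (\<lambda>j. b j + c j) \<le> nc b + nc c" for b c
    unfolding nc_def by (rule L2_set_triangle_ineq)
  have N0[simp]: "N c \<ge> 0" "nc c \<ge> 0" for c by (auto simp: N_def nc_def)
  have approx: "\<exists>g\<in>grid m. nc (\<lambda>j. c j - g j) \<le> 1 / 4 \<and> nc g \<le> 5 / 4 \<and> nc c - 1 / 4 \<le> nc g" if "nc c \<le> 1" for c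
  proof -
    obtain g where g: "g \<in> grid m" "nc (\<lambda>j. c j - g j) \<le> 1 / 4"
      using grid_approximates[of c m] \<open>nc c \<le> 1\<close> by (auto simp: nc_def)
    have m: "nc (\<lambda>j. g j - c j) = nc (\<lambda>j. c j - g j)"
      by (simp add: nc_def L2_set_def power2_commute)
    show ?thesis using g m that nc_add[of "\<lambda>j. g j - c j" c] nc_add[of "\<lambda>j. c j - g j" g] by force
  qed
  have gcross: "\<bar>\<Sum>j<m. g j * l j\<bar> \<le> 3 / 2 * \<eta> * n" if g: "g \<in> grid m" "nc g \<le> 5 / 4" for g
  proof -
    have "4 * (\<Sum>j<m. g j * l j) = (\<Sum>i\<in>I. ((\<Sum>j<m. g j * F i j) + z i)\<^sup>2) - (\<Sum>i\<in>I. ((\<Sum>j<m. g j * F i j) - z i)\<^sup>2)"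
      unfolding l[symmetric] sum_subtractf[symmetric] sum_distrib_left
      by (intro sum.cong refl) (simp add: power2_eq_square algebra_simps)
    also have "\<bar>\<dots>\<bar> \<le> 2 * (\<eta> * (n * ((nc g)\<^sup>2 + 1)))"
      using plus[OF g(1)] minus[OF g(1)] unfolding nc2 by linarith
    also have "(nc g)\<^sup>2 \<le> (5 / 4)\<^sup>2" using g(2) by (intro power_mono) auto
    hence "\<eta> * (n * ((nc g)\<^sup>2 + 1)) \<le> \<eta> * (n * 3)"
      using n \<eta> by (intro mult_left_mono) (auto simp: power2_eq_square)
    finally show ?thesis by simp
  qed
  have L: "nc l \<le> 2 * \<eta> * n"
  proof (cases "nc l = 0")
    case True
    thus ?thesis using n \<eta> by simp
  next
    case False
    hence p: "nc l > 0" using N0(2)[of l] by linarith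
    \<comment> \<open>The unit vector at which the linear form attains its norm.\<close>
    define u where "u = (\<lambda>j. inverse (nc l) * l j)"
    have "nc u = 1" using p unfolding u_def nc_cmult by simp
    then obtain g where g: "g \<in> grid m" "nc (\<lambda>j. u j - g j) \<le> 1 / 4" "nc g \<le> 5 / 4"
      using approx[of u] by auto
    have "nc l = (\<Sum>j<m. u j * l j)"
    proof -
      have "(\<Sum>j<m. u j * l j) = inverse (nc l) * (nc l)\<^sup>2"
        unfolding nc2 u_def sum_distrib_left by (simp add: power2_eq_square mult.assoc)
      thus ?thesis using p by (simp add: power2_eq_square)
    qed
    also have "\<dots> = (\<Sum>j<m. g j * l j) + (\<Sum>j<m. (u j - g j) * l j)"
      by (simp add: algebra_simps sum.distrib[symmetric])
    also have "\<dots> \<le> 3 / 2 * \<eta> * n + nc (\<lambda>j. u j - g j) * nc l"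
      using gcross[OF g(1,3)] inner_le_L2_set[of "\<lambda>j. u j - g j" l "{..<m}"]
      by (simp add: nc_def)
    also have "nc (\<lambda>j. u j - g j) * nc l \<le> 1 / 4 * nc l"
      using g(2) by (intro mult_right_mono) auto
    finally show ?thesis by simp
  qed
  have up: "\<bar>\<Sum>j<m. c j * l j\<bar> \<le> 2 * \<eta> * n * nc c" for c
  proof -
    have "\<bar>\<Sum>j<m. c j * l j\<bar> \<le> nc c * nc l" unfolding nc_def by (rule inner_le_L2_set)
    also have "\<dots> \<le> nc c * (2 * \<eta> * n)" by (intro mult_left_mono L) auto
    finally show ?thesis by (simp add: mult.commute)
  qed
  have N2: "\<bar>(N g)\<^sup>2 - n * (nc g)\<^sup>2\<bar> \<le> 1 / 4 * (n * (nc g)\<^sup>2)" if "g \<in> grid m" for g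
  proof -
    have "\<bar>(N g)\<^sup>2 - n * (nc g)\<^sup>2\<bar> \<le> \<eta> * (n * (nc g)\<^sup>2)"
      using norm[OF that] unfolding nc2 N_def L2_set_power2 .
    also have "\<dots> \<le> 1 / 4 * (n * (nc g)\<^sup>2)" using n \<eta> by (intro mult_right_mono) auto
    finally show ?thesis .
  qed
  have gup: "N g \<le> 7 / 5 * sqrt n" if g: "g \<in> grid m" "nc g \<le> 5 / 4" for g
  proof (rule power2_le_imp_le)
    have "(nc g)\<^sup>2 \<le> (5 / 4)\<^sup>2" using g(2) by (intro power_mono) auto
    hence "n * (nc g)\<^sup>2 \<le> n * (5 / 4)\<^sup>2" using n by (intro mult_left_mono) auto
    moreover have "(7 / 5 * sqrt n)\<^sup>2 = 49 / 25 * n"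
      using n unfolding power_mult_distrib by (simp add: power2_eq_square)
    moreover have "n * (5 / 4)\<^sup>2 = 25 / 16 * n" by (simp add: power2_eq_square)
    ultimately show "(N g)\<^sup>2 \<le> (7 / 5 * sqrt n)\<^sup>2"
      using N2[OF g(1)] n unfolding abs_le_iff by linarith
  qed (use n in auto)
  have glow: "16 / 25 * sqrt n \<le> N g" if g: "g \<in> grid m" "3 / 4 \<le> nc g" for g
  proof (rule power2_le_imp_le)
    have "(3 / 4)\<^sup>2 \<le> (nc g)\<^sup>2" using g(2) by (intro power_mono) auto
    hence "n * (3 / 4)\<^sup>2 \<le> n * (nc g)\<^sup>2" using n by (intro mult_left_mono) auto
    moreover have "(16 / 25 * sqrt n)\<^sup>2 = 256 / 625 * n"
      using n unfolding power_mult_distrib by (simp add: power2_eq_square)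
    moreover have "n * (3 / 4)\<^sup>2 = 9 / 16 * n" by (simp add: power2_eq_square)
    ultimately show "(16 / 25 * sqrt n)\<^sup>2 \<le> (N g)\<^sup>2"
      using N2[OF g(1)] n unfolding abs_le_iff by linarith
  qed auto
  \<comment> \<open>Between grid points the seminorm is controlled only through its supremum over the unit ball,
    which therefore has to be bounded before any lower bound.\<close>
  define S where "S = {N c |c. nc c \<le> 1}"
  have bdd: "bdd_above S"
  proof (rule bdd_aboveI)
    fix x assume "x \<in> S"
    then obtain c where c: "x = N c" "nc c \<le> 1" by (auto simp: S_def)
    have "N c \<le> (\<Sum>i\<in>I. \<bar>\<Sum>j<m. c j * F i j\<bar>)" unfolding N_def by (rule L2_set_le_sum_abs)
    also have "\<dots> \<le> (\<Sum>i\<in>I. 1 * L2_set (F i) {..<m})"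
    proof (intro sum_mono)
      fix i
      have "\<bar>\<Sum>j<m. c j * F i j\<bar> \<le> nc c * L2_set (F i) {..<m}" unfolding nc_def by (rule inner_le_L2_set)
      also have "\<dots> \<le> 1 * L2_set (F i) {..<m}" using c by (intro mult_right_mono) auto
      finally show "\<bar>\<Sum>j<m. c j * F i j\<bar> \<le> 1 * L2_set (F i) {..<m}" .
    qed
    finally show "x \<le> (\<Sum>i\<in>I. 1 * L2_set (F i) {..<m})" by (simp add: c)
  qed
  have NS: "N c \<le> Sup S * \<alpha>" if "nc c \<le> \<alpha>" "\<alpha> > 0" for c \<alpha>
  proof -
    have "nc (\<lambda>j. inverse \<alpha> * c j) \<le> 1"
      unfolding nc_cmult using that by (simp add: field_simps)
    hence "N (\<lambda>j. inverse \<alpha> * c j) \<le> Sup S" by (intro cSup_upper bdd) (auto simp: S_def)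
    thus ?thesis unfolding N_cmult using that by (simp add: field_simps)
  qed
  have split: "N c \<le> N g + Sup S / 4" "N g \<le> N c + Sup S / 4" if "nc (\<lambda>j. c j - g j) \<le> 1 / 4" for c g
  proof -
    have "nc (\<lambda>j. g j - c j) \<le> 1 / 4"
      using that by (simp add: nc_def L2_set_def power2_commute)
    thus "N c \<le> N g + Sup S / 4" "N g \<le> N c + Sup S / 4"
      using NS[OF that] NS[of "\<lambda>j. g j - c j" "1 / 4"] N_add[of g "\<lambda>j. c j - g j"] N_add[of c "\<lambda>j. g j - c j"]
      by simp_all
  qed
  have "Sup S \<le> 7 / 5 * sqrt n + Sup S / 4"
  proof (rule cSup_least)
    have "N (\<lambda>_. 0) \<in> S" by (auto simp: S_def nc_def L2_set_def intro!: exI[of _ "\<lambda>_. 0"])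
    thus "S \<noteq> {}" by auto
    fix x assume "x \<in> S"
    then obtain c where c: "x = N c" "nc c \<le> 1" by (auto simp: S_def)
    then obtain g where g: "g \<in> grid m" "nc (\<lambda>j. c j - g j) \<le> 1 / 4" "nc g \<le> 5 / 4"
      using approx[of c] by auto
    show "x \<le> 7 / 5 * sqrt n + Sup S / 4" using gup[OF g(1,3)] split(1)[OF g(2)] c by simp
  qed
  hence S: "Sup S / 4 \<le> 12 / 25 * sqrt n" using real_sqrt_ge_zero[of n] n by linarith
  have low1: "1 / 10 * sqrt n \<le> N c" if c: "nc c = 1" for c
  proof -
    obtain g where g: "g \<in> grid m" "nc (\<lambda>j. c j - g j) \<le> 1 / 4" "3 / 4 \<le> nc g"
      using approx[of c] c by force
    have "N g \<le> N c + 12 / 25 * sqrt n" using split(2)[OF g(2)] S by linarith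
    moreover have "sqrt n \<ge> 0" using n by simp
    ultimately show ?thesis using glow[OF g(1,3)] by linarith
  qed
  have low: "1 / 10 * sqrt n * nc c \<le> N c" for c
  proof (cases "nc c = 0")
    case False
    hence p: "nc c > 0" using N0(2)[of c] by linarith
    have "1 / 10 * sqrt n \<le> N (\<lambda>j. inverse (nc c) * c j)"
      using p by (intro low1) (unfold nc_cmult, simp)
    thus ?thesis unfolding N_cmult using p by (simp add: field_simps)
  qed simp
  have "\<bar>\<Sum>j<m. c j * l j\<bar> \<le> 20 * \<eta> * sqrt n * (1 / 10 * sqrt n * nc c)"
  proof -
    have "sqrt n * sqrt n = n" using n by simp
    hence "20 * \<eta> * sqrt n * (1 / 10 * sqrt n * nc c) = 2 * \<eta> * n * nc c" by (simp add: algebra_simps)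
    thus ?thesis using up[of c] by (simp only:)
  qed
  also have "\<dots> \<le> 20 * \<eta> * sqrt n * N c" using n \<eta> by (intro mult_left_mono low) auto
  finally show ?thesis unfolding l N_def .
qed

section \<open>The law of a random vector is determined by its linear combinations\<close>

text \<open>
  Normalizing the weight \<open>h\<close> makes \<open>B \<mapsto> (\<integral>x. h x * indicator B (Y x) \<partial>P)\<close> a probability law on the line, and
  the assumption \<open>eq\<close> (phases \<open>0\<close> and \<open>- pi / 2\<close>) says that its characteristic function is the same under
  \<open>P\<close> and \<open>Q\<close>.
\<close>

lemma weighted_law_eq:
  fixes h Y :: "'a \<Rightarrow> real"
  assumes PQ: "prob_space P" "prob_space Q" "sets Q = sets P"
    and meas: "h \<in> borel_measurable P" "Y \<in> borel_measurable P"
    and h: "\<And>x. 0 \<le> h x" "\<And>x. h x \<le> C"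
    and eq: "\<And>u \<phi>. (\<integral>x. h x * cos (u * Y x + \<phi>) \<partial>P) = (\<integral>x. h x * cos (u * Y x + \<phi>) \<partial>Q)"
    and B: "B \<in> sets borel"
  shows "(\<integral>x. h x * indicator B (Y x) \<partial>P) = (\<integral>x. h x * indicator B (Y x) \<partial>Q)"
proof -
  define H where "H = (\<integral>x. h x \<partial>P)"
  have M: "prob_space M" "h \<in> borel_measurable M" "Y \<in> borel_measurable M" "(\<integral>x. h x \<partial>M) = H"
    if "M = P \<or> M = Q" for M
    using that PQ meas eq[of 0 0] measurable_cong_sets[OF PQ(3) refl] by (auto simp: H_def)
  have int: "integrable M (\<lambda>x. h x * f x)"
    if M': "M = P \<or> M = Q" and f: "f \<in> borel_measurable M" "\<And>x. \<bar>f x\<bar> \<le> 1" for M f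
  proof -
    interpret prob_space M by (rule M(1)[OF M'])
    have "\<bar>h x\<bar> * \<bar>f x\<bar> \<le> C * 1" for x
      using h[of x] f(2)[of x] by (intro mult_mono) auto
    thus ?thesis using M(2)[OF M'] f(1)
      by (intro integrable_const_bound[of _ C]) (auto simp: abs_mult)
  qed
  show ?thesis
  proof (cases "H = 0")
    case True
    have "(\<integral>x. h x * indicator B (Y x) \<partial>M) = 0" if M': "M = P \<or> M = Q" for M
    proof -
      have i: "integrable M h" using int[OF M', of "\<lambda>_. 1"] by simp
      have "AE x in M. h x = 0"
        using integral_nonneg_eq_0_iff_AE[OF i] M(4)[OF M'] True h by simp
      thus ?thesis by (intro integral_eq_zero_AE) auto
    qed
    thus ?thesis by simp
  next
    case False
    have "H \<ge> 0" unfolding H_def by (rule integral_nonneg_AE) (simp add: h)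
    with False have H: "H > 0" by simp
    define \<nu> where "\<nu> M = distr (density M (\<lambda>x. ennreal (h x / H))) borel Y" for M
    have rd: "real_distribution (\<nu> M)" if M': "M = P \<or> M = Q" for M
    proof -
      note [measurable] = M(2,3)[OF M']
      have "(\<integral>\<^sup>+x. ennreal (h x / H) \<partial>M) = ennreal (\<integral>x. h x / H \<partial>M)"
        using int[OF M', of "\<lambda>_. 1"] h H by (intro nn_integral_eq_integral) auto
      also have "\<dots> = 1" using M(4)[OF M'] H by simp
      finally have "prob_space (density M (\<lambda>x. ennreal (h x / H)))"
        by (intro prob_spaceI) (simp add: emeasure_density cong: nn_integral_cong)
      thus ?thesis unfolding \<nu>_def by (intro prob_space.real_distribution_distr) auto
    qed
    have int_\<nu>: "integral\<^sup>L (\<nu> M) f = (\<integral>x. (h x / H) *\<^sub>R f (Y x) \<partial>M)"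
      if M': "M = P \<or> M = Q" and [measurable]: "f \<in> borel_measurable borel"
      for M and f :: "real \<Rightarrow> 'd::{banach, second_countable_topology}"
    proof -
      note [measurable] = M(2,3)[OF M']
      show ?thesis unfolding \<nu>_def
        using h H by (subst integral_distr, simp, simp, subst integral_density) auto
    qed
    have char_\<nu>: "char (\<nu> M) u = Complex ((\<integral>x. h x * cos (u * Y x + 0) \<partial>M) / H)
        ((\<integral>x. h x * cos (u * Y x + - (pi / 2)) \<partial>M) / H)" if M': "M = P \<or> M = Q" for M u
    proof -
      note [measurable] = M(2,3)[OF M']
      have e: "char (\<nu> M) u = (\<integral>x. (h x / H) *\<^sub>R iexp (u * Y x) \<partial>M)"
        unfolding char_def by (rule int_\<nu>[OF M']) auto
      have s: "sin x = cos (x + - (pi / 2))" for x :: real by (simp add: cos_sin_eq[of "x - _"] cos_diff)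
      have eqf: "(h x / H) *\<^sub>R iexp (u * Y x)
          = Complex (h x * cos (u * Y x + 0) / H) (h x * cos (u * Y x + - (pi / 2)) / H)" for x
        unfolding s[symmetric] by (simp add: complex_eq_iff Re_exp Im_exp)
      have i: "integrable M (\<lambda>x. h x * cos (u * Y x + \<phi>) / H)" for \<phi>
        using int[OF M', of "\<lambda>x. cos (u * Y x + \<phi>)"] by simp
      have I: "integrable M (\<lambda>x. (h x / H) *\<^sub>R iexp (u * Y x))"
        unfolding eqf Complex_eq
        by (intro Bochner_Integration.integrable_add Bochner_Integration.integrable_mult_right
            Bochner_Integration.integrable_of_real i)
      have "Re (\<integral>x. (h x / H) *\<^sub>R iexp (u * Y x) \<partial>M) = (\<integral>x. h x * cos (u * Y x + 0) / H \<partial>M)"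
        by (subst integral_Re[OF I, symmetric]) (simp only: eqf complex.sel)
      moreover have "Im (\<integral>x. (h x / H) *\<^sub>R iexp (u * Y x) \<partial>M) = (\<integral>x. h x * cos (u * Y x + - (pi / 2)) / H \<partial>M)"
        by (subst integral_Im[OF I, symmetric]) (simp only: eqf complex.sel)
      ultimately show ?thesis unfolding e complex_eq_iff by simp
    qed
    have "\<nu> P = \<nu> Q"
    proof (rule Levy_uniqueness)
      show "char (\<nu> P) = char (\<nu> Q)"
        by (rule ext) (unfold char_\<nu>[OF disjI1[OF refl]] char_\<nu>[OF disjI2[OF refl]] eq, rule refl)
    qed (simp_all add: rd)
    moreover have "integral\<^sup>L (\<nu> M) (indicator B :: real \<Rightarrow> real) = (\<integral>x. (h x / H) *\<^sub>R indicator B (Y x) \<partial>M)"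
      if "M = P \<or> M = Q" for M
      by (rule int_\<nu>[OF that]) (use B in auto)
    ultimately have "(\<integral>x. (h x / H) *\<^sub>R indicator B (Y x) \<partial>P) = (\<integral>x. (h x / H) *\<^sub>R (indicator B (Y x) :: real) \<partial>Q)"
      by metis
    thus ?thesis using H by simp
  qed
qed

text \<open>
  One coordinate at a time, trigonometric factors are exchanged for indicators: if the integrals of
  \<open>W J B\<close> (a product of indicators of the coordinates in \<open>J\<close>) times a cosine of the remaining coordinates
  agree, so do those with one more indicator. The one-dimensional uniqueness theorem needs nonnegative
  weights, which \<open>W J B\<close> and \<open>W J B * (1 + cos \<Theta>)\<close> are; their difference is the desired integrand.
\<close>

theorem cramer_wold:
  fixes P Q :: "('i \<Rightarrow> real) measure"
  assumes PQ: "prob_space P" "prob_space Q" and I: "finite I"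
    and sets: "sets P = sets (PiM I (\<lambda>_. borel))" "sets Q = sets (PiM I (\<lambda>_. borel))"
    and lin: "\<And>t. distr P borel (\<lambda>x. \<Sum>k\<in>I. t k * x k) = distr Q borel (\<lambda>x. \<Sum>k\<in>I. t k * x k)"
  shows "P = Q"
proof -
  have sQP: "sets Q = sets P" by (simp add: sets)
  define W where "W J B x = (\<Prod>j\<in>J. indicator (B j) (x j) :: real)" for J B and x :: "'i \<Rightarrow> real"
  have W_bnd: "0 \<le> W J B x" "W J B x \<le> 1" for J B x
    unfolding W_def by (auto intro!: prod_nonneg prod_le_1)
  have Mcong: "borel_measurable M = borel_measurable (PiM I (\<lambda>_. borel :: real measure))"
    if "M = P \<or> M = Q" for M using that sets by (auto intro!: measurable_cong_sets)
  have X_meas: "(\<lambda>x. x k) \<in> borel_measurable M" if "M = P \<or> M = Q" "k \<in> I" for k M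
    unfolding Mcong[OF that(1)] using that(2) by measurable
  have W_meas: "W J B \<in> borel_measurable M"
    if "M = P \<or> M = Q" "J \<subseteq> I" "\<And>j. j \<in> J \<Longrightarrow> B j \<in> sets borel" for J B M
    unfolding W_def[abs_def] using that X_meas
    by (auto intro!: borel_measurable_prod measurable_compose[OF _ borel_measurable_indicator])
  have L_meas: "(\<lambda>x. \<Sum>k\<in>J. t k * x k) \<in> borel_measurable M" if "M = P \<or> M = Q" "J \<subseteq> I" for J t M
    using X_meas[OF that(1)] that(2) by (auto intro!: borel_measurable_sum borel_measurable_times)
  have main: "\<forall>B \<phi> t. (\<forall>j\<in>J. B j \<in> sets borel) \<longrightarrow>
      (\<integral>x. W J B x * cos ((\<Sum>k\<in>I - J. t k * x k) + \<phi>) \<partial>P)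
      = (\<integral>x. W J B x * cos ((\<Sum>k\<in>I - J. t k * x k) + \<phi>) \<partial>Q)" if "finite J" "J \<subseteq> I" for J
    using that
  proof (induction J rule: finite_induct)
    case empty
    show ?case
    proof (intro allI impI)
      fix \<phi> :: real and t :: "'i \<Rightarrow> real"
      have "(\<integral>x. cos ((\<Sum>k\<in>I. t k * x k) + \<phi>) \<partial>P) = (\<integral>y. cos (y + \<phi>) \<partial>distr P borel (\<lambda>x. \<Sum>k\<in>I. t k * x k))"
        using L_meas[of P I] by (subst integral_distr) auto
      also have "\<dots> = (\<integral>x. cos ((\<Sum>k\<in>I. t k * x k) + \<phi>) \<partial>Q)"
        unfolding lin using L_meas[of Q I] by (subst integral_distr) auto
      finally show "(\<integral>x. W {} B x * cos ((\<Sum>k\<in>I - {}. t k * x k) + \<phi>) \<partial>P)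
        = (\<integral>x. W {} B x * cos ((\<Sum>k\<in>I - {}. t k * x k) + \<phi>) \<partial>Q)" for B
        by (simp add: W_def)
    qed
  next
    case (insert i J)
    have JI: "J \<subseteq> I" "i \<in> I" "i \<in> I - J" using insert by auto
    show ?case
    proof (intro allI impI)
      fix B :: "'i \<Rightarrow> real set" and \<phi> :: real and t :: "'i \<Rightarrow> real"
      assume B: "\<forall>j\<in>insert i J. B j \<in> sets borel"
      define R where "R = I - insert i J"
      define \<Theta> where "\<Theta> x = (\<Sum>k\<in>R. t k * x k) + \<phi>" for x
      have split_sum: "(\<Sum>k\<in>I - J. t' k * x k) = t' i * x i + (\<Sum>k\<in>R. t' k * x k)" for t' x :: "'i \<Rightarrow> real"
      proof -
        have e: "I - J = insert i R" and R: "i \<notin> R" "finite R" using JI I by (auto simp: R_def)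
        show ?thesis unfolding e by (rule sum.insert[OF R(2,1)])
      qed
      have IH: "(\<integral>x. W J B x * cos (u * x i + s * (\<Sum>k\<in>R. t k * x k) + \<psi>) \<partial>P)
          = (\<integral>x. W J B x * cos (u * x i + s * (\<Sum>k\<in>R. t k * x k) + \<psi>) \<partial>Q)" for u s \<psi>
      proof -
        define t' where "t' k = (if k = i then u else s * t k)" for k
        have "(\<Sum>k\<in>R. t' k * x k) = s * (\<Sum>k\<in>R. t k * x k)" for x :: "'i \<Rightarrow> real"
          unfolding sum_distrib_left by (intro sum.cong) (auto simp: t'_def R_def)
        hence e: "(\<Sum>k\<in>I - J. t' k * x k) = u * x i + s * (\<Sum>k\<in>R. t k * x k)" for x
          unfolding split_sum by (simp add: t'_def)
        show ?thesis using insert.IH[OF JI(1), rule_format, of B t' \<psi>] B unfolding e by simp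
      qed
      have ms: "W J B \<in> borel_measurable M" "(\<lambda>x. x i) \<in> borel_measurable M" "\<Theta> \<in> borel_measurable M"
        if "M = P \<or> M = Q" for M
        using W_meas[OF that JI(1)] L_meas[OF that, of R] X_meas[OF that JI(2)] B
        unfolding \<Theta>_def[abs_def] by (auto simp: R_def)
      have int: "integrable M (\<lambda>x. W J B x * f x)"
        if M: "M = P \<or> M = Q" and f: "f \<in> borel_measurable M" "\<And>x. \<bar>f x\<bar> \<le> 2" for f M
      proof -
        interpret prob_space M using M PQ by auto
        have "\<bar>W J B x\<bar> * \<bar>f x\<bar> \<le> 1 * 2" for x using W_bnd[of J B x] f(2)[of x] by (intro mult_mono) auto
        thus ?thesis using ms(1)[OF M] f(1) by (intro integrable_const_bound[of _ 2]) (auto simp: abs_mult)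
      qed
      have intc: "integrable M (\<lambda>x. W J B x * cos (f x))"
        if "M = P \<or> M = Q" "f \<in> borel_measurable M" for f M
        using that by (intro int) (auto intro: order_trans[OF abs_cos_le_one])
      have expand: "w * (1 + cos \<theta>) * cos (y + \<psi>)
          = w * cos (y + \<psi>) + (w * cos (y + \<theta> + \<psi>) + w * cos (y - \<theta> + \<psi>)) / 2" for w \<theta> y \<psi> :: real
      proof -
        have "cos (y + \<theta> + \<psi>) + cos (y - \<theta> + \<psi>) = 2 * (cos (y + \<psi>) * cos \<theta>)"
          using cos_add[of "y + \<psi>" \<theta>] cos_diff[of "y + \<psi>" \<theta>] by (simp add: algebra_simps)
        hence "w * cos (y + \<theta> + \<psi>) + w * cos (y - \<theta> + \<psi>) = w * (2 * (cos (y + \<psi>) * cos \<theta>))"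
          by (simp only: distrib_left[symmetric])
        thus ?thesis by (simp only:) (simp add: distrib_left distrib_right)
      qed
      have flip: "u * y - (S + \<phi>) + \<psi> = u * y + (-1) * S + (\<psi> - \<phi>)" "u * y + (S + \<phi>) + \<psi> = u * y + 1 * S + (\<psi> + \<phi>)"
        for u y S \<psi> :: real by auto
      have e0: "(\<integral>x. W J B x * cos (u * x i + \<psi>) \<partial>P) = (\<integral>x. W J B x * cos (u * x i + \<psi>) \<partial>Q)" for u \<psi>
        using IH[of u 0 \<psi>] by simp
      have epm: "(\<integral>x. W J B x * cos (u * x i + \<Theta> x + \<psi>) \<partial>P) = (\<integral>x. W J B x * cos (u * x i + \<Theta> x + \<psi>) \<partial>Q)"
        "(\<integral>x. W J B x * cos (u * x i - \<Theta> x + \<psi>) \<partial>P) = (\<integral>x. W J B x * cos (u * x i - \<Theta> x + \<psi>) \<partial>Q)" for u \<psi>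
        unfolding \<Theta>_def flip by (rule IH)+
      have w: "(\<integral>x. W J B x * (1 + cos (\<Theta> x)) * cos (u * x i + \<psi>) \<partial>P)
          = (\<integral>x. W J B x * (1 + cos (\<Theta> x)) * cos (u * x i + \<psi>) \<partial>Q)" for u \<psi>
      proof -
        note [measurable] = ms[OF disjI1[OF refl]] ms[OF disjI2[OF refl]]
        show ?thesis unfolding expand by (simp add: intc e0 epm)
      qed
      have b: "0 \<le> W J B x * (1 + cos (\<Theta> x))" "W J B x * (1 + cos (\<Theta> x)) \<le> 2" for x
      proof -
        have c: "- 1 \<le> cos (\<Theta> x)" "cos (\<Theta> x) \<le> 1" by auto
        show "0 \<le> W J B x * (1 + cos (\<Theta> x))" using W_bnd[of J B x] c by (intro mult_nonneg_nonneg) linarith+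
        have "W J B x * (1 + cos (\<Theta> x)) \<le> 1 * 2" using W_bnd[of J B x] c by (intro mult_mono) linarith+
        thus "W J B x * (1 + cos (\<Theta> x)) \<le> 2" by simp
      qed
      have Bi: "B i \<in> sets borel" using B by auto
      have 1: "(\<integral>x. W J B x * (1 + cos (\<Theta> x)) * indicator (B i) (x i) \<partial>P)
          = (\<integral>x. W J B x * (1 + cos (\<Theta> x)) * indicator (B i) (x i) \<partial>Q)"
        by (rule weighted_law_eq[OF PQ sQP, of _ _ 2]) (use b Bi w ms[of P] in auto)
      have 2: "(\<integral>x. W J B x * indicator (B i) (x i) \<partial>P) = (\<integral>x. W J B x * indicator (B i) (x i) \<partial>Q)"
        by (rule weighted_law_eq[OF PQ sQP, of _ _ 1]) (use W_bnd[of J B] Bi e0 ms[of P] in auto)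
      have d: "(\<integral>x. W (insert i J) B x * cos (\<Theta> x) \<partial>M)
          = (\<integral>x. W J B x * (1 + cos (\<Theta> x)) * indicator (B i) (x i) \<partial>M)
            - (\<integral>x. W J B x * indicator (B i) (x i) \<partial>M)" if M: "M = P \<or> M = Q" for M
      proof -
        have Ii: "(\<lambda>x. indicator (B i) (x i) :: real) \<in> borel_measurable M"
          using ms(2)[OF M] Bi by (rule measurable_compose[OF _ borel_measurable_indicator])
        have "integrable M (\<lambda>x. W J B x * indicator (B i) (x i))"
          by (rule int[OF M Ii]) (auto simp: indicator_def)
        moreover have "integrable M (\<lambda>x. W J B x * (cos (\<Theta> x) * indicator (B i) (x i)))"
          by (rule int[OF M]) (use ms(3)[OF M] Ii in \<open>auto simp: indicator_def intro: order_trans[OF abs_cos_le_one]\<close>)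
        moreover have "W (insert i J) B x = W J B x * indicator (B i) (x i)" for x
          using insert.hyps by (simp add: W_def)
        ultimately show ?thesis by (simp add: algebra_simps)
      qed
      show "(\<integral>x. W (insert i J) B x * cos ((\<Sum>k\<in>I - insert i J. t k * x k) + \<phi>) \<partial>P)
        = (\<integral>x. W (insert i J) B x * cos ((\<Sum>k\<in>I - insert i J. t k * x k) + \<phi>) \<partial>Q)"
        using d[of P] d[of Q] 1 2 unfolding \<Theta>_def R_def by simp
    qed
  qed
  show ?thesis
  proof (rule measure_eqI_PiM_finite[OF I sets])
    fix B :: "'i \<Rightarrow> real set" assume B: "\<And>i. i \<in> I \<Longrightarrow> B i \<in> sets borel"
    have PB: "PiE I B \<in> sets (PiM I (\<lambda>_. borel))" using B I by (intro sets_PiM_I_finite) auto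
    have em: "emeasure M (PiE I B) = ennreal (\<integral>x. W I B x \<partial>M)" if M: "M = P \<or> M = Q" for M
    proof -
      interpret prob_space M using M PQ by auto
      have "W I B x = indicator (PiE I B) x" if "x \<in> space M" for x
        using that sets_eq_imp_space_eq[of M "PiM I (\<lambda>_. borel :: real measure)"] M sets I
        by (auto simp: W_def indicator_def prod_zero_iff PiE_iff space_PiM)
      moreover have "PiE I B \<inter> space M = PiE I B"
        using PB M sets by (intro sets.Int_space_eq2) auto
      ultimately show ?thesis
        using PB M sets by (simp add: emeasure_eq_measure cong: Bochner_Integration.integral_cong)
    qed
    show "emeasure P (PiE I B) = emeasure Q (PiE I B)"
      using main[OF I order_refl, rule_format, of B "\<lambda>_. 0" 0] B by (simp add: em)
  next
    show "range (\<lambda>_::nat. PiE I (\<lambda>_. UNIV)) \<subseteq> prod_algebra I (\<lambda>_. borel :: real measure)"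
      using I by (auto intro!: prod_algebraI_finite)
    interpret P: prob_space P by (rule PQ(1))
    show "emeasure P (PiE I (\<lambda>_. UNIV)) \<noteq> \<infinity>" by simp
  qed (auto simp: space_PiM)
qed

section \<open>The covariance form and orthogonal projection\<close>

definition unit_vec :: "'i \<Rightarrow> 'i \<Rightarrow> real" where
  "unit_vec a = (\<lambda>k. of_bool (k = a))"

definition cov_form :: "'i set \<Rightarrow> ('i \<Rightarrow> 'i \<Rightarrow> real) \<Rightarrow> ('i \<Rightarrow> real) \<Rightarrow> ('i \<Rightarrow> real) \<Rightarrow> real" where
  "cov_form V S t u = (\<Sum>a\<in>V. \<Sum>b\<in>V. t a * S a b * u b)"

text \<open>
  The vector \<open>t\<close> stands for the linear combination \<open>\<Sum>k\<in>V. t k * X k\<close>, and the form for the covariance of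
  two such combinations.
\<close>

locale covariance =
  fixes V :: "'i set" and S K :: "'i \<Rightarrow> 'i \<Rightarrow> real"
  assumes finite_V: "finite V"
    and S_sym: "\<And>a b. a \<in> V \<Longrightarrow> b \<in> V \<Longrightarrow> S a b = S b a"
    and form_nonneg: "\<And>t. 0 \<le> cov_form V S t t"
    and S_inv: "matrix_inverse_on V S K"
begin

abbreviation B where "B \<equiv> cov_form V S"

lemma B_cong: "(\<And>k. k \<in> V \<Longrightarrow> t k = t' k) \<Longrightarrow> (\<And>k. k \<in> V \<Longrightarrow> u k = u' k) \<Longrightarrow> B t u = B t' u'"
  by (simp add: cov_form_def cong: sum.cong)

lemma B_sym: "B t u = B u t"
  unfolding cov_form_def by (subst sum.swap) (intro sum.cong refl, simp add: S_sym)

lemma B_add_left: "B (\<lambda>k. t k + t' k) u = B t u + B t' u"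
  by (simp add: cov_form_def algebra_simps sum.distrib)

lemma B_diff_left: "B (\<lambda>k. t k - t' k) u = B t u - B t' u"
  by (simp add: cov_form_def algebra_simps sum_subtractf)

lemma B_scale_left: "B (\<lambda>k. c * t k) u = c * B t u"
  by (simp add: cov_form_def sum_distrib_left mult.assoc)

lemma B_add_right: "B u (\<lambda>k. t k + t' k) = B u t + B u t'"
  by (simp add: B_sym[of u] B_add_left)

lemma B_diff_right: "B u (\<lambda>k. t k - t' k) = B u t - B u t'"
  by (simp add: B_sym[of u] B_diff_left)

lemma B_scale_right: "B u (\<lambda>k. c * t k) = c * B u t"
  by (simp add: B_sym[of u] B_scale_left)

lemma B_sum_left: "finite J \<Longrightarrow> B (\<lambda>k. \<Sum>j\<in>J. c j * f j k) u = (\<Sum>j\<in>J. c j * B (f j) u)"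
  by (induction J rule: finite_induct) (simp_all add: B_add_left B_scale_left, simp add: cov_form_def)

lemma B_sum_right: "finite J \<Longrightarrow> B u (\<lambda>k. \<Sum>j\<in>J. c j * f j k) = (\<Sum>j\<in>J. c j * B u (f j))"
  by (simp add: B_sym[of u] B_sum_left)

lemmas B_simps = B_add_left B_diff_left B_scale_left B_add_right B_diff_right B_scale_right

lemma unit_expand: "k \<in> V \<Longrightarrow> t k = (\<Sum>j\<in>V. t j * unit_vec j k)"
  using finite_V by (simp add: unit_vec_def of_bool_def if_distrib[of "\<lambda>x. t _ * x"] cong: if_cong)

lemma B_units: "B u t = (\<Sum>j\<in>V. t j * B u (unit_vec j))"
proof -
  have "B u t = B u (\<lambda>k. \<Sum>j\<in>V. t j * unit_vec j k)"
    by (rule B_cong) (rule refl, rule unit_expand)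
  thus ?thesis by (simp add: B_sum_right finite_V)
qed

lemma B_unit_unit: "a \<in> V \<Longrightarrow> b \<in> V \<Longrightarrow> B (unit_vec a) (unit_vec b) = S a b"
proof -
  assume ab: "a \<in> V" "b \<in> V"
  have "B (unit_vec a) (unit_vec b) = (\<Sum>i\<in>V. \<Sum>j\<in>V. if j = b then (if i = a then S i j else 0) else 0)"
    unfolding cov_form_def unit_vec_def by (intro sum.cong refl) auto
  also have "\<dots> = S a b" using ab finite_V by simp
  finally show ?thesis .
qed

text \<open>
  A column of the precision matrix represents evaluation at a node with respect to the form.
\<close>

definition prec_col :: "'i \<Rightarrow> 'i \<Rightarrow> real" where "prec_col a = (\<lambda>k. K k a)"

lemma B_prec_col: "a \<in> V \<Longrightarrow> B t (prec_col a) = t a"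
proof -
  assume a: "a \<in> V"
  have "B t (prec_col a) = (\<Sum>i\<in>V. t i * (\<Sum>j\<in>V. S i j * K j a))"
    by (simp add: cov_form_def prec_col_def sum_distrib_left mult.assoc)
  also have "\<dots> = (\<Sum>i\<in>V. if i = a then t i else 0)"
    using S_inv a by (intro sum.cong refl) (auto simp: matrix_inverse_on_def)
  also have "\<dots> = t a" using a finite_V by simp
  finally show ?thesis .
qed

lemma B_null: "B t t = 0 \<Longrightarrow> B t u = 0"
proof (rule ccontr)
  assume t: "B t t = 0" and nz: "B t u \<noteq> 0"
  define s where "s = - B t u / (B u u + 1)"
  have u: "B u u + 1 > 0" using form_nonneg[of u] by linarith
  have "0 \<le> B (\<lambda>k. t k + s * u k) (\<lambda>k. t k + s * u k)" by (rule form_nonneg)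
  also have "\<dots> = 2 * s * B t u + s\<^sup>2 * B u u"
    by (simp add: B_simps t B_sym[of u t] power2_eq_square algebra_simps)
  also have "\<dots> = s * (2 * B t u + s * B u u)" by (simp add: power2_eq_square algebra_simps)
  also have "s * B u u = - B t u * (B u u / (B u u + 1))" by (simp add: s_def)
  also have "s * (2 * B t u + - B t u * (B u u / (B u u + 1))) = s * B t u * (2 - B u u / (B u u + 1))"
    by (simp add: algebra_simps)
  also have "s * B t u = - ((B t u)\<^sup>2 / (B u u + 1))" by (simp add: s_def power2_eq_square)
  finally have "(B t u)\<^sup>2 / (B u u + 1) * (2 - B u u / (B u u + 1)) \<le> 0" by simp
  moreover have "(B t u)\<^sup>2 / (B u u + 1) > 0" using u nz by simp
  moreover have "2 - B u u / (B u u + 1) > 0" using u form_nonneg[of u] by (simp add: field_simps)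
  ultimately show False using mult_pos_pos by (meson not_le)
qed

lemma B_definite: "B t t = 0 \<Longrightarrow> k \<in> V \<Longrightarrow> t k = 0"
  using B_null[of t "prec_col k"] B_prec_col[of k t] by simp

lemma B_pos: "k \<in> V \<Longrightarrow> t k \<noteq> 0 \<Longrightarrow> B t t > 0"
  using B_definite[of t k] form_nonneg[of t] by fastforce

text \<open>
  Gram-Schmidt. Membership in the span is recorded by the coefficients \<open>c\<close>, so that anything orthogonal
  to \<open>G\<close> is orthogonal to the basis.
\<close>

lemma orthonormal_basis:
  assumes "finite G"
  shows "\<exists>m f. m \<le> card G \<and> (\<forall>i<m. \<forall>j<m. B (f i) (f j) = of_bool (i = j))
    \<and> (\<forall>g\<in>G. \<forall>k\<in>V. g k = (\<Sum>i<m. B g (f i) * f i k))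
    \<and> (\<forall>i<m. \<exists>c. \<forall>k. f i k = (\<Sum>g\<in>G. c g * g k))"
  using assms
proof (induction G rule: finite_induct)
  case empty
  show ?case by (intro exI[of _ 0]) auto
next
  case (insert g G)
  obtain m f where m: "m \<le> card G"
    and on: "\<And>i j. i < m \<Longrightarrow> j < m \<Longrightarrow> B (f i) (f j) = of_bool (i = j)"
    and ex: "\<And>h k. h \<in> G \<Longrightarrow> k \<in> V \<Longrightarrow> h k = (\<Sum>i<m. B h (f i) * f i k)"
    and span: "\<And>i. i < m \<Longrightarrow> \<exists>c. \<forall>k. f i k = (\<Sum>h\<in>G. c h * h k)"
    using insert.IH by blast
  from span obtain c where c: "\<And>i k. i < m \<Longrightarrow> f i k = (\<Sum>h\<in>G. c i h * h k)" by metis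
  define r where "r k = g k - (\<Sum>i<m. B g (f i) * f i k)" for k
  have r_orth: "B r (f j) = 0" if "j < m" for j
  proof -
    have "B r (f j) = B g (f j) - (\<Sum>i<m. B g (f i) * B (f i) (f j))"
      unfolding r_def by (simp add: B_diff_left B_sum_left)
    also have "(\<Sum>i<m. B g (f i) * B (f i) (f j)) = (\<Sum>i<m. if i = j then B g (f i) else 0)"
      using that on by (intro sum.cong) auto
    finally show ?thesis using that by simp
  qed
  have c_ext: "f i k = (\<Sum>h\<in>insert g G. (if h = g then 0 else c i h) * h k)" if "i < m" for i k
  proof -
    have "(\<Sum>h\<in>G. (if h = g then 0 else c i h) * h k) = (\<Sum>h\<in>G. c i h * h k)"
      using insert.hyps by (intro sum.cong) auto
    thus ?thesis using insert.hyps c[OF that] by simp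
  qed
  have card: "card (insert g G) = Suc (card G)" using insert.hyps by simp
  show ?case
  proof (cases "B r r = 0")
    case True
    hence "g k = (\<Sum>i<m. B g (f i) * f i k)" if "k \<in> V" for k
      using B_definite[OF True that] by (simp add: r_def)
    note g_ex = this
    show ?thesis
    proof (intro exI[of _ m] exI[of _ f] conjI allI impI ballI)
      show "m \<le> card (insert g G)" using m card by simp
      show "h k = (\<Sum>i<m. B h (f i) * f i k)" if "h \<in> insert g G" "k \<in> V" for h k
        using that g_ex ex by blast
      show "\<exists>c. \<forall>k. f i k = (\<Sum>h\<in>insert g G. c h * h k)" if "i < m" for i
        by (intro exI[of _ "\<lambda>h. if h = g then 0 else c i h"] allI c_ext that)
    qed (rule on)
  next
    case False
    hence rr: "B r r > 0" using form_nonneg[of r] by simp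
    define q where "q = sqrt (B r r)"
    have q: "q > 0" "q * q = B r r" using rr by (simp_all add: q_def)
    define f' where "f' = f(m := \<lambda>k. inverse q * r k)"
    have f': "f' i = f i" if "i < m" for i using that by (simp add: f'_def)
    have fm: "f' m = (\<lambda>k. inverse q * r k)" by (simp add: f'_def)
    have gr: "B g r = B r r"
    proof -
      have "B r r = B (\<lambda>k. g k - (\<Sum>i<m. B g (f i) * f i k)) r"
        by (rule B_cong) (simp_all add: r_def)
      also have "\<dots> = B g r - (\<Sum>i<m. B g (f i) * B (f i) r)"
        by (simp add: B_diff_left B_sum_left)
      also have "(\<Sum>i<m. B g (f i) * B (f i) r) = 0"
        by (intro sum.neutral ballI) (simp add: r_orth B_sym[where u = r])
      finally show ?thesis by simp
    qed
    have on': "B (f' i) (f' j) = of_bool (i = j)" if ij: "i < Suc m" "j < Suc m" for i j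
    proof -
      have "inverse q * (inverse q * B r r) = 1" unfolding q(2)[symmetric] using q(1) by (simp add: field_simps)
      hence mm: "B (f' m) (f' m) = 1" by (simp only: fm B_scale_left B_scale_right)
      have im: "B (f' m) (f i) = 0" if "i < m" for i
        unfolding fm B_scale_left r_orth[OF that] by simp
      hence mi: "B (f i) (f' m) = 0" if "i < m" for i
        using that B_sym[of "f i" "f' m"] by simp
      consider "i < m" "j < m" | "i = m" "j < m" | "i < m" "j = m" | "i = m" "j = m"
        using ij unfolding less_Suc_eq by blast
      thus ?thesis
      proof cases
        case 1
        thus ?thesis using on[OF 1] by (simp only: f')
      next
        case 2
        thus ?thesis using im[OF 2(2)] by (simp only: f') simp
      next
        case 3
        thus ?thesis using mi[OF 3(1)] by (simp only: f') simp
      next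
        case 4
        thus ?thesis using mm by simp
      qed
    qed
    have ex': "h k = (\<Sum>i<Suc m. B h (f' i) * f' i k)" if "h \<in> insert g G" "k \<in> V" for h k
    proof (cases "h = g")
      case True
      have "B g (f' m) = inverse q * (q * q)" unfolding fm B_scale_right gr q(2) ..
      hence "B g (f' m) * f' m k = r k" using q(1) by (simp add: fm)
      thus ?thesis using True by (simp add: f' r_def)
    next
      case h: False
      hence hG: "h \<in> G" using that by auto
      have "B h r = B (\<lambda>k. \<Sum>i<m. B h (f i) * f i k) r" by (rule B_cong) (use ex hG in auto)
      also have "\<dots> = (\<Sum>i<m. B h (f i) * B (f i) r)" by (simp add: B_sum_left)
      also have "\<dots> = 0" by (intro sum.neutral ballI) (simp add: r_orth B_sym[where u = r])
      finally have "B h r = 0" .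
      hence hm: "B h (f' m) = 0" unfolding fm B_scale_right by simp
      have "(\<Sum>i<m. B h (f' i) * f' i k) = (\<Sum>i<m. B h (f i) * f i k)"
        by (intro sum.cong) (auto simp: f')
      thus ?thesis unfolding sum.lessThan_Suc hm ex[OF hG that(2), symmetric] by simp
    qed
    have span': "\<exists>c. \<forall>k. f' i k = (\<Sum>h\<in>insert g G. c h * h k)" if i: "i < Suc m" for i
    proof (cases "i < m")
      case True
      thus ?thesis unfolding f'[OF True] by (intro exI[of _ "\<lambda>h. if h = g then 0 else c i h"] allI c_ext)
    next
      case False
      hence im: "i = m" using i by simp
      define c' where "c' h = inverse q * (if h = g then 1 else - (\<Sum>i<m. B g (f i) * c i h))" for h
      have "f' i k = (\<Sum>h\<in>insert g G. c' h * h k)" for k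
      proof -
        have "(\<Sum>i<m. B g (f i) * f i k) = (\<Sum>h\<in>G. (\<Sum>i<m. B g (f i) * c i h) * h k)"
        proof -
          have "(\<Sum>i<m. B g (f i) * f i k) = (\<Sum>i<m. \<Sum>h\<in>G. B g (f i) * c i h * h k)"
            using c by (intro sum.cong) (auto simp: sum_distrib_left mult.assoc)
          also have "\<dots> = (\<Sum>h\<in>G. \<Sum>i<m. B g (f i) * c i h * h k)" by (rule sum.swap)
          finally show ?thesis by (simp add: sum_distrib_right)
        qed
        moreover have "(\<Sum>h\<in>G. c' h * h k) = (\<Sum>h\<in>G. - (inverse q * ((\<Sum>i<m. B g (f i) * c i h) * h k)))"
          using insert.hyps by (intro sum.cong) (auto simp: c'_def)
        ultimately have "(\<Sum>h\<in>G. c' h * h k) = - (inverse q * (\<Sum>i<m. B g (f i) * f i k))"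
          by (simp add: sum_negf sum_distrib_left)
        thus ?thesis
          using insert.hyps by (simp add: im fm r_def c'_def right_diff_distrib)
      qed
      thus ?thesis by blast
    qed
    show ?thesis
    proof (intro exI[of _ "Suc m"] exI[of _ f'] conjI allI impI ballI)
      show "Suc m \<le> card (insert g G)" using m card by simp
    qed (fact on' ex' span')+
  qed
qed

lemma projection_exists:
  assumes "A \<subseteq> V"
  shows "\<exists>\<tau>. (\<forall>k. k \<notin> A \<longrightarrow> \<tau> k = 0) \<and> (\<forall>k\<in>A. B (\<lambda>j. t j - \<tau> j) (unit_vec k) = 0)"
proof -
  have "finite (unit_vec ` A)" using assms finite_V finite_subset by blast
  from orthonormal_basis[OF this] obtain m :: nat and f where
    on: "\<And>i j. i < m \<Longrightarrow> j < m \<Longrightarrow> B (f i) (f j) = of_bool (i = j)"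
    and ex: "\<And>a k. a \<in> A \<Longrightarrow> k \<in> V \<Longrightarrow> unit_vec a k = (\<Sum>i<m. B (unit_vec a) (f i) * f i k)"
    and span: "\<And>i. i < m \<Longrightarrow> \<exists>c. \<forall>k. f i k = (\<Sum>g\<in>unit_vec ` A. c g * g k)"
    by blast
  define \<tau> where "\<tau> k = (\<Sum>i<m. B t (f i) * f i k)" for k
  have "f i k = 0" if "i < m" "k \<notin> A" for i k
  proof -
    have "(\<Sum>g\<in>unit_vec ` A. c g * g k) = 0" for c
      using that by (intro sum.neutral) (auto simp: unit_vec_def)
    thus ?thesis using span[OF that(1)] by auto
  qed
  hence "\<tau> k = 0" if "k \<notin> A" for k using that by (auto simp: \<tau>_def)
  moreover have "B (\<lambda>j. t j - \<tau> j) (unit_vec a) = 0" if a: "a \<in> A" for a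
  proof -
    have o: "B (\<lambda>j. t j - \<tau> j) (f j) = 0" if "j < m" for j
    proof -
      have "B \<tau> (f j) = (\<Sum>i<m. B t (f i) * B (f i) (f j))"
        unfolding \<tau>_def by (simp add: B_sum_left)
      also have "\<dots> = (\<Sum>i<m. if i = j then B t (f i) else 0)"
        using that on by (intro sum.cong) auto
      finally show ?thesis using that by (simp add: B_diff_left)
    qed
    have "B (\<lambda>j. t j - \<tau> j) (unit_vec a) = B (\<lambda>j. t j - \<tau> j) (\<lambda>k. \<Sum>i<m. B (unit_vec a) (f i) * f i k)"
      by (rule B_cong) (use ex a in auto)
    also have "\<dots> = 0" using o by (simp add: B_sum_right)
    finally show ?thesis .
  qed
  ultimately show ?thesis by blast
qed

lemma prec_diag_pos: "a \<in> V \<Longrightarrow> K a a > 0"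
proof -
  assume a: "a \<in> V"
  have "B (prec_col a) (prec_col a) \<noteq> 0"
  proof
    assume "B (prec_col a) (prec_col a) = 0"
    hence "B (prec_col a) (unit_vec a) = 0" by (rule B_null)
    thus False using B_prec_col[OF a, of "unit_vec a"] by (simp add: B_sym unit_vec_def)
  qed
  hence "B (prec_col a) (prec_col a) > 0" using form_nonneg[of "prec_col a"] by simp
  thus ?thesis unfolding B_prec_col[OF a] by (simp add: prec_col_def)
qed

lemma prec_sym: "a \<in> V \<Longrightarrow> b \<in> V \<Longrightarrow> K a b = K b a"
  using B_prec_col[of a "prec_col b"] B_prec_col[of b "prec_col a"] B_sym[of "prec_col a" "prec_col b"]
  by (simp add: prec_col_def)

text \<open>
  The residual of \<open>X a\<close> after optimal prediction from all other variables: the optimal coefficient of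
  \<open>k\<close> is \<open>- K k a / K a a\<close>.
\<close>

definition innovation :: "'i \<Rightarrow> 'i \<Rightarrow> real" where "innovation a = (\<lambda>k. K k a / K a a)"

lemma innovation_self: "a \<in> V \<Longrightarrow> innovation a a = 1"
  using prec_diag_pos[of a] by (simp add: innovation_def)

lemma B_innovation: "a \<in> V \<Longrightarrow> B t (innovation a) = t a / K a a"
proof -
  assume a: "a \<in> V"
  have "innovation a = (\<lambda>k. inverse (K a a) * prec_col a k)"
    by (auto simp: innovation_def prec_col_def field_simps)
  hence "B t (innovation a) = inverse (K a a) * t a" by (simp only: B_scale_right B_prec_col[OF a])
  thus ?thesis by (simp add: field_simps)
qed

lemma innovation_var: "a \<in> V \<Longrightarrow> B (innovation a) (innovation a) = 1 / K a a"
  by (simp add: B_innovation innovation_self)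

text \<open>
  A combination in which \<open>a\<close> has coefficient 1 is a prediction error of \<open>X a\<close> from the other variables.
\<close>

lemma innovation_var_minimal: "a \<in> V \<Longrightarrow> t a = 1 \<Longrightarrow> 1 / K a a \<le> B t t"
proof -
  assume a: "a \<in> V" "t a = 1"
  have "0 \<le> B (\<lambda>k. t k - innovation a k) (\<lambda>k. t k - innovation a k)" by (rule form_nonneg)
  thus ?thesis
    by (simp add: B_simps B_innovation a innovation_self B_sym[of "innovation a" t])
qed

text \<open>
  Such a \<open>t\<close> represents evaluation at \<open>b\<close> up to a factor, so it is a multiple of the column of \<open>b\<close>, and this
  column vanishes at \<open>a\<close> along with \<open>t\<close>.
\<close>

lemma prec_zero_if_orthogonal:
  assumes ab: "a \<in> V" "b \<in> V" "a \<noteq> b" and t: "t b = 1" "t a = 0"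
    and orth: "\<And>k. k \<in> V \<Longrightarrow> k \<noteq> b \<Longrightarrow> B t (unit_vec k) = 0"
  shows "K a b = 0"
proof -
  have e: "B t u = u b * B t (unit_vec b)" for u
    unfolding B_units[of t u] using orth ab finite_V
    by (subst sum.remove[of _ b]) auto
  have "B t t > 0" by (rule B_pos[OF ab(2)]) (simp add: t)
  hence "B t (unit_vec b) > 0" using e[of t] t by simp
  moreover have "K b a * B t (unit_vec b) = 0"
    using e[of "prec_col a"] B_prec_col[OF ab(1), of t] t by (simp add: prec_col_def)
  ultimately show ?thesis using prec_sym[OF ab(1,2)] by simp
qed

end

section \<open>Gaussian families\<close>

definition lin_comb :: "'i set \<Rightarrow> ('i \<Rightarrow> 'w \<Rightarrow> real) \<Rightarrow> ('i \<Rightarrow> real) \<Rightarrow> 'w \<Rightarrow> real" where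
  "lin_comb V X t \<omega> = (\<Sum>k\<in>V. t k * X k \<omega>)"

lemma centered_normal_moments:
  assumes "v \<ge> 0"
  shows "integrable (centered_normal v) (\<lambda>x. x)" (is ?A) and "(\<integral>x. x \<partial>centered_normal v) = 0" (is ?B)
    and "integrable (centered_normal v) (\<lambda>x. x\<^sup>2)" (is ?C) and "(\<integral>x. x\<^sup>2 \<partial>centered_normal v) = v" (is ?D)
proof -
  consider "v = 0" | "sqrt v > 0" using assms by fastforce
  hence "?A \<and> ?B \<and> ?C \<and> ?D"
  proof cases
    case 1
    have cn: "centered_normal v = return borel 0" by (simp add: centered_normal_def 1)
    have int0: "integrable (return borel (0::real)) f" if "f \<in> borel_measurable borel" for f :: "real \<Rightarrow> real"
    proof (rule integrableI_bounded)
      show "f \<in> borel_measurable (return borel 0)" using that by simp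
      have "(\<integral>\<^sup>+ x. ennreal (norm (f x)) \<partial>return borel 0) = ennreal (norm (f 0))"
        by (rule nn_integral_return) (use that in auto)
      thus "(\<integral>\<^sup>+ x. ennreal (norm (f x)) \<partial>return borel 0) < \<infinity>" by simp
    qed
    have ret: "(\<integral>x. f x \<partial>return borel 0) = f 0" if "f \<in> borel_measurable borel" for f :: "real \<Rightarrow> real"
      by (rule integral_return) (use that in auto)
    have ?A unfolding cn by (rule int0) measurable
    moreover have ?B unfolding cn by (rule ret) measurable
    moreover have ?C unfolding cn by (rule int0) measurable
    moreover have "(\<integral>x. x\<^sup>2 \<partial>return borel 0) = (0::real)\<^sup>2" by (rule ret) measurable
    hence ?D unfolding cn by (simp only: 1) simp
    ultimately show ?thesis by blast
  next
    case 2
    hence nz: "v \<noteq> 0" by auto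
    have sq: "(sqrt v)\<^sup>2 = v" using assms by simp
    show ?thesis
      using integrable_normal_moment[OF 2, of 0 1] integral_normal_moment_nz_1[OF 2, of 0]
        integrable_normal_moment[OF 2, of 0 2] integral_normal_moment_even[OF 2, of 0 1] nz sq
      by (simp add: centered_normal_def integrable_density integral_density)
  qed
  thus ?A ?B ?C ?D by auto
qed

locale gaussian_family = prob_space M for M :: "'w measure" +
  fixes V :: "'i set" and X :: "'i \<Rightarrow> 'w \<Rightarrow> real" and S K :: "'i \<Rightarrow> 'i \<Rightarrow> real"
  assumes fin_V: "finite V" and gaussian: "gaussian_vector M V X S" and prec: "matrix_inverse_on V S K"

sublocale gaussian_family \<subseteq> covariance V S K
  using fin_V gaussian prec by unfold_locales (auto simp: gaussian_vector_def cov_form_def)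

context gaussian_family
begin

abbreviation L where "L \<equiv> lin_comb V X"

lemma X_measurable: "a \<in> V \<Longrightarrow> X a \<in> borel_measurable M"
  using gaussian by (auto simp: gaussian_vector_def)

lemma L_measurable [measurable]: "L t \<in> borel_measurable M"
  unfolding lin_comb_def[abs_def] by (auto intro!: borel_measurable_sum borel_measurable_times X_measurable)

lemma L_distr: "distr M borel (L t) = centered_normal (B t t)"
  using gaussian by (auto simp: gaussian_vector_def cov_form_def lin_comb_def[abs_def])

lemma L_cong: "(\<And>k. k \<in> V \<Longrightarrow> t k = t' k) \<Longrightarrow> L t = L t'"
  by (auto simp: lin_comb_def cong: sum.cong)

lemma L_add: "L (\<lambda>k. t k + u k) \<omega> = L t \<omega> + L u \<omega>"
  by (simp add: lin_comb_def algebra_simps sum.distrib)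

lemma L_diff: "L (\<lambda>k. t k - u k) \<omega> = L t \<omega> - L u \<omega>"
  by (simp add: lin_comb_def algebra_simps sum_subtractf)

lemma L_scale: "L (\<lambda>k. c * t k) \<omega> = c * L t \<omega>"
  by (simp add: lin_comb_def sum_distrib_left mult.assoc)

lemma L_unit: "a \<in> V \<Longrightarrow> L (unit_vec a) = X a"
  using fin_V by (auto simp: lin_comb_def unit_vec_def of_bool_def if_distrib[of "\<lambda>x. x * _"] cong: if_cong)

lemma L_integrable: "integrable M (L t)" "expectation (L t) = 0"
  and L_square: "integrable M (\<lambda>\<omega>. (L t \<omega>)\<^sup>2)" "expectation (\<lambda>\<omega>. (L t \<omega>)\<^sup>2) = B t t"
proof -
  note m = centered_normal_moments[OF form_nonneg, of t, folded L_distr]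
  show "integrable M (L t)" "expectation (L t) = 0" "integrable M (\<lambda>\<omega>. (L t \<omega>)\<^sup>2)"
    "expectation (\<lambda>\<omega>. (L t \<omega>)\<^sup>2) = B t t"
    using m by (simp_all add: integrable_distr_eq integral_distr)
qed

lemma L_prod: "integrable M (\<lambda>\<omega>. L t \<omega> * L u \<omega>)" "expectation (\<lambda>\<omega>. L t \<omega> * L u \<omega>) = B t u"
proof -
  have e: "L t \<omega> * L u \<omega> = ((L (\<lambda>k. t k + u k) \<omega>)\<^sup>2 - (L t \<omega>)\<^sup>2 - (L u \<omega>)\<^sup>2) / 2" for \<omega>
    by (simp add: L_add power2_eq_square algebra_simps)
  show "integrable M (\<lambda>\<omega>. L t \<omega> * L u \<omega>)" unfolding e by (intro integrable_divide Bochner_Integration.integrable_diff L_square)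
  show "expectation (\<lambda>\<omega>. L t \<omega> * L u \<omega>) = B t u"
    unfolding e by (simp add: L_square B_add_left B_add_right B_sym[of u t])
qed

text \<open>
  By Pythagoras the prediction error exceeds that of the orthogonal projection by the squared
  norm of the difference of the coefficient vectors, which is definite.
\<close>

lemma opt_coef_eqI:
  assumes A: "A \<subseteq> V" and b: "b \<in> V" and supp: "\<And>k. k \<notin> A \<Longrightarrow> \<tau> k = 0"
    and orth: "\<And>k. k \<in> A \<Longrightarrow> B (\<lambda>j. unit_vec b j - \<tau> j) (unit_vec k) = 0"
  shows "opt_coef M V X b A = \<tau>"
proof -
  define z where "z = (\<lambda>j. unit_vec b j - \<tau> j)"
  have obj: "expectation (\<lambda>\<omega>. (X b \<omega> - (\<Sum>k\<in>V. \<theta> k * X k \<omega>))\<^sup>2) = B z z + B (\<lambda>k. \<tau> k - \<theta> k) (\<lambda>k. \<tau> k - \<theta> k)"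
    if \<theta>: "\<forall>k. k \<notin> A \<longrightarrow> \<theta> k = 0" for \<theta>
  proof -
    define h where "h = (\<lambda>k. \<tau> k - \<theta> k)"
    have "X b \<omega> - (\<Sum>k\<in>V. \<theta> k * X k \<omega>) = L (\<lambda>k. unit_vec b k - \<theta> k) \<omega>" for \<omega>
      by (simp add: L_diff L_unit b) (simp add: lin_comb_def)
    hence "expectation (\<lambda>\<omega>. (X b \<omega> - (\<Sum>k\<in>V. \<theta> k * X k \<omega>))\<^sup>2)
        = B (\<lambda>k. unit_vec b k - \<theta> k) (\<lambda>k. unit_vec b k - \<theta> k)"
      by (simp add: L_square)
    also have "(\<lambda>k. unit_vec b k - \<theta> k) = (\<lambda>k. z k + h k)" by (auto simp: z_def h_def)
    also have "B (\<lambda>k. z k + h k) (\<lambda>k. z k + h k) = B z z + 2 * B z h + B h h"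
      by (simp add: B_add_left B_add_right B_sym[of h z])
    also have "B z h = (\<Sum>j\<in>V. h j * B z (unit_vec j))" by (rule B_units)
    also have "\<dots> = 0"
    proof (intro sum.neutral ballI)
      fix j show "h j * B z (unit_vec j) = 0"
        by (cases "j \<in> A") (use \<theta> supp orth in \<open>auto simp: z_def h_def\<close>)
    qed
    finally show ?thesis by (simp add: h_def)
  qed
  show ?thesis
    unfolding opt_coef_def
  proof (rule arg_minI[where x = \<tau>])
    show "\<forall>k. k \<notin> A \<longrightarrow> \<tau> k = 0" using supp by auto
    show "\<not> expectation (\<lambda>\<omega>. (X b \<omega> - (\<Sum>k\<in>V. y k * X k \<omega>))\<^sup>2) < expectation (\<lambda>\<omega>. (X b \<omega> - (\<Sum>k\<in>V. \<tau> k * X k \<omega>))\<^sup>2)"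
      if "\<forall>k. k \<notin> A \<longrightarrow> y k = 0" for y
      using supp form_nonneg[of "\<lambda>k. \<tau> k - y k"] by (subst (1 2) obj) (auto simp: that, simp add: cov_form_def)
    fix \<theta> assume \<theta>: "\<forall>k. k \<notin> A \<longrightarrow> \<theta> k = 0"
      and min: "\<forall>y. (\<forall>k. k \<notin> A \<longrightarrow> y k = 0) \<longrightarrow>
        \<not> expectation (\<lambda>\<omega>. (X b \<omega> - (\<Sum>k\<in>V. y k * X k \<omega>))\<^sup>2) < expectation (\<lambda>\<omega>. (X b \<omega> - (\<Sum>k\<in>V. \<theta> k * X k \<omega>))\<^sup>2)"
    have "\<not> B z z + B (\<lambda>k. \<tau> k - \<tau> k) (\<lambda>k. \<tau> k - \<tau> k) < B z z + B (\<lambda>k. \<tau> k - \<theta> k) (\<lambda>k. \<tau> k - \<theta> k)"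
      using min[rule_format, of \<tau>] obj[of \<tau>] obj[of \<theta>] \<theta> supp by simp
    hence "B (\<lambda>k. \<tau> k - \<theta> k) (\<lambda>k. \<tau> k - \<theta> k) = 0"
      using form_nonneg[of "\<lambda>k. \<tau> k - \<theta> k"] by (simp add: cov_form_def)
    from B_definite[OF this] have "\<theta> k = \<tau> k" if "k \<in> V" for k using that by force
    thus "\<theta> = \<tau>" using \<theta> supp A by (metis ext subsetD)
  qed
qed

lemma opt_coef_projection:
  assumes A: "A \<subseteq> V" and b: "b \<in> V"
  shows "k \<notin> A \<Longrightarrow> opt_coef M V X b A k = 0"
    and "k \<in> A \<Longrightarrow> B (\<lambda>j. unit_vec b j - opt_coef M V X b A j) (unit_vec k) = 0"
proof -
  obtain \<tau> where \<tau>: "\<And>k. k \<notin> A \<Longrightarrow> \<tau> k = 0" "\<And>k. k \<in> A \<Longrightarrow> B (\<lambda>j. unit_vec b j - \<tau> j) (unit_vec k) = 0"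
    using projection_exists[OF A, of "unit_vec b"] by blast
  have "opt_coef M V X b A = \<tau>" by (rule opt_coef_eqI[OF A b \<tau>])
  thus "k \<notin> A \<Longrightarrow> opt_coef M V X b A k = 0"
    "k \<in> A \<Longrightarrow> B (\<lambda>j. unit_vec b j - opt_coef M V X b A j) (unit_vec k) = 0" using \<tau> by auto
qed

end

section \<open>Conditioning on the remaining variables\<close>

text \<open>
  Testing \<open>Y\<close> against indicators of events determined by \<open>T\<close> identifies its conditional expectation as zero;
  the pull-out property then extends the test from indicators to all \<open>Z\<close> measurable with respect to \<open>T\<close>.
\<close>

lemma (in prob_space) expectation_mult_eq_0:
  assumes T: "T \<in> measurable M N" and Y: "integrable M Y"
    and Z: "Z \<in> borel_measurable (vimage_algebra (space M) T N)" and YZ: "integrable M (\<lambda>\<omega>. Z \<omega> * Y \<omega>)"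
    and zero: "\<And>B. B \<in> sets N \<Longrightarrow> expectation (\<lambda>\<omega>. indicator B (T \<omega>) * Y \<omega>) = 0"
  shows "expectation (\<lambda>\<omega>. Z \<omega> * Y \<omega>) = 0"
    and "AE \<omega> in M. real_cond_exp M (vimage_algebra (space M) T N) Y \<omega> = 0"
proof -
  define F where "F = vimage_algebra (space M) T N"
  have TX: "T \<in> space M \<rightarrow> space N" using T by (auto simp: measurable_def)
  have "subalgebra M F"
    unfolding F_def subalgebra_def using T TX by (auto simp: sets_vimage_algebra2 measurable_sets)
  then interpret F: finite_measure_subalgebra M F by unfold_locales
  show ae: "AE \<omega> in M. real_cond_exp M (vimage_algebra (space M) T N) Y \<omega> = 0"
    unfolding F_def[symmetric]
  proof (rule F.real_cond_exp_charact)
    fix A assume "A \<in> sets F"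
    then obtain B where B: "B \<in> sets N" "A = T -` B \<inter> space M"
      unfolding F_def sets_vimage_algebra2[OF TX] by auto
    have "(\<integral>\<omega>\<in>A. Y \<omega> \<partial>M) = expectation (\<lambda>\<omega>. indicator B (T \<omega>) * Y \<omega>)"
      unfolding set_lebesgue_integral_def B(2)
      by (intro Bochner_Integration.integral_cong refl) (auto simp: indicator_def)
    thus "(\<integral>\<omega>\<in>A. Y \<omega> \<partial>M) = (\<integral>\<omega>\<in>A. 0 \<partial>M)" using zero[OF B(1)] by simp
  qed (use Y in auto)
  have "expectation (\<lambda>\<omega>. Z \<omega> * Y \<omega>) = expectation (\<lambda>\<omega>. Z \<omega> * real_cond_exp M F Y \<omega>)"
    using F.real_cond_exp_intg(2)[OF YZ Z[folded F_def]] Y by simp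
  also have "\<dots> = 0" using ae unfolding F_def[symmetric] by (intro integral_eq_zero_AE) auto
  finally show "expectation (\<lambda>\<omega>. Z \<omega> * Y \<omega>) = 0" .
qed

context gaussian_family
begin

lemma joint_measurable: "C \<subseteq> V \<Longrightarrow> joint C X \<in> measurable M (PiM C (\<lambda>_. borel))"
  unfolding joint_def[abs_def] using X_measurable by (intro measurable_restrict) auto

text \<open>
  The pairs \<open>(L t, X C)\<close> and \<open>(- L t, X C)\<close> have the same law: a linear combination of either has a centered
  normal law whose variance does not see the sign, because the cross covariances vanish. Hence the
  expectation equals its own negative.
\<close>

lemma reflection:
  assumes C: "C \<subseteq> V" and orth: "\<And>k. k \<in> C \<Longrightarrow> B t (unit_vec k) = 0"
    and Bs: "Bs \<in> sets (PiM C (\<lambda>_. borel))"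
  shows "expectation (\<lambda>\<omega>. indicator Bs (joint C X \<omega>) * L t \<omega>) = 0"
proof -
  \<comment> \<open>The index \<open>None\<close> carries the combination \<open>L t\<close> with sign \<open>s\<close>.\<close>
  define I where "I = insert None (Some ` C)"
  define T where "T s i = (case i of None \<Rightarrow> (\<lambda>\<omega>. s * L t \<omega>) | Some k \<Rightarrow> X k)" for s :: real and i
  have finC: "finite C" using C fin_V finite_subset by blast
  have finI: "finite I" using finC by (simp add: I_def)
  have Tm: "T s i \<in> borel_measurable M" if "i \<in> I" for s i
    using that C X_measurable by (auto simp: T_def I_def)
  have comb: "(\<Sum>i\<in>I. c i * T s i \<omega>) = L (\<lambda>k. (c None * s) * t k + (if k \<in> C then c (Some k) else 0)) \<omega>" for c s \<omega>
  proof -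
    have "(\<Sum>i\<in>I. c i * T s i \<omega>) = c None * s * L t \<omega> + (\<Sum>k\<in>C. c (Some k) * X k \<omega>)"
      unfolding I_def using finC by (simp add: T_def sum.reindex)
    also have "(\<Sum>k\<in>C. c (Some k) * X k \<omega>) = L (\<lambda>k. if k \<in> C then c (Some k) else 0) \<omega>"
      unfolding lin_comb_def using C fin_V by (intro sum.mono_neutral_cong_left) auto
    finally show ?thesis by (simp add: L_add L_scale)
  qed
  have var: "B (\<lambda>k. (c * s) * t k + (if k \<in> C then e k else 0)) (\<lambda>k. (c * s) * t k + (if k \<in> C then e k else 0))
      = c\<^sup>2 * s\<^sup>2 * B t t + B (\<lambda>k. if k \<in> C then e k else 0) (\<lambda>k. if k \<in> C then e k else 0)" for c s e
  proof -
    define u where "u = (\<lambda>k. if k \<in> C then e k else 0)"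
    have "B t u = 0" unfolding B_units[of t u] using orth by (intro sum.neutral) (auto simp: u_def)
    hence "B (\<lambda>k. (c * s) * t k + u k) (\<lambda>k. (c * s) * t k + u k) = c\<^sup>2 * s\<^sup>2 * B t t + B u u"
      by (simp add: B_simps B_sym[of u t] power2_eq_square)
    thus ?thesis unfolding u_def .
  qed
  have jm: "joint I (T s) \<in> measurable M (PiM I (\<lambda>_. borel))" for s
    unfolding joint_def[abs_def] using Tm by (intro measurable_restrict) auto
  have law: "distr M (PiM I (\<lambda>_. borel)) (joint I (T 1)) = distr M (PiM I (\<lambda>_. borel)) (joint I (T (-1)))"
  proof (rule cramer_wold[OF prob_space_distr[OF jm] prob_space_distr[OF jm] finI])
    have "distr (distr M (PiM I (\<lambda>_. borel)) (joint I (T s))) borel (\<lambda>x. \<Sum>i\<in>I. c i * x i)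
        = centered_normal ((c None)\<^sup>2 * s\<^sup>2 * B t t
          + B (\<lambda>k. if k \<in> C then c (Some k) else 0) (\<lambda>k. if k \<in> C then c (Some k) else 0))" for c s
    proof -
      have "distr (distr M (PiM I (\<lambda>_. borel)) (joint I (T s))) borel (\<lambda>x. \<Sum>i\<in>I. c i * x i)
          = distr M borel (\<lambda>\<omega>. \<Sum>i\<in>I. c i * T s i \<omega>)"
        using jm by (simp add: distr_distr comp_def joint_def cong: sum.cong)
      thus ?thesis unfolding comb L_distr var .
    qed
    thus "distr (distr M (PiM I (\<lambda>_. borel)) (joint I (T 1))) borel (\<lambda>x. \<Sum>i\<in>I. c i * x i)
        = distr (distr M (PiM I (\<lambda>_. borel)) (joint I (T (-1)))) borel (\<lambda>x. \<Sum>i\<in>I. c i * x i)" for c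
      by simp
  qed simp_all
  define \<phi> where "\<phi> x = indicator Bs (\<lambda>k\<in>C. x (Some k)) * x None" for x :: "'i option \<Rightarrow> real"
  have "(\<lambda>x. \<lambda>k\<in>C. x (Some k)) \<in> measurable (PiM I (\<lambda>_. borel)) (PiM C (\<lambda>_. borel :: real measure))"
    by (intro measurable_restrict measurable_component_singleton) (auto simp: I_def)
  hence \<phi>m: "\<phi> \<in> borel_measurable (PiM I (\<lambda>_. borel))"
    unfolding \<phi>_def[abs_def] using Bs
    by (intro borel_measurable_times measurable_compose[OF _ borel_measurable_indicator[OF Bs]] measurable_component_singleton)
      (auto simp: I_def)
  have \<phi>T: "\<phi> (joint I (T s) \<omega>) = s * (indicator Bs (joint C X \<omega>) * L t \<omega>)" for s \<omega>
  proof -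
    have "(\<lambda>k\<in>C. joint I (T s) \<omega> (Some k)) = joint C X \<omega>"
      by (auto simp: joint_def I_def T_def)
    thus ?thesis by (simp add: \<phi>_def joint_def I_def T_def)
  qed
  have "(\<integral>x. \<phi> x \<partial>distr M (PiM I (\<lambda>_. borel)) (joint I (T s))) = s * expectation (\<lambda>\<omega>. indicator Bs (joint C X \<omega>) * L t \<omega>)" for s
    using \<phi>m jm by (simp add: integral_distr \<phi>T)
  from this[of 1] this[of "-1"] law show ?thesis by simp
qed

lemma bounded_mult_L_integrable:
  assumes [measurable]: "Z \<in> borel_measurable M" and Z: "AE \<omega> in M. \<bar>Z \<omega>\<bar> \<le> 1"
  shows "integrable M (\<lambda>\<omega>. Z \<omega> * L t \<omega>)"
proof (rule Bochner_Integration.integrable_bound[OF L_integrable(1)])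
  show "AE \<omega> in M. norm (Z \<omega> * L t \<omega>) \<le> norm (L t \<omega>)"
    using Z by eventually_elim (auto simp: abs_mult intro: mult_left_le_one_le)
qed measurable

lemma generated_subalgebra: "C \<subseteq> V \<Longrightarrow> subalgebra M (generated_algebra M C X)"
proof -
  assume C: "C \<subseteq> V"
  have "joint C X \<in> space M \<rightarrow> space (PiM C (\<lambda>_. borel))"
    using joint_measurable[OF C] by (auto simp: measurable_def)
  thus ?thesis
    unfolding generated_algebra_def subalgebra_def using joint_measurable[OF C]
    by (auto simp: sets_vimage_algebra2 measurable_sets)
qed

lemma cond_exp_orthogonal:
  assumes C: "C \<subseteq> V" and orth: "\<And>k. k \<in> C \<Longrightarrow> B t (unit_vec k) = 0"
  shows "AE \<omega> in M. real_cond_exp M (generated_algebra M C X) (L t) \<omega> = 0"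
    and "Z \<in> borel_measurable (generated_algebra M C X) \<Longrightarrow> integrable M (\<lambda>\<omega>. Z \<omega> * L t \<omega>) \<Longrightarrow>
      expectation (\<lambda>\<omega>. Z \<omega> * L t \<omega>) = 0"
  using expectation_mult_eq_0[OF joint_measurable[OF C] L_integrable(1), of "\<lambda>_. 0"]
    expectation_mult_eq_0(1)[OF joint_measurable[OF C] L_integrable(1), of Z] reflection[OF C orth]
  by (simp_all add: generated_algebra_def)

lemma L_generated:
  assumes C: "C \<subseteq> V" and "\<And>k. k \<notin> C \<Longrightarrow> \<tau> k = 0"
  shows "L \<tau> \<in> borel_measurable (generated_algebra M C X)"
proof -
  have "joint C X \<in> space M \<rightarrow> space (PiM C (\<lambda>_. borel))"
    using joint_measurable[OF C] by (auto simp: measurable_def)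
  hence j: "joint C X \<in> measurable (generated_algebra M C X) (PiM C (\<lambda>_. borel))"
    unfolding generated_algebra_def by (rule measurable_vimage_algebra1)
  have "L \<tau> = (\<lambda>\<omega>. \<Sum>k\<in>C. \<tau> k * (joint C X \<omega>) k)"
    unfolding lin_comb_def[abs_def] using assms fin_V
    by (intro ext sum.mono_neutral_cong_right) (auto simp: joint_def)
  also have "\<dots> \<in> borel_measurable (generated_algebra M C X)"
    by (intro borel_measurable_sum borel_measurable_times borel_measurable_const
        measurable_compose[OF j measurable_component_singleton]) auto
  finally show ?thesis .
qed

text \<open>
  The conditional expectation of \<open>X a\<close> is its linear prediction, so the conditional variance is the conditional
  expectation of the squared innovation, which has mean \<open>1 / K a a\<close>.
\<close>

lemma innovation_variance_ge:
  assumes a: "a \<in> V"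
    and cv: "AE \<omega> in M. cond_variance M (generated_algebra M (V - {a}) X) (X a) \<omega> \<ge> v"
  shows "v \<le> 1 / K a a"
proof -
  define C where "C = V - {a}"
  define F where "F = generated_algebra M C X"
  define t where "t = innovation a"
  define \<tau> where "\<tau> k = (if k \<in> C then - t k else 0)" for k
  have C: "C \<subseteq> V" by (auto simp: C_def)
  interpret F: finite_measure_subalgebra M F
    using generated_subalgebra[OF C] by unfold_locales (simp add: F_def)
  have orth: "B t (unit_vec k) = 0" if "k \<in> C" for k
  proof -
    have "k \<noteq> a" using that by (simp add: C_def)
    hence "unit_vec k a / K a a = 0" by (simp add: unit_vec_def)
    thus ?thesis unfolding t_def B_sym[of "innovation a" "unit_vec k"] B_innovation[OF a] .
  qed
  have "X a = L (\<lambda>k. t k + \<tau> k)"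
    unfolding L_unit[OF a, symmetric] using innovation_self[OF a]
    by (intro L_cong) (auto simp: \<tau>_def C_def t_def unit_vec_def)
  hence Xa: "X a = (\<lambda>\<omega>. L t \<omega> + L \<tau> \<omega>)" by (auto simp: L_add)
  have "AE \<omega> in M. real_cond_exp M F (\<lambda>\<omega>. L t \<omega> + L \<tau> \<omega>) \<omega> = real_cond_exp M F (L t) \<omega> + real_cond_exp M F (L \<tau>) \<omega>"
    by (rule F.real_cond_exp_add) (rule L_integrable)+
  moreover have "AE \<omega> in M. real_cond_exp M F (L t) \<omega> = 0"
    unfolding F_def by (rule cond_exp_orthogonal(1)[OF C orth])
  moreover have "AE \<omega> in M. real_cond_exp M F (L \<tau>) \<omega> = L \<tau> \<omega>"
    by (rule F.real_cond_exp_F_meas[OF L_integrable(1)]) (auto simp: F_def \<tau>_def intro!: L_generated[OF C])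
  ultimately have "AE \<omega> in M. (X a \<omega> - real_cond_exp M F (X a) \<omega>)\<^sup>2 = (L t \<omega>)\<^sup>2"
    unfolding Xa by eventually_elim simp
  moreover have [measurable]: "X a \<in> borel_measurable M" by (rule X_measurable[OF a])
  ultimately have "AE \<omega> in M. cond_variance M F (X a) \<omega> = real_cond_exp M F (\<lambda>\<omega>. (L t \<omega>)\<^sup>2) \<omega>"
    unfolding cond_variance_def by (intro F.real_cond_exp_cong) measurable
  with cv have "AE \<omega> in M. v \<le> real_cond_exp M F (\<lambda>\<omega>. (L t \<omega>)\<^sup>2) \<omega>"
    unfolding F_def C_def by eventually_elim simp
  hence "expectation (\<lambda>_. v) \<le> expectation (real_cond_exp M F (\<lambda>\<omega>. (L t \<omega>)\<^sup>2))"
    using F.real_cond_exp_int(1)[OF L_square(1)] by (intro integral_mono_AE) auto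
  also have "\<dots> = B t t" using F.real_cond_exp_int(2)[OF L_square(1), of t] L_square(2)[of t] by simp
  also have "\<dots> = 1 / K a a" unfolding t_def by (rule innovation_var[OF a])
  finally show ?thesis by (simp add: prob_space)
qed

text \<open>
  Let \<open>L r\<close> be the residual of \<open>X b\<close> given the nodes other than \<open>a\<close> and \<open>b\<close>. Conditional independence allows one to
  replace an indicator \<open>Ia\<close> of \<open>X a\<close> by its conditional expectation \<open>Q\<close> in the product with \<open>X b\<close>; the residual is
  orthogonal to \<open>Q\<close>, hence to every \<open>Ia\<close>, hence to \<open>X a\<close>. So \<open>r\<close> is orthogonal to all nodes except \<open>b\<close>.
\<close>

lemma prec_zero_if_cond_indep:
  assumes ab: "a \<in> V" "b \<in> V" "a \<noteq> b"
    and ci: "cond_indep M (generated_algebra M (V - {a, b}) X) (X a) (X b)"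
  shows "K a b = 0"
proof -
  define C where "C = V - {a, b}"
  define F where "F = generated_algebra M C X"
  have C: "C \<subseteq> V" by (auto simp: C_def)
  interpret F: finite_measure_subalgebra M F
    using generated_subalgebra[OF C] by unfold_locales (simp add: F_def)
  have [measurable]: "X a \<in> borel_measurable M" "X b \<in> borel_measurable M" using X_measurable ab by auto
  obtain \<tau> where \<tau>: "\<And>k. k \<notin> C \<Longrightarrow> \<tau> k = 0"
      "\<And>k. k \<in> C \<Longrightarrow> B (\<lambda>j. unit_vec b j - \<tau> j) (unit_vec k) = 0"
    using projection_exists[OF C, of "unit_vec b"] by blast
  define r where "r = (\<lambda>j. unit_vec b j - \<tau> j)"
  have Lr: "L r \<omega> = X b \<omega> - L \<tau> \<omega>" for \<omega> by (simp add: r_def L_diff L_unit ab)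
  have L\<tau>[measurable]: "L \<tau> \<in> borel_measurable F" unfolding F_def by (rule L_generated[OF C \<tau>(1)])
  have zero: "expectation (\<lambda>\<omega>. indicator A (X a \<omega>) * L r \<omega>) = 0" if [measurable]: "A \<in> sets borel" for A
  proof -
    define Ia where "Ia \<omega> = (indicator A (X a \<omega>) :: real)" for \<omega>
    define Q where "Q = real_cond_exp M F Ia"
    have [measurable]: "Ia \<in> borel_measurable M" unfolding Ia_def[abs_def] by measurable
    have Ia_int: "integrable M Ia" by (rule integrable_const_bound[of _ 1]) (auto simp: Ia_def indicator_def)
    have QF[measurable]: "Q \<in> borel_measurable F" by (simp add: Q_def)
    have [measurable]: "Q \<in> borel_measurable M" by (simp add: Q_def)
    have Q1: "AE \<omega> in M. \<bar>Q \<omega>\<bar> \<le> 1"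
    proof -
      have "AE \<omega> in M. Q \<omega> \<ge> 0" unfolding Q_def by (rule F.real_cond_exp_ge_c[OF Ia_int]) (auto simp: Ia_def)
      moreover have "AE \<omega> in M. Q \<omega> \<le> 1" unfolding Q_def
        by (rule F.real_cond_exp_le_c[OF Ia_int]) (auto simp: Ia_def indicator_def)
      ultimately show ?thesis by eventually_elim auto
    qed
    have Ia1: "AE \<omega> in M. \<bar>Ia \<omega>\<bar> \<le> 1" by (auto simp: Ia_def indicator_def)
    have 1: "expectation (\<lambda>\<omega>. indicator Bs (X b \<omega>) * (Ia \<omega> - Q \<omega>)) = 0" if [measurable]: "Bs \<in> sets borel" for Bs
    proof -
      define Ib where "Ib \<omega> = (indicator Bs (X b \<omega>) :: real)" for \<omega>
      have [measurable]: "Ib \<in> borel_measurable M" unfolding Ib_def[abs_def] by measurable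
      have i1: "integrable M (\<lambda>\<omega>. Ia \<omega> * Ib \<omega>)"
        by (rule integrable_const_bound[of _ 1]) (auto simp: Ia_def Ib_def indicator_def)
      have i2: "integrable M (\<lambda>\<omega>. Q \<omega> * Ib \<omega>)"
        using Q1 by (intro integrable_const_bound[of _ 1]) (auto simp: Ib_def indicator_def elim!: eventually_mono)
      have "expectation (\<lambda>\<omega>. Ia \<omega> * Ib \<omega>) = expectation (real_cond_exp M F (\<lambda>\<omega>. Ia \<omega> * Ib \<omega>))"
        by (rule F.real_cond_exp_int(2)[OF i1, symmetric])
      also have "\<dots> = expectation (\<lambda>\<omega>. Q \<omega> * real_cond_exp M F Ib \<omega>)"
        using ci that unfolding cond_indep_def Q_def Ia_def[abs_def] Ib_def[abs_def] F_def C_def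
        by (intro integral_cong_AE) auto
      also have "\<dots> = expectation (\<lambda>\<omega>. Q \<omega> * Ib \<omega>)"
        by (rule F.real_cond_exp_intg(2)[OF i2]) measurable
      finally show ?thesis using i1 i2 by (simp add: Ib_def[symmetric] right_diff_distrib mult.commute)
    qed
    have iaL: "integrable M (\<lambda>\<omega>. Ia \<omega> * L t \<omega>)" and iqL: "integrable M (\<lambda>\<omega>. Q \<omega> * L t \<omega>)" for t
      by (rule bounded_mult_L_integrable[OF _ Ia1] bounded_mult_L_integrable[OF _ Q1], measurable)+
    have "expectation (\<lambda>\<omega>. X b \<omega> * (Ia \<omega> - Q \<omega>)) = 0"
    proof (rule expectation_mult_eq_0(1)[where T = "X b" and N = borel])
      show "integrable M (\<lambda>\<omega>. Ia \<omega> - Q \<omega>)"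
        using Ia_int F.real_cond_exp_int(1)[OF Ia_int] by (simp add: Q_def)
      show "X b \<in> borel_measurable (vimage_algebra (space M) (X b) borel)"
        by (rule measurable_vimage_algebra1) auto
      show "integrable M (\<lambda>\<omega>. X b \<omega> * (Ia \<omega> - Q \<omega>))"
        using iaL[of "unit_vec b"] iqL[of "unit_vec b"] by (simp add: L_unit ab algebra_simps)
    qed (use 1 in auto)
    hence 2: "expectation (\<lambda>\<omega>. Ia \<omega> * X b \<omega>) = expectation (\<lambda>\<omega>. Q \<omega> * X b \<omega>)"
      using iaL[of "unit_vec b"] iqL[of "unit_vec b"] by (simp add: L_unit ab algebra_simps)
    have 3: "expectation (\<lambda>\<omega>. Q \<omega> * L r \<omega>) = 0"
      by (rule cond_exp_orthogonal(2)[OF C]) (use QF iqL \<tau>(2) in \<open>auto simp: F_def r_def\<close>)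
    have 4: "expectation (\<lambda>\<omega>. L \<tau> \<omega> * Q \<omega>) = expectation (\<lambda>\<omega>. L \<tau> \<omega> * Ia \<omega>)"
      unfolding Q_def by (rule F.real_cond_exp_intg(2)) (use iaL[of \<tau>] in \<open>auto simp: mult.commute\<close>)
    have "expectation (\<lambda>\<omega>. Ia \<omega> * L r \<omega>) = expectation (\<lambda>\<omega>. Ia \<omega> * X b \<omega>) - expectation (\<lambda>\<omega>. Ia \<omega> * L \<tau> \<omega>)"
      unfolding Lr right_diff_distrib using iaL[of "unit_vec b"] iaL[of \<tau>] by (simp add: L_unit ab)
    also have "\<dots> = expectation (\<lambda>\<omega>. Q \<omega> * X b \<omega>) - expectation (\<lambda>\<omega>. Q \<omega> * L \<tau> \<omega>)"
      using 2 4 by (simp add: mult.commute)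
    also have "\<dots> = expectation (\<lambda>\<omega>. Q \<omega> * L r \<omega>)"
      unfolding Lr right_diff_distrib using iqL[of "unit_vec b"] iqL[of \<tau>] by (simp add: L_unit ab)
    finally show ?thesis using 3 by (simp add: Ia_def)
  qed
  have "expectation (\<lambda>\<omega>. X a \<omega> * L r \<omega>) = 0"
  proof (rule expectation_mult_eq_0(1)[where T = "X a" and N = borel])
    show "X a \<in> borel_measurable (vimage_algebra (space M) (X a) borel)"
      by (rule measurable_vimage_algebra1) auto
    show "integrable M (\<lambda>\<omega>. X a \<omega> * L r \<omega>)"
      using L_prod(1)[of "unit_vec a" r] by (simp add: L_unit ab)
  qed (use zero L_integrable in auto)
  hence ra: "B r (unit_vec a) = 0"
    using L_prod(2)[of "unit_vec a" r] by (simp add: L_unit ab B_sym[of r])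
  show ?thesis
  proof (rule prec_zero_if_orthogonal[OF ab])
    show "r b = 1" "r a = 0" using \<tau>(1)[of a] \<tau>(1)[of b] ab by (auto simp: r_def unit_vec_def C_def)
    show "B r (unit_vec k) = 0" if "k \<in> V" "k \<noteq> b" for k
      using ra \<tau>(2)[of k] that by (cases "k = a") (auto simp: r_def C_def)
  qed
qed

end

section \<open>Neighbourhoods and the precision matrix\<close>

context gaussian_family
begin

abbreviation nbr where "nbr \<equiv> ne M V X"

abbreviation coef where "coef \<equiv> opt_coef M V X"

lemma edges_sym: "(a, b) \<in> edges M V X \<Longrightarrow> (b, a) \<in> edges M V X"
proof -
  have "cond_indep M F Y Z" if "cond_indep M F Z Y" for F Y Z
    unfolding cond_indep_def
  proof (intro ballI)
    fix A A' :: "real set" assume "A \<in> sets borel" "A' \<in> sets borel"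
    hence "AE \<omega> in M. real_cond_exp M F (\<lambda>x. indicator A' (Z x) * indicator A (Y x)) \<omega>
        = real_cond_exp M F (\<lambda>x. indicator A' (Z x)) \<omega> * real_cond_exp M F (\<lambda>x. indicator A (Y x)) \<omega>"
      using that by (auto simp: cond_indep_def)
    thus "AE \<omega> in M. real_cond_exp M F (\<lambda>x. indicator A (Y x) * indicator A' (Z x)) \<omega>
        = real_cond_exp M F (\<lambda>x. indicator A (Y x)) \<omega> * real_cond_exp M F (\<lambda>x. indicator A' (Z x)) \<omega>"
      by (simp add: mult.commute)
  qed
  thus "(a, b) \<in> edges M V X \<Longrightarrow> (b, a) \<in> edges M V X"
    unfolding edges_def by (auto simp: insert_commute)
qed

lemma ne_iff: "b \<in> nbr a \<longleftrightarrow> (a, b) \<in> edges M V X"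
  by (auto simp: ne_def edges_def)

lemma ne_sym: "b \<in> nbr a \<longleftrightarrow> a \<in> nbr b"
  unfolding ne_iff using edges_sym by blast

lemma ne_subset: "nbr a \<subseteq> V - {a}"
  by (auto simp: ne_def)

lemma prec_zero_outside_ne:
  assumes "a \<in> V" "b \<in> V" "b \<noteq> a" "b \<notin> nbr a"
  shows "K b a = 0"
proof -
  have "cond_indep M (generated_algebra M (V - {a, b}) X) (X a) (X b)"
    using assms by (auto simp: ne_def edges_def)
  hence "K a b = 0" using prec_zero_if_cond_indep[of a b] assms by auto
  thus ?thesis using prec_sym[of a b] assms by simp
qed

text \<open>
  The innovation is supported on \<open>a\<close> and its neighbours, so prediction from the neighbours is as good as
  prediction from all other nodes.
\<close>

lemma opt_coef_ne:
  assumes a: "a \<in> V"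
  shows "coef a (nbr a) = (\<lambda>k. if k \<in> nbr a then - innovation a k else 0)"
    and "k \<in> V \<Longrightarrow> unit_vec a k - coef a (nbr a) k = innovation a k"
proof -
  define \<beta> where "\<beta> = (\<lambda>k. if k \<in> nbr a then - innovation a k else 0)"
  have w: "unit_vec a k - \<beta> k = innovation a k" if "k \<in> V" for k
    using prec_zero_outside_ne[OF a that] innovation_self[OF a] ne_subset[of a]
    by (auto simp: \<beta>_def unit_vec_def innovation_def)
  have *: "coef a (nbr a) = \<beta>"
  proof (rule opt_coef_eqI)
    show "\<beta> k = 0" if "k \<notin> nbr a" for k using that by (simp add: \<beta>_def)
    fix k assume k: "k \<in> nbr a"
    have "B (\<lambda>j. unit_vec a j - \<beta> j) (unit_vec k) = B (innovation a) (unit_vec k)"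
      by (rule B_cong) (simp_all add: w)
    also have "\<dots> = unit_vec k a / K a a" using B_innovation[OF a] B_sym by metis
    also have "\<dots> = 0" using k by (auto simp: unit_vec_def ne_def)
    finally show "B (\<lambda>j. unit_vec a j - \<beta> j) (unit_vec k) = 0" .
  qed (use ne_subset a in auto)
  show "coef a (nbr a) = (\<lambda>k. if k \<in> nbr a then - innovation a k else 0)"
    using * by (simp add: \<beta>_def)
  show "k \<in> V \<Longrightarrow> unit_vec a k - coef a (nbr a) k = innovation a k"
    using w * by simp
qed

text \<open>
  The coefficient is \<open>K b a / K a a\<close>, that is the partial correlation times \<open>sqrt (K b b / K a a)\<close> up to sign, and
  \<open>K b b \<ge> 1\<close> for a variable of variance 1, while \<open>1 / sqrt (K a a) \<ge> \<bar>v\<bar>\<close>.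
\<close>

lemma partial_corr_le_opt_coef:
  assumes a: "a \<in> V" and b: "b \<in> nbr a" and v: "v\<^sup>2 \<le> 1 / K a a" and Sb: "S b b = 1"
  shows "\<bar>v\<bar> * \<bar>partial_corr K a b\<bar> \<le> \<bar>coef a (nbr a) b\<bar>"
proof -
  have bV: "b \<in> V" using b ne_subset by blast
  have Ka: "K a a > 0" and Kb: "K b b > 0" using prec_diag_pos a bV by auto
  have "1 / K b b \<le> B (unit_vec b) (unit_vec b)"
    by (rule innovation_var_minimal[OF bV]) (simp add: unit_vec_def)
  hence Kb1: "K b b \<ge> 1" using Kb by (simp add: B_unit_unit bV Sb)
  have "v\<^sup>2 \<le> (1 / sqrt (K a a))\<^sup>2" using v Ka by (simp add: power_divide)
  hence v': "\<bar>v\<bar> \<le> 1 / sqrt (K a a)" using Ka by (simp add: abs_le_square_iff[symmetric])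
  have "\<bar>v\<bar> * \<bar>partial_corr K a b\<bar> = \<bar>K b a\<bar> * (\<bar>v\<bar> * (1 / sqrt (K a a)) * (1 / sqrt (K b b)))"
    using Ka Kb prec_sym[OF a bV] by (simp add: partial_corr_def abs_mult real_sqrt_mult)
  also have "\<dots> \<le> \<bar>K b a\<bar> * (1 / sqrt (K a a) * (1 / sqrt (K a a)) * 1)"
    using Ka Kb Kb1 v' by (intro mult_left_mono mult_mono) auto
  also have "\<dots> = \<bar>K b a\<bar> / K a a"
  proof -
    have "sqrt (K a a) * sqrt (K a a) = K a a" using Ka by simp
    thus ?thesis by simp
  qed
  also have "\<dots> = \<bar>coef a (nbr a) b\<bar>"
    using b Ka by (simp add: opt_coef_ne(1)[OF a] innovation_def)
  finally show ?thesis .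
qed

definition ne_residual :: "'i \<Rightarrow> 'i \<Rightarrow> 'i \<Rightarrow> real" where
  "ne_residual a b = (\<lambda>k. unit_vec b k - coef b (nbr a - {b}) k)"

lemma ne_residual:
  assumes a: "a \<in> V" and b: "b \<in> V" "b \<noteq> a"
  shows "k \<in> nbr a - {b} \<Longrightarrow> B (ne_residual a b) (unit_vec k) = 0"
    and "B (ne_residual a b) (innovation a) = 0"
    and "1 / K b b \<le> B (ne_residual a b) (ne_residual a b)"
    and "B (ne_residual a b) (ne_residual a b) \<le> S b b"
proof -
  define A where "A = nbr a - {b}"
  have A: "A \<subseteq> V" using ne_subset by (auto simp: A_def)
  define \<tau> where "\<tau> = coef b A"
  define z where "z = ne_residual a b"
  have z: "z = (\<lambda>k. unit_vec b k - \<tau> k)" by (simp add: z_def ne_residual_def \<tau>_def A_def)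
  have supp: "\<tau> k = 0" if "k \<notin> A" for k using opt_coef_projection(1)[OF A b(1) that] by (simp add: \<tau>_def)
  have orth: "B z (unit_vec k) = 0" if "k \<in> A" for k
    using opt_coef_projection(2)[OF A b(1) that] by (simp add: z \<tau>_def)
  thus "k \<in> nbr a - {b} \<Longrightarrow> B (ne_residual a b) (unit_vec k) = 0" by (simp add: A_def z_def)
  have za: "z a = 0" using b supp[of a] ne_subset[of a] by (auto simp: z unit_vec_def A_def)
  thus "B (ne_residual a b) (innovation a) = 0" using B_innovation[OF a, of z] by (simp add: z_def)
  have "z b = 1" using supp[of b] by (simp add: z unit_vec_def A_def)
  thus "1 / K b b \<le> B (ne_residual a b) (ne_residual a b)"
    using innovation_var_minimal[OF b(1), of z] by (simp add: z_def)
  have "B z \<tau> = (\<Sum>j\<in>V. \<tau> j * B z (unit_vec j))" by (rule B_units)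
  also have "\<dots> = 0"
  proof (intro sum.neutral ballI)
    fix j show "\<tau> j * B z (unit_vec j) = 0" by (cases "j \<in> A") (simp_all add: orth supp)
  qed
  finally have z\<tau>: "B z \<tau> = 0" .
  have "unit_vec b = (\<lambda>k. z k + \<tau> k)" by (auto simp: z)
  hence "B (unit_vec b) (unit_vec b) = B (\<lambda>k. z k + \<tau> k) (\<lambda>k. z k + \<tau> k)" by simp
  also have "\<dots> = B z z + B \<tau> \<tau>" using z\<tau> B_sym[of \<tau> z] by (simp add: B_add_left B_add_right)
  finally show "B (ne_residual a b) (ne_residual a b) \<le> S b b"
    using form_nonneg[of \<tau>] by (simp add: B_unit_unit b z_def)
qed

end

section \<open>Concentration of sums of squares\<close>

lemma centered_normal_exp_square:
  assumes v: "v > 0" and s: "2 * s < 1"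
  shows "(\<integral>\<^sup>+x. ennreal (exp (s * (x\<^sup>2 / v))) \<partial>centered_normal v) = ennreal (1 / sqrt (1 - 2 * s))"
proof -
  define q where "q = sqrt (1 - 2 * s)"
  have q: "q > 0" "q\<^sup>2 = 1 - 2 * s" using s by (simp_all add: q_def)
  define \<sigma> where "\<sigma> = sqrt v"
  have \<sigma>: "\<sigma> > 0" "\<sigma>\<^sup>2 = v" using v by (simp_all add: \<sigma>_def)
  have "normal_density 0 \<sigma> x * exp (s * (x\<^sup>2 / v)) = 1 / q * normal_density 0 (\<sigma> / q) x" for x
  proof -
    have "exp (- x\<^sup>2 / (2 * \<sigma>\<^sup>2)) * exp (s * (x\<^sup>2 / v)) = exp (- x\<^sup>2 / (2 * (\<sigma> / q)\<^sup>2))"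
      unfolding exp_add[symmetric] power_divide \<sigma>(2) q(2) using v s by (simp add: field_simps)
    moreover have "1 / q * (1 / sqrt (2 * pi * (\<sigma> / q)\<^sup>2)) = 1 / sqrt (2 * pi * \<sigma>\<^sup>2)"
      using q(1) \<sigma>(1) by (simp add: real_sqrt_mult power_divide real_sqrt_divide)
    ultimately show ?thesis by (simp add: normal_density_def)
  qed
  hence e: "ennreal (normal_density 0 \<sigma> x) * ennreal (exp (s * (x\<^sup>2 / v))) = ennreal (1 / q) * ennreal (normal_density 0 (\<sigma> / q) x)" for x
    using q(1) by (simp flip: ennreal_mult)
  have "(\<integral>\<^sup>+x. ennreal (exp (s * (x\<^sup>2 / v))) \<partial>centered_normal v)
      = (\<integral>\<^sup>+x. ennreal (1 / q) * ennreal (normal_density 0 (\<sigma> / q) x) \<partial>lborel)"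
  proof -
    have "(\<integral>\<^sup>+x. ennreal (exp (s * (x\<^sup>2 / v))) \<partial>centered_normal v)
        = (\<integral>\<^sup>+x. ennreal (normal_density 0 \<sigma> x) * ennreal (exp (s * (x\<^sup>2 / v))) \<partial>lborel)"
      unfolding centered_normal_def \<sigma>_def[symmetric] using v by (simp add: nn_integral_density)
    thus ?thesis unfolding e .
  qed
  also have "\<dots> = ennreal (1 / q) * (\<integral>\<^sup>+x. ennreal (normal_density 0 (\<sigma> / q) x) \<partial>lborel)"
    by (rule nn_integral_cmult) measurable
  also have "(\<integral>\<^sup>+x. ennreal (normal_density 0 (\<sigma> / q) x) \<partial>lborel) = 1"
  proof -
    interpret N: prob_space "density lborel (\<lambda>x. ennreal (normal_density 0 (\<sigma> / q) x))"
      by (rule prob_space_normal_density) (use \<sigma> q in auto)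
    show ?thesis using N.emeasure_space_1 by (simp add: emeasure_density)
  qed
  finally show ?thesis by (simp add: q_def)
qed

lemma inverse_sqrt_le_exp:
  assumes "\<bar>s\<bar> \<le> 1 / 4"
  shows "1 / sqrt (1 - 2 * s) \<le> exp (s + 4 * s\<^sup>2)"
proof -
  have p: "1 - 2 * s > 0" using assms by linarith
  have "\<bar>ln (1 + (- 2 * s)) - (- 2 * s)\<bar> \<le> 2 * (- 2 * s)\<^sup>2"
    by (rule abs_ln_one_plus_x_minus_x_bound) (use assms in auto)
  hence "- (ln (1 - 2 * s) / 2) \<le> s + 4 * s\<^sup>2" by (simp add: power2_eq_square abs_le_iff)
  hence "exp (- (ln (1 - 2 * s) / 2)) \<le> exp (s + 4 * s\<^sup>2)" by simp
  moreover have "exp (- (ln (1 - 2 * s) / 2)) = 1 / sqrt (1 - 2 * s)"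
    using p by (simp add: exp_minus ln_sqrt[symmetric] inverse_eq_divide)
  ultimately show ?thesis by simp
qed

context prob_space
begin

text \<open>
  Both signs of \<open>s\<close> are allowed: positive values control the upper tail of the sum of squares and negative
  ones the lower tail.
\<close>

lemma sum_squares_Chernoff:
  fixes Y :: "'i \<Rightarrow> 'a \<Rightarrow> real" and v s c :: real
  assumes I: "finite I" and indep: "indep_vars (\<lambda>_. borel) Y I" and v: "v > 0"
    and dist: "\<And>i. i \<in> I \<Longrightarrow> distr M borel (Y i) = centered_normal v"
    and s: "\<bar>s\<bar> \<le> 1 / 4"
  shows "prob {\<omega> \<in> space M. s * (\<Sum>i\<in>I. (Y i \<omega>)\<^sup>2 / v) \<ge> c} \<le> exp (real (card I) * (s + 4 * s\<^sup>2) - c)"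
proof -
  have Ym: "Y i \<in> borel_measurable M" if "i \<in> I" for i using indep that by (auto simp: indep_vars_def)
  define W where "W \<omega> = s * (\<Sum>i\<in>I. (Y i \<omega>)\<^sup>2 / v)" for \<omega>
  have Wm[measurable]: "W \<in> borel_measurable M" unfolding W_def[abs_def] using Ym by measurable
  have W_exp: "ennreal (exp (W \<omega>)) = (\<Prod>i\<in>I. ennreal (exp (s * ((Y i \<omega>)\<^sup>2 / v))))" for \<omega>
    using I by (simp add: W_def sum_distrib_left exp_sum prod_ennreal)
  have "(\<integral>\<^sup>+\<omega>. ennreal (exp (W \<omega>)) \<partial>M) = (\<Prod>i\<in>I. \<integral>\<^sup>+\<omega>. ennreal (exp (s * ((Y i \<omega>)\<^sup>2 / v))) \<partial>M)"
    unfolding W_exp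
  proof (rule indep_vars_nn_integral[OF I])
    show "indep_vars (\<lambda>_. borel) (\<lambda>i \<omega>. ennreal (exp (s * ((Y i \<omega>)\<^sup>2 / v)))) I"
      by (rule indep_vars_compose2[OF indep]) measurable
  qed auto
  also have "\<dots> = (\<Prod>i\<in>I. ennreal (1 / sqrt (1 - 2 * s)))"
  proof (rule prod.cong[OF refl])
    fix i assume i: "i \<in> I"
    have "(\<integral>\<^sup>+\<omega>. ennreal (exp (s * ((Y i \<omega>)\<^sup>2 / v))) \<partial>M) = (\<integral>\<^sup>+x. ennreal (exp (s * (x\<^sup>2 / v))) \<partial>distr M borel (Y i))"
      using Ym[OF i] by (simp add: nn_integral_distr)
    also have "\<dots> = ennreal (1 / sqrt (1 - 2 * s))"
      unfolding dist[OF i] by (rule centered_normal_exp_square[OF v]) (use s in linarith)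
    finally show "(\<integral>\<^sup>+\<omega>. ennreal (exp (s * ((Y i \<omega>)\<^sup>2 / v))) \<partial>M) = ennreal (1 / sqrt (1 - 2 * s))" .
  qed
  also have "\<dots> \<le> (\<Prod>i\<in>I. ennreal (exp (s + 4 * s\<^sup>2)))"
    unfolding prod_constant using inverse_sqrt_le_exp[OF s] by (intro power_mono ennreal_leI) auto
  also have "\<dots> = ennreal (exp (real (card I) * (s + 4 * s\<^sup>2)))"
    by (simp add: prod_constant ennreal_power exp_of_nat_mult[symmetric])
  finally have mgf: "(\<integral>\<^sup>+\<omega>. ennreal (exp (W \<omega>)) \<partial>M) \<le> ennreal (exp (real (card I) * (s + 4 * s\<^sup>2)))" .
  have "emeasure M {\<omega> \<in> space M. 1 \<le> ennreal (exp (- c)) * ennreal (exp (W \<omega>))}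
      \<le> ennreal (exp (- c)) * (\<integral>\<^sup>+\<omega>. ennreal (exp (W \<omega>)) * indicator (space M) \<omega> \<partial>M)"
    by (rule nn_integral_Markov_inequality) auto
  also have "(\<integral>\<^sup>+\<omega>. ennreal (exp (W \<omega>)) * indicator (space M) \<omega> \<partial>M) = (\<integral>\<^sup>+\<omega>. ennreal (exp (W \<omega>)) \<partial>M)"
    by (intro nn_integral_cong) auto
  also have "ennreal (exp (- c)) * \<dots> \<le> ennreal (exp (- c)) * ennreal (exp (real (card I) * (s + 4 * s\<^sup>2)))"
    by (intro mult_left_mono mgf) auto
  also have "\<dots> = ennreal (exp (real (card I) * (s + 4 * s\<^sup>2) - c))"
    by (simp add: exp_diff exp_minus field_simps flip: ennreal_mult)
  also have "{\<omega> \<in> space M. 1 \<le> ennreal (exp (- c)) * ennreal (exp (W \<omega>))} = {\<omega> \<in> space M. W \<omega> \<ge> c}"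
  proof -
    have "1 \<le> ennreal (exp (- c)) * ennreal (exp (W \<omega>)) \<longleftrightarrow> c \<le> W \<omega>" for \<omega>
      by (simp flip: ennreal_mult ennreal_1 exp_add)
    thus ?thesis by simp
  qed
  finally show ?thesis unfolding W_def by (simp add: emeasure_eq_measure)
qed

text \<open>
  The values \<open>s = \<plusminus> \<eta> / 8\<close> minimize the exponents \<open>4 * s\<^sup>2 \<mp> s * \<eta>\<close> per observation.
\<close>

lemma sum_squares_concentration:
  fixes Y :: "'i \<Rightarrow> 'a \<Rightarrow> real" and v \<eta> :: real
  assumes I: "finite I" and indep: "indep_vars (\<lambda>_. borel) Y I" and v: "v > 0"
    and dist: "\<And>i. i \<in> I \<Longrightarrow> distr M borel (Y i) = centered_normal v"
    and \<eta>: "0 \<le> \<eta>" "\<eta> \<le> 1"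
  shows "prob {\<omega> \<in> space M. \<not> \<bar>(\<Sum>i\<in>I. (Y i \<omega>)\<^sup>2) - card I * v\<bar> \<le> \<eta> * (card I * v)}
    \<le> 2 * exp (- real (card I) * \<eta>\<^sup>2 / 16)" (is "prob ?dev \<le> _")
proof -
  have Ym: "Y i \<in> borel_measurable M" if "i \<in> I" for i using indep that by (auto simp: indep_vars_def)
  define n where "n = real (card I)"
  define W where "W \<omega> = (\<Sum>i\<in>I. (Y i \<omega>)\<^sup>2 / v)" for \<omega>
  have Wm[measurable]: "W \<in> borel_measurable M" unfolding W_def[abs_def] using Ym by measurable
  define Up where "Up = {\<omega> \<in> space M. \<eta> / 8 * W \<omega> \<ge> \<eta> / 8 * (n * (1 + \<eta>))}"
  define Lo where "Lo = {\<omega> \<in> space M. - \<eta> / 8 * W \<omega> \<ge> - \<eta> / 8 * (n * (1 - \<eta>))}"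
  have [measurable]: "Up \<in> events" "Lo \<in> events" unfolding Up_def Lo_def by measurable
  have "?dev \<subseteq> Up \<union> Lo"
  proof
    fix \<omega> assume "\<omega> \<in> ?dev"
    hence \<omega>: "\<omega> \<in> space M" "\<not> \<bar>(\<Sum>i\<in>I. (Y i \<omega>)\<^sup>2) - n * v\<bar> \<le> \<eta> * (n * v)" by (auto simp: n_def)
    have "(\<Sum>i\<in>I. (Y i \<omega>)\<^sup>2) = W \<omega> * v" using v by (simp add: W_def sum_divide_distrib[symmetric])
    hence "\<not> \<bar>(W \<omega> - n) * v\<bar> \<le> \<eta> * n * v" using \<omega> by (simp add: algebra_simps)
    hence "\<not> \<bar>W \<omega> - n\<bar> \<le> \<eta> * n" using v by (simp add: abs_mult)
    hence "n * (1 + \<eta>) \<le> W \<omega> \<or> W \<omega> \<le> n * (1 - \<eta>)" by (auto simp: algebra_simps)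
    hence "\<eta> / 8 * (n * (1 + \<eta>)) \<le> \<eta> / 8 * W \<omega> \<or> \<eta> / 8 * W \<omega> \<le> \<eta> / 8 * (n * (1 - \<eta>))"
      using \<eta> by (auto intro!: mult_left_mono)
    thus "\<omega> \<in> Up \<union> Lo"
      using \<omega>(1) by (auto simp: Up_def Lo_def)
  qed
  hence "prob ?dev \<le> prob (Up \<union> Lo)"
    by (rule finite_measure_mono) measurable
  also have "\<dots> \<le> prob Up + prob Lo"
    by (rule measure_Un_le) measurable
  also have "prob Up \<le> exp (n * (\<eta> / 8 + 4 * (\<eta> / 8)\<^sup>2) - \<eta> / 8 * (n * (1 + \<eta>)))"
    unfolding Up_def Lo_def W_def n_def by (rule sum_squares_Chernoff[OF I indep v dist]) (use \<eta> in auto)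
  also have "prob Lo \<le> exp (n * (- \<eta> / 8 + 4 * (- \<eta> / 8)\<^sup>2) - - \<eta> / 8 * (n * (1 - \<eta>)))"
    unfolding Up_def Lo_def W_def n_def by (rule sum_squares_Chernoff[OF I indep v dist]) (use \<eta> in auto)
  also have "n * (\<eta> / 8 + 4 * (\<eta> / 8)\<^sup>2) - \<eta> / 8 * (n * (1 + \<eta>)) = - n * \<eta>\<^sup>2 / 16"
    by (simp add: power2_eq_square field_simps)
  also have "n * (- \<eta> / 8 + 4 * (- \<eta> / 8)\<^sup>2) - - \<eta> / 8 * (n * (1 - \<eta>)) = - n * \<eta>\<^sup>2 / 16"
    by (simp add: power2_eq_square field_simps)
  finally show ?thesis by (simp add: n_def)
qed

end

lemma (in gaussian_family) observations_concentration:
  assumes data: "iid_observations M V X n D" and \<eta>: "0 \<le> \<eta>" "\<eta> \<le> 1"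
  shows "prob {\<omega> \<in> space M. \<not> \<bar>(\<Sum>i\<in>{1..n}. (lin_comb V (D i) t \<omega>)\<^sup>2) - n * B t t\<bar> \<le> \<eta> * (n * B t t)}
      \<le> 2 * exp (- real n * \<eta>\<^sup>2 / 16)" (is "prob ?dev \<le> _")
    and "{\<omega> \<in> space M. \<not> \<bar>(\<Sum>i\<in>{1..n}. (lin_comb V (D i) t \<omega>)\<^sup>2) - n * B t t\<bar> \<le> \<eta> * (n * B t t)} \<in> events"
proof -
  define f where "f x = (\<Sum>k\<in>V. t k * x k)" for x :: "'i \<Rightarrow> real"
  have f[measurable]: "f \<in> borel_measurable (PiM V (\<lambda>_. borel))"
    unfolding f_def[abs_def] by measurable
  have fj: "lin_comb V Y t \<omega> = f (joint V Y \<omega>)" for Y \<omega>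
    by (simp add: lin_comb_def f_def joint_def)
  have indep: "indep_vars (\<lambda>_. PiM V (\<lambda>_. borel)) (\<lambda>i. joint V (D i)) {1..n}"
    and law: "\<And>i. i \<in> {1..n} \<Longrightarrow> distr M (PiM V (\<lambda>_. borel)) (joint V (D i)) = distr M (PiM V (\<lambda>_. borel)) (joint V X)"
    using data by (auto simp: iid_observations_def)
  have ind: "indep_vars (\<lambda>_. borel) (\<lambda>i. lin_comb V (D i) t) {1..n}"
    unfolding fj[abs_def] by (rule indep_vars_compose2[OF indep]) (rule f)
  have Dm: "lin_comb V (D i) t \<in> borel_measurable M" if "i \<in> {1..n}" for i
    using ind that by (auto simp: indep_vars_def)
  define Q where "Q \<omega> = (\<Sum>i\<in>{1..n}. (lin_comb V (D i) t \<omega>)\<^sup>2)" for \<omega>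
  have [measurable]: "Q \<in> borel_measurable M"
    unfolding Q_def[abs_def] by (intro borel_measurable_sum borel_measurable_power Dm)
  show "?dev \<in> events"
    unfolding Q_def[symmetric] by measurable
  have jm: "joint V (D i) \<in> measurable M (PiM V (\<lambda>_. borel))" if "i \<in> {1..n}" for i
    using indep that by (auto simp: indep_vars_def)
  have dist: "distr M borel (lin_comb V (D i) t) = centered_normal (B t t)" if i: "i \<in> {1..n}" for i
  proof -
    have "distr M borel (lin_comb V (D i) t) = distr (distr M (PiM V (\<lambda>_. borel)) (joint V (D i))) borel f"
      using jm[OF i] by (simp add: distr_distr fj[abs_def] comp_def)
    also have "\<dots> = distr M borel (L t)"
      unfolding law[OF i] using joint_measurable[of V] by (simp add: distr_distr fj[abs_def] comp_def)
    finally show ?thesis using L_distr by simp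
  qed
  show "prob ?dev
      \<le> 2 * exp (- real n * \<eta>\<^sup>2 / 16)"
  proof (cases "B t t = 0")
    case True
    hence "lin_comb V (D i) t \<omega> = 0" for i \<omega>
      using B_definite[OF True] by (simp add: lin_comb_def)
    thus ?thesis using True by simp
  next
    case False
    hence "B t t > 0" using form_nonneg[of t] by simp
    thus ?thesis using sum_squares_concentration[OF _ ind _ dist \<eta>] by simp
  qed
qed

section \<open>Recovery on a finite collection of concentration events\<close>

abbreviation dot :: "'i set \<Rightarrow> ('i \<Rightarrow> real) \<Rightarrow> ('i \<Rightarrow> real) \<Rightarrow> real" where
  "dot J t x \<equiv> \<Sum>k\<in>J. t k * x k"

definition concentrated ::
    "'i set \<Rightarrow> ('i \<Rightarrow> 'i \<Rightarrow> real) \<Rightarrow> nat \<Rightarrow> real \<Rightarrow> (nat \<Rightarrow> 'i \<Rightarrow> real) \<Rightarrow> ('i \<Rightarrow> real) \<Rightarrow> bool" where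
  "concentrated V S n \<eta> d t \<longleftrightarrow>
     \<bar>(\<Sum>i\<in>{1..n}. (dot V t (d i))\<^sup>2) - n * cov_form V S t t\<bar> \<le> \<eta> * (n * cov_form V S t t)"

context gaussian_family
begin

text \<open>
  Finitely many directions control the whole span of the innovation of \<open>a\<close> and the neighbours other than
  \<open>b\<close>: the grid combinations of an orthonormal basis, and their sums and differences with the normalized residual.
  The normalization is undone at the end at no cost, as the residual has variance at most 1.
\<close>

lemma cross_bound_directions:
  assumes a: "a \<in> V" and b: "b \<in> V" "b \<noteq> a" and unit: "\<And>a. a \<in> V \<Longrightarrow> S a a = 1"
    and n: "n \<ge> 1" and \<eta>: "0 \<le> \<eta>" "\<eta> \<le> 1 / 4"
  shows "\<exists>T. finite T \<and> card T \<le> 4 * (8 * card (nbr a) + 9) ^ (card (nbr a) + 1) \<and>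
    ne_residual a b \<in> T \<and>
    (\<forall>d c. (\<forall>t\<in>T. concentrated V S n \<eta> d t) \<longrightarrow>
      \<bar>\<Sum>i\<in>{1..n}. (dot V (innovation a) (d i) + dot (nbr a - {b}) c (d i)) * (dot V (ne_residual a b) (d i))\<bar>
        \<le> 20 * \<eta> * sqrt n * L2_set (\<lambda>i. dot V (innovation a) (d i) + dot (nbr a - {b}) c (d i)) {1..n})"
proof -
  define N where "N = nbr a - {b}"
  define s where "s = card (nbr a)"
  have N: "N \<subseteq> V" "finite N" using ne_subset[of a] fin_V finite_subset by (auto simp: N_def)
  have fin_ne: "finite (nbr a)" using ne_subset[of a] fin_V finite_subset by blast
  define G where "G = insert (innovation a) (unit_vec ` N)"
  have cG: "card G \<le> s + 1"
  proof -
    have "card G \<le> Suc (card (unit_vec ` N))" unfolding G_def by (rule card_insert_le_m1) simp_all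
    also have "card (unit_vec ` N) \<le> card N" by (rule card_image_le[OF N(2)])
    also have "card N \<le> s" unfolding N_def s_def by (intro card_mono fin_ne) auto
    finally show ?thesis by simp
  qed
  have "finite G" using N by (simp add: G_def)
  from orthonormal_basis[OF this] obtain m :: nat and f where m: "m \<le> card G"
    and on: "\<And>i j. i < m \<Longrightarrow> j < m \<Longrightarrow> B (f i) (f j) = of_bool (i = j)"
    and ex: "\<And>g k. g \<in> G \<Longrightarrow> k \<in> V \<Longrightarrow> g k = (\<Sum>i<m. B g (f i) * f i k)"
    and span: "\<And>i. i < m \<Longrightarrow> \<exists>c. \<forall>k. f i k = (\<Sum>g\<in>G. c g * g k)" by blast
  define z where "z = ne_residual a b"
  have zG: "B z g = 0" if "g \<in> G" for g
    using that ne_residual(1,2)[OF a b] by (auto simp: G_def z_def N_def)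
  have zf: "B z (f i) = 0" if i: "i < m" for i
  proof -
    obtain c where "\<forall>k. f i k = (\<Sum>g\<in>G. c g * g k)" using span[OF i] by blast
    hence "f i = (\<lambda>k. \<Sum>g\<in>G. c g * g k)" by auto
    hence "B z (f i) = (\<Sum>g\<in>G. c g * B z g)" using \<open>finite G\<close> by (simp add: B_sum_right)
    thus ?thesis by (simp add: zG)
  qed
  define \<sigma> where "\<sigma> = sqrt (B z z)"
  have zz: "B z z > 0" "B z z \<le> 1"
  proof -
    have "1 / K b b > 0" using prec_diag_pos[OF b(1)] by simp
    thus "B z z > 0" unfolding z_def by (rule less_le_trans) (rule ne_residual(3)[OF a b])
    show "B z z \<le> 1" using ne_residual(4)[OF a b] unit[OF b(1)] by (simp add: z_def)
  qed
  hence \<sigma>: "0 < \<sigma>" "\<sigma> \<le> 1" "\<sigma> * \<sigma> = B z z" by (simp_all add: \<sigma>_def)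
  define y where "y = (\<lambda>k. inverse \<sigma> * z k)"
  have yy: "B y y = 1"
  proof -
    have "B y y = inverse \<sigma> * (inverse \<sigma> * B z z)" unfolding y_def by (simp only: B_scale_left B_scale_right)
    also have "\<dots> = inverse \<sigma> * (inverse \<sigma> * (\<sigma> * \<sigma>))" by (simp only: \<sigma>(3))
    also have "\<dots> = 1" using \<sigma>(1) by (simp add: field_simps)
    finally show ?thesis .
  qed
  have fy: "B (f i) y = 0" "B y (f i) = 0" if "i < m" for i
  proof -
    show "B y (f i) = 0" unfolding y_def B_scale_left zf[OF that] by simp
    thus "B (f i) y = 0" by (simp add: B_sym[of "f i" y])
  qed
  define comb where "comb g = (\<lambda>k. \<Sum>j<m. g j * f j k)" for g
  have comb_y: "B (comb g) y = 0" for g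
    unfolding comb_def by (simp add: B_sum_left fy)
  have comb_comb: "B (comb g) (comb g) = (\<Sum>j<m. (g j)\<^sup>2)" for g
  proof -
    have "B (comb g) (f i) = g i" if i: "i < m" for i
    proof -
      have "B (comb g) (f i) = (\<Sum>j<m. g j * B (f j) (f i))" unfolding comb_def by (simp add: B_sum_left)
      also have "\<dots> = (\<Sum>j<m. if j = i then g j else 0)" using i on by (intro sum.cong) auto
      finally show ?thesis using i by simp
    qed
    hence "(\<Sum>i<m. g i * B (comb g) (f i)) = (\<Sum>i<m. (g i)\<^sup>2)"
      by (intro sum.cong) (auto simp: power2_eq_square)
    moreover have "B (comb g) (comb g) = (\<Sum>i<m. g i * B (comb g) (f i))"
      by (subst (2) comb_def) (simp add: B_sum_right)
    ultimately show ?thesis by simp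
  qed
  have plus: "B (\<lambda>k. comb g k + y k) (\<lambda>k. comb g k + y k) = (\<Sum>j<m. (g j)\<^sup>2) + 1"
    and minus: "B (\<lambda>k. comb g k - y k) (\<lambda>k. comb g k - y k) = (\<Sum>j<m. (g j)\<^sup>2) + 1" for g
    using comb_y[of g] B_sym[of y "comb g"]
    by (simp_all add: B_add_left B_add_right B_diff_left B_diff_right comb_comb yy)
  define T where "T = insert z (comb ` grid m \<union> (\<lambda>g k. comb g k + y k) ` grid m \<union> (\<lambda>g k. comb g k - y k) ` grid m)"
  have finT: "finite T" by (simp add: T_def finite_grid)
  have cardT: "card T \<le> 4 * (8 * s + 9) ^ (s + 1)"
  proof -
    let ?q = "(8 * s + 9) ^ (s + 1)"
    have "card (grid m) \<le> (8 * m + 1) ^ m" by (rule card_grid_le)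
    also have "\<dots> \<le> (8 * s + 9) ^ m" using m cG by (intro power_mono) auto
    also have "\<dots> \<le> ?q" using m cG by (intro power_increasing) auto
    finally have g: "card (grid m) \<le> ?q" .
    have img: "card (h ` grid m) \<le> ?q" for h :: "(nat \<Rightarrow> real) \<Rightarrow> 'i \<Rightarrow> real"
      using card_image_le[OF finite_grid, of h m] g by linarith
    have "card T \<le> Suc (card (comb ` grid m \<union> (\<lambda>g k. comb g k + y k) ` grid m \<union> (\<lambda>g k. comb g k - y k) ` grid m))"
      unfolding T_def by (rule card_insert_le_m1) simp_all
    also have "\<dots> \<le> Suc (card (comb ` grid m) + card ((\<lambda>g k. comb g k + y k) ` grid m) + card ((\<lambda>g k. comb g k - y k) ` grid m))"
      using card_Un_le[of "comb ` grid m" "(\<lambda>g k. comb g k + y k) ` grid m"]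
        card_Un_le[of "comb ` grid m \<union> (\<lambda>g k. comb g k + y k) ` grid m" "(\<lambda>g k. comb g k - y k) ` grid m"] by linarith
    also have "\<dots> \<le> Suc (?q + ?q + ?q)"
      using img[of comb] img[of "\<lambda>g k. comb g k + y k"] img[of "\<lambda>g k. comb g k - y k"] by linarith
    also have "\<dots> \<le> 4 * ?q"
    proof -
      have "?q \<ge> 1" by (rule one_le_power) simp
      thus ?thesis by linarith
    qed
    finally show ?thesis .
  qed
  have "\<bar>\<Sum>i\<in>{1..n}. (dot V (innovation a) (d i) + dot N c (d i)) * (dot V z (d i))\<bar>
        \<le> 20 * \<eta> * sqrt n * L2_set (\<lambda>i. dot V (innovation a) (d i) + dot N c (d i)) {1..n}"
    if conc: "\<forall>t\<in>T. concentrated V S n \<eta> d t" for d c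
  proof -
    define C where "C i = B (innovation a) (f i) + (\<Sum>k\<in>N. c k * B (unit_vec k) (f i))" for i
    define F where "F i j = dot V (f j) (d i)" for i j
    define x where "x i = dot V y (d i)" for i
    have combF: "dot V (comb g) (d i) = (\<Sum>j<m. g j * F i j)" for g i
      unfolding comb_def F_def sum_distrib_left sum_distrib_right
      by (subst sum.swap) (simp add: mult.assoc)
    have unitk: "(\<Sum>j\<in>V. unit_vec k j * d i j) = d i k" if "k \<in> V" for k i
      using that fin_V by (simp add: unit_vec_def of_bool_def if_distrib[of "\<lambda>x. x * _"] cong: if_cong)
    have rep: "dot V (innovation a) (d i) + dot N c (d i) = (\<Sum>j<m. C j * F i j)" for i
    proof -
      have gF: "dot V g (d i) = (\<Sum>j<m. B g (f j) * F i j)" if "g \<in> G" for g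
        unfolding combF[symmetric] comb_def by (intro sum.cong) (simp_all add: ex[OF that, symmetric])
      have "dot N c (d i) = (\<Sum>k\<in>N. c k * (\<Sum>j<m. B (unit_vec k) (f j) * F i j))"
        using N by (intro sum.cong) (auto simp: gF[symmetric] unitk G_def)
      also have "\<dots> = (\<Sum>j<m. (\<Sum>k\<in>N. c k * B (unit_vec k) (f j)) * F i j)"
        unfolding sum_distrib_left sum_distrib_right by (subst sum.swap) (simp add: mult.assoc)
      finally show ?thesis
        using gF[of "innovation a"] by (simp add: C_def distrib_right sum.distrib G_def)
    qed
    have zx: "dot V z (d i) = \<sigma> * x i" for i
    proof -
      have "\<sigma> * x i = (\<Sum>k\<in>V. \<sigma> * (inverse \<sigma> * z k * d i k))" by (simp add: x_def y_def sum_distrib_left)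
      also have "\<dots> = dot V z (d i)" using \<sigma>(1) by (intro sum.cong) auto
      finally show ?thesis by simp
    qed
    have "\<bar>\<Sum>i\<in>{1..n}. (\<Sum>j<m. C j * F i j) * x i\<bar> \<le> 20 * \<eta> * sqrt n * L2_set (\<lambda>i. \<Sum>j<m. C j * F i j) {1..n}"
    proof (rule grid_cross_bound[OF _ \<eta>])
      show "real n > 0" using n by simp
      fix g assume g: "g \<in> grid m"
      have "concentrated V S n \<eta> d (comb g)" "concentrated V S n \<eta> d (\<lambda>k. comb g k + y k)"
        "concentrated V S n \<eta> d (\<lambda>k. comb g k - y k)" using conc g by (auto simp: T_def)
      thus "\<bar>(\<Sum>i\<in>{1..n}. (\<Sum>j<m. g j * F i j)\<^sup>2) - n * (\<Sum>j<m. (g j)\<^sup>2)\<bar> \<le> \<eta> * (n * (\<Sum>j<m. (g j)\<^sup>2))"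
        "\<bar>(\<Sum>i\<in>{1..n}. ((\<Sum>j<m. g j * F i j) + x i)\<^sup>2) - n * ((\<Sum>j<m. (g j)\<^sup>2) + 1)\<bar> \<le> \<eta> * (n * ((\<Sum>j<m. (g j)\<^sup>2) + 1))"
        "\<bar>(\<Sum>i\<in>{1..n}. ((\<Sum>j<m. g j * F i j) - x i)\<^sup>2) - n * ((\<Sum>j<m. (g j)\<^sup>2) + 1)\<bar> \<le> \<eta> * (n * ((\<Sum>j<m. (g j)\<^sup>2) + 1))"
        unfolding concentrated_def comb_comb plus minus
        by (simp_all add: distrib_right left_diff_distrib sum.distrib sum_subtractf combF x_def)
    qed
    hence "\<sigma> * \<bar>\<Sum>i\<in>{1..n}. (\<Sum>j<m. C j * F i j) * x i\<bar> \<le> 1 * (20 * \<eta> * sqrt n * L2_set (\<lambda>i. \<Sum>j<m. C j * F i j) {1..n})"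
      using \<sigma> by (intro mult_mono) auto
    moreover have "\<bar>\<Sum>i\<in>{1..n}. (\<Sum>j<m. C j * F i j) * (\<sigma> * x i)\<bar> = \<sigma> * \<bar>\<Sum>i\<in>{1..n}. (\<Sum>j<m. C j * F i j) * x i\<bar>"
    proof -
      have "(\<Sum>i\<in>{1..n}. (\<Sum>j<m. C j * F i j) * (\<sigma> * x i)) = \<sigma> * (\<Sum>i\<in>{1..n}. (\<Sum>j<m. C j * F i j) * x i)"
        unfolding sum_distrib_left[of \<sigma>] by (intro sum.cong) (auto simp: mult.left_commute)
      thus ?thesis using \<sigma>(1) by (simp add: abs_mult)
    qed
    ultimately show ?thesis unfolding rep zx by simp
  qed
  thus ?thesis
    using finT cardT unfolding N_def[symmetric] s_def[symmetric] z_def[symmetric]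
    by (intro exI[of _ T]) (simp add: T_def)
qed

text \<open>
  Collects the directions of all \<open>b\<close>, together with \<open>a\<close> itself, whose concentration bounds the norm
  of the data column of \<open>a\<close> and thereby that of every Lasso residual.
\<close>

lemma neighbourhood_directions:
  assumes a: "a \<in> V" and unit: "\<And>a. a \<in> V \<Longrightarrow> S a a = 1" and v: "\<And>a. a \<in> V \<Longrightarrow> v\<^sup>2 \<le> 1 / K a a"
    and n: "n \<ge> 1" and \<eta>: "0 \<le> \<eta>" "\<eta> \<le> 1 / 4" and lam: "lam > 0"
    and l1: "\<And>b. b \<in> nbr a \<Longrightarrow> l1_norm V (coef b (nbr a - {b})) \<le> \<theta>"
    and big: "\<And>b. b \<in> nbr a \<Longrightarrow>
      lam / 2 * (1 + \<theta>) + 40 * \<eta> < \<bar>coef a (nbr a) b\<bar> * (v\<^sup>2 / 2 - 40 * \<eta>)"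
    and sign: "\<And>b. b \<in> V \<Longrightarrow> b \<noteq> a \<Longrightarrow> b \<notin> nbr a \<Longrightarrow> \<bar>sign_stat M V X a b\<bar> \<le> \<delta>"
    and gap: "80 * \<eta> < (1 - \<delta>) * lam"
  shows "\<exists>T. finite T \<and> card T \<le> card V * (5 * (8 * card (nbr a) + 9) ^ (card (nbr a) + 1)) \<and>
    (\<forall>d \<psi>. (\<forall>t\<in>T. concentrated V S n \<eta> d t) \<longrightarrow> lasso_solution n V d lam a \<psi> \<longrightarrow>
      lasso_support V \<psi> = nbr a)"
proof -
  define N where "N = nbr a"
  define q where "q = (8 * card N + 9) ^ (card N + 1)"
  have N: "N \<subseteq> V" "a \<notin> N" "finite N" using ne_subset[of a] fin_V finite_subset by (auto simp: N_def)
  have "\<exists>T. \<forall>b\<in>V - {a}. finite (T b) \<and> card (T b) \<le> 4 * q \<and> ne_residual a b \<in> T b \<and>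
    (\<forall>d c. (\<forall>t\<in>T b. concentrated V S n \<eta> d t) \<longrightarrow>
      \<bar>\<Sum>i\<in>{1..n}. (dot V (innovation a) (d i) + dot (N - {b}) c (d i)) * (dot V (ne_residual a b) (d i))\<bar>
        \<le> 20 * \<eta> * sqrt n * L2_set (\<lambda>i. dot V (innovation a) (d i) + dot (N - {b}) c (d i)) {1..n})"
    unfolding N_def q_def
    by (rule bchoice, rule ballI) (rule cross_bound_directions[OF a _ _ unit n \<eta>]; auto)
  then obtain T where T: "\<And>b. b \<in> V \<Longrightarrow> b \<noteq> a \<Longrightarrow> finite (T b)" "\<And>b. b \<in> V \<Longrightarrow> b \<noteq> a \<Longrightarrow> card (T b) \<le> 4 * q"
      "\<And>b. b \<in> V \<Longrightarrow> b \<noteq> a \<Longrightarrow> ne_residual a b \<in> T b"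
    and cross: "\<And>b d c. b \<in> V \<Longrightarrow> b \<noteq> a \<Longrightarrow> \<forall>t\<in>T b. concentrated V S n \<eta> d t \<Longrightarrow>
      \<bar>\<Sum>i\<in>{1..n}. (dot V (innovation a) (d i) + dot (N - {b}) c (d i)) * (dot V (ne_residual a b) (d i))\<bar>
        \<le> 20 * \<eta> * sqrt n * L2_set (\<lambda>i. dot V (innovation a) (d i) + dot (N - {b}) c (d i)) {1..n}"
    by blast
  define U where "U = insert (unit_vec a) (\<Union>b\<in>V - {a}. T b)"
  have finU: "finite U" using T(1) fin_V by (auto simp: U_def)
  have cardU: "card U \<le> card V * (5 * q)"
  proof -
    have q1: "q \<ge> 1" unfolding q_def by (rule one_le_power) simp
    have V1: "card V \<ge> 1" using a fin_V by (metis One_nat_def Suc_leI card_gt_0_iff empty_iff)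
    have "card U \<le> Suc (card (\<Union>b\<in>V - {a}. T b))" unfolding U_def by (rule card_insert_le_m1) simp_all
    also have "card (\<Union>b\<in>V - {a}. T b) \<le> (\<Sum>b\<in>V - {a}. card (T b))" by (rule card_UN_le) (simp add: fin_V)
    also have "\<dots> \<le> (\<Sum>b\<in>V - {a}. 4 * q)" using T(2) by (intro sum_mono) auto
    also have "\<dots> \<le> card V * (4 * q)" using fin_V by (simp add: card_Diff_subset_Int)
    also have "Suc \<dots> \<le> card V * (5 * q)"
    proof -
      have "1 * 1 \<le> card V * q" by (rule mult_le_mono[OF V1 q1])
      thus ?thesis by (simp add: algebra_simps)
    qed
    finally show ?thesis by simp
  qed
  have "lasso_support V \<psi> = N"
    if conc: "\<forall>t\<in>U. concentrated V S n \<eta> d t" and sol: "lasso_solution n V d lam a \<psi>" for d \<psi>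
  proof -
    define \<beta> where "\<beta> = coef a N"
    define \<tau> where "\<tau> b = coef b (N - {b})" for b
    have \<beta>0: "\<beta> k = 0" if "k \<notin> N" for k
      using that opt_coef_ne(1)[OF a] by (simp add: \<beta>_def N_def)
    have \<tau>0: "\<tau> b k = 0" if "b \<in> V" "k \<notin> N - {b}" for b k
      using opt_coef_projection(1)[of "N - {b}" b k] that N by (auto simp: \<tau>_def)
    have unitk: "(\<Sum>j\<in>V. unit_vec k j * d i j) = d i k" if "k \<in> V" for k i
      using that fin_V by (simp add: unit_vec_def of_bool_def if_distrib[of "\<lambda>x. x * _"] cong: if_cong)
    have w: "d i a - dot N \<beta> (d i) = dot V (innovation a) (d i)" for i
    proof -
      have "dot V (innovation a) (d i) = (\<Sum>k\<in>V. unit_vec a k * d i k - \<beta> k * d i k)"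
        using opt_coef_ne(2)[OF a] by (intro sum.cong) (simp_all add: \<beta>_def N_def flip: left_diff_distrib)
      moreover have "dot V \<beta> (d i) = dot N \<beta> (d i)"
        using N fin_V \<beta>0 by (intro sum.mono_neutral_right) auto
      ultimately show ?thesis by (simp add: sum_subtractf unitk[OF a])
    qed
    have z: "d i b - dot (N - {b}) (\<tau> b) (d i) = dot V (ne_residual a b) (d i)" if b: "b \<in> V" for i b
    proof -
      have "dot V (ne_residual a b) (d i) = (\<Sum>k\<in>V. unit_vec b k * d i k - \<tau> b k * d i k)"
        by (intro sum.cong) (simp_all add: \<tau>_def N_def ne_residual_def flip: left_diff_distrib)
      moreover have "dot V (\<tau> b) (d i) = dot (N - {b}) (\<tau> b) (d i)"
        using N fin_V \<tau>0[OF b] by (intro sum.mono_neutral_right) auto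
      ultimately show ?thesis by (simp add: sum_subtractf unitk[OF b])
    qed
    have np: "real n > 0" using n by simp
    have concT: "\<forall>t\<in>T b. concentrated V S n \<eta> d t" if "b \<in> V" "b \<noteq> a" for b
      using conc that by (auto simp: U_def)
    have z_norm: "\<bar>(L2_set (\<lambda>i. \<Sum>k\<in>V. ne_residual a b k * d i k) {1..n})\<^sup>2 - n * B (ne_residual a b) (ne_residual a b)\<bar>
        \<le> \<eta> * (n * B (ne_residual a b) (ne_residual a b))" if b: "b \<in> N" for b
    proof -
      have "b \<in> V" "b \<noteq> a" using b N by auto
      hence "concentrated V S n \<eta> d (ne_residual a b)" using concT T(3) by blast
      thus ?thesis by (simp add: concentrated_def L2_set_power2)
    qed
    have zvar: "v\<^sup>2 \<le> B (ne_residual a b) (ne_residual a b)" "B (ne_residual a b) (ne_residual a b) \<le> 1" if b: "b \<in> N" for b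
    proof -
      have bV: "b \<in> V" "b \<noteq> a" using b N by auto
      show "v\<^sup>2 \<le> B (ne_residual a b) (ne_residual a b)" using ne_residual(3)[OF a bV] v[OF bV(1)] by linarith
      show "B (ne_residual a b) (ne_residual a b) \<le> 1" using ne_residual(4)[OF a bV] unit[OF bV(1)] by simp
    qed
    have sq4: "(2 * sqrt n)\<^sup>2 = 4 * real n" by (simp add: power_mult_distrib)
    show ?thesis
    proof (rule lasso_recovers_neighbourhood[where \<beta> = \<beta> and \<tau> = \<tau> and \<rho> = "20 * \<eta>" and \<mu> = "v\<^sup>2 / 2" and \<delta> = \<delta> and \<theta> = \<theta> and D = d])
      show "n \<ge> 1" "lam > 0" "finite V" "N \<subseteq> V" "a \<in> V" "a \<notin> N" "20 * \<eta> \<ge> 0"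
        using n lam fin_V N a \<eta> by auto
      show "\<bar>\<Sum>i\<in>{1..n}. ((d i a - dot N \<beta> (d i)) + dot (N - {b}) c (d i)) * (d i b - dot (N - {b}) (\<tau> b) (d i))\<bar>
          \<le> 20 * \<eta> * sqrt n * L2_set (\<lambda>i. (d i a - dot N \<beta> (d i)) + dot (N - {b}) c (d i)) {1..n}"
        if "b \<in> V" "b \<noteq> a" for b c
        unfolding w z[OF that(1)] by (rule cross[OF that concT[OF that]])
      show "L2_set (\<lambda>i. d i a) {1..n} \<le> 2 * sqrt n"
      proof (rule power2_le_imp_le)
        have "concentrated V S n \<eta> d (unit_vec a)" using conc by (auto simp: U_def)
        hence "\<bar>(L2_set (\<lambda>i. d i a) {1..n})\<^sup>2 - n\<bar> \<le> \<eta> * n"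
          by (simp add: concentrated_def L2_set_power2 unitk[OF a] B_unit_unit[OF a a] unit[OF a])
        also have "\<eta> * n \<le> 1 / 4 * n" using \<eta> by (intro mult_right_mono) auto
        finally show "(L2_set (\<lambda>i. d i a) {1..n})\<^sup>2 \<le> (2 * sqrt n)\<^sup>2" unfolding sq4 by linarith
      qed simp
      show "v\<^sup>2 / 2 * real n \<le> (L2_set (\<lambda>i. d i b - dot (N - {b}) (\<tau> b) (d i)) {1..n})\<^sup>2" if b: "b \<in> N" for b
      proof -
        have bV: "b \<in> V" using b N by auto
        define z2 where "z2 = B (ne_residual a b) (ne_residual a b)"
        have "\<eta> * (n * z2) \<le> 1 / 4 * (n * z2)" using \<eta> form_nonneg by (intro mult_right_mono) (auto simp: z2_def)
        hence "1 / 2 * (n * z2) \<le> (L2_set (\<lambda>i. \<Sum>k\<in>V. ne_residual a b k * d i k) {1..n})\<^sup>2"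
          using z_norm[OF b] np form_nonneg[of "ne_residual a b"] mult_nonneg_nonneg[of "real n" z2] unfolding z2_def[symmetric] by linarith
        moreover have "v\<^sup>2 * n \<le> z2 * n" using zvar(1)[OF b] by (intro mult_right_mono) (auto simp: z2_def)
        ultimately show ?thesis unfolding z[OF bV] by (simp add: mult.commute)
      qed
      show "L2_set (\<lambda>i. d i b - dot (N - {b}) (\<tau> b) (d i)) {1..n} \<le> 2 * sqrt n" if b: "b \<in> N" for b
      proof (rule power2_le_imp_le)
        have bV: "b \<in> V" using b N by auto
        define z2 where "z2 = B (ne_residual a b) (ne_residual a b)"
        have "real n * z2 \<le> real n * 1" using zvar(2)[OF b] by (intro mult_left_mono) (auto simp: z2_def)
        moreover have "\<eta> * (n * z2) \<le> 1 / 4 * (n * z2)" using \<eta> form_nonneg by (intro mult_right_mono) (auto simp: z2_def)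
        ultimately show "(L2_set (\<lambda>i. d i b - dot (N - {b}) (\<tau> b) (d i)) {1..n})\<^sup>2 \<le> (2 * sqrt n)\<^sup>2"
          using z_norm[OF b] unfolding sq4 z[OF bV] z2_def[symmetric] by linarith
      qed simp
      show "lam / 2 * (1 + \<theta>) + 2 * (20 * \<eta>) < \<bar>\<beta> b\<bar> * (v\<^sup>2 / 2 - 2 * (20 * \<eta>))" if b: "b \<in> N" for b
        using big[folded N_def, OF b] by (simp add: \<beta>_def)
      show "(\<Sum>k\<in>N - {b}. \<bar>\<tau> b k\<bar>) \<le> \<theta>" if b: "b \<in> N" for b
      proof -
        have "(\<Sum>k\<in>N - {b}. \<bar>\<tau> b k\<bar>) \<le> (\<Sum>k\<in>V. \<bar>\<tau> b k\<bar>)" using N fin_V by (intro sum_mono2) auto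
        also have "\<dots> \<le> \<theta>" using l1[folded N_def, OF b] by (simp add: l1_norm_def \<tau>_def)
        finally show ?thesis .
      qed
      show "\<bar>\<Sum>k\<in>N. sgn (\<beta> k) * \<tau> b k\<bar> \<le> \<delta>" if b: "b \<in> V" "b \<notin> N" "b \<noteq> a" for b
        using sign[folded N_def, OF b(1,3,2)] b(2) by (simp add: sign_stat_def \<beta>_def \<tau>_def flip: N_def)
      show "4 * (20 * \<eta>) < (1 - \<delta>) * lam" using gap by simp
      show "lasso_solution n V d lam a \<psi>" by (rule sol)
    qed
  qed
  thus ?thesis
    using finU cardU unfolding N_def[symmetric] q_def[symmetric] by (intro exI[of _ U]) blast
qed

text \<open>
  The complement of \<open>E\<close> is covered by the deviation events of the directions of all nodes; the bound is
  their number times the probability of one of them.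
\<close>

theorem recovery_probability:
  assumes data: "iid_observations M V X n D" and n: "n \<ge> 1" and \<eta>: "0 \<le> \<eta>" "\<eta> \<le> 1 / 4" and lam: "lam > 0"
    and unit: "\<And>a. a \<in> V \<Longrightarrow> S a a = 1" and v: "\<And>a. a \<in> V \<Longrightarrow> v\<^sup>2 \<le> 1 / K a a"
    and s: "\<And>a. a \<in> V \<Longrightarrow> card (nbr a) \<le> s"
    and l1: "\<And>a b. a \<in> V \<Longrightarrow> b \<in> nbr a \<Longrightarrow> l1_norm V (coef b (nbr a - {b})) \<le> \<theta>"
    and big: "\<And>a b. a \<in> V \<Longrightarrow> b \<in> nbr a \<Longrightarrow>
      lam / 2 * (1 + \<theta>) + 40 * \<eta> < \<bar>coef a (nbr a) b\<bar> * (v\<^sup>2 / 2 - 40 * \<eta>)"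
    and sign: "\<And>a b. a \<in> V \<Longrightarrow> b \<in> V \<Longrightarrow> b \<noteq> a \<Longrightarrow> b \<notin> nbr a \<Longrightarrow> \<bar>sign_stat M V X a b\<bar> \<le> \<delta>"
    and gap: "80 * \<eta> < (1 - \<delta>) * lam"
    and sol: "\<And>a \<omega>. a \<in> V \<Longrightarrow> \<omega> \<in> space M \<Longrightarrow> lasso_solution n V (\<lambda>i k. D i k \<omega>) lam a (\<psi> a \<omega>)"
    and E: "E \<in> events"
    and sub: "\<And>\<omega>. \<omega> \<in> space M \<Longrightarrow> (\<And>a. a \<in> V \<Longrightarrow> lasso_support V (\<psi> a \<omega>) = nbr a) \<Longrightarrow> \<omega> \<in> E"
  shows "1 - prob E \<le> 10 * (real (card V))\<^sup>2 * (8 * real s + 9) ^ (s + 1) * exp (- real n * \<eta>\<^sup>2 / 16)"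
proof -
  define q where "q = (8 * s + 9) ^ (s + 1)"
  define bad where "bad t = {\<omega> \<in> space M. \<not> \<bar>(\<Sum>i\<in>{1..n}. (lin_comb V (D i) t \<omega>)\<^sup>2) - n * B t t\<bar> \<le> \<eta> * (n * B t t)}" for t
  have \<eta>1: "\<eta> \<le> 1" using \<eta> by simp
  have bad_prob: "prob (bad t) \<le> 2 * exp (- real n * \<eta>\<^sup>2 / 16)" and bad_event: "bad t \<in> events" for t
    using observations_concentration[OF data \<eta>(1) \<eta>1, of t] by (auto simp: bad_def)
  have good: "concentrated V S n \<eta> (\<lambda>i k. D i k \<omega>) t" if "\<omega> \<in> space M" "\<omega> \<notin> bad t" for t \<omega>
    using that by (simp add: bad_def concentrated_def lin_comb_def)
  have "\<forall>a\<in>V. \<exists>T. finite T \<and> card T \<le> card V * (5 * q) \<and>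
      (\<forall>\<omega>\<in>space M. (\<forall>t\<in>T. \<omega> \<notin> bad t) \<longrightarrow> lasso_support V (\<psi> a \<omega>) = nbr a)"
  proof
    fix a assume a: "a \<in> V"
    define r where "r = card (nbr a)"
    obtain T where T: "finite T" "card T \<le> card V * (5 * (8 * r + 9) ^ (r + 1))"
      and rec: "\<And>d \<psi>. (\<forall>t\<in>T. concentrated V S n \<eta> d t) \<Longrightarrow> lasso_solution n V d lam a \<psi> \<Longrightarrow> lasso_support V \<psi> = nbr a"
      using neighbourhood_directions[OF a unit v n \<eta> lam l1[OF a] big[OF a] sign[OF a] gap, folded r_def] by blast
    have "(8 * r + 9) ^ (r + 1) \<le> (8 * s + 9) ^ (r + 1)" using s[OF a] by (intro power_mono) (auto simp: r_def)
    also have "\<dots> \<le> q" unfolding q_def using s[OF a] by (intro power_increasing) (auto simp: r_def)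
    finally have "card V * (5 * (8 * r + 9) ^ (r + 1)) \<le> card V * (5 * q)" by (intro mult_le_mono) auto
    hence "card T \<le> card V * (5 * q)" using T(2) by linarith
    moreover have "lasso_support V (\<psi> a \<omega>) = nbr a" if "\<omega> \<in> space M" "\<forall>t\<in>T. \<omega> \<notin> bad t" for \<omega>
      using that by (intro rec[of "\<lambda>i k. D i k \<omega>"] sol[OF a]) (auto intro: good)
    ultimately show "\<exists>T. finite T \<and> card T \<le> card V * (5 * q) \<and>
      (\<forall>\<omega>\<in>space M. (\<forall>t\<in>T. \<omega> \<notin> bad t) \<longrightarrow> lasso_support V (\<psi> a \<omega>) = nbr a)" using T(1) by blast
  qed
  from bchoice[OF this] obtain T where T: "\<And>a. a \<in> V \<Longrightarrow> finite (T a)" "\<And>a. a \<in> V \<Longrightarrow> card (T a) \<le> card V * (5 * q)"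
    and rec: "\<And>a \<omega>. a \<in> V \<Longrightarrow> \<omega> \<in> space M \<Longrightarrow> \<forall>t\<in>T a. \<omega> \<notin> bad t \<Longrightarrow> lasso_support V (\<psi> a \<omega>) = nbr a" by blast
  define U where "U = (\<Union>a\<in>V. T a)"
  have finU: "finite U" using T(1) fin_V by (auto simp: U_def)
  have "card U \<le> (\<Sum>a\<in>V. card (T a))" unfolding U_def by (rule card_UN_le[OF fin_V])
  also have "\<dots> \<le> (\<Sum>a\<in>V. card V * (5 * q))" using T(2) by (intro sum_mono) auto
  finally have "card U \<le> card V * (card V * (5 * q))" by simp
  hence cardU: "real (card U) \<le> 5 * (real (card V))\<^sup>2 * real q"
    unfolding of_nat_le_iff[symmetric, where 'a = real] by (simp add: power2_eq_square algebra_simps)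
  have "space M - E \<subseteq> (\<Union>t\<in>U. bad t)"
    using sub rec unfolding U_def by blast
  moreover have "(\<Union>t\<in>U. bad t) \<in> events" using finU bad_event by (intro sets.finite_UN) auto
  ultimately have "prob (space M - E) \<le> prob (\<Union>t\<in>U. bad t)" by (intro finite_measure_mono) auto
  also have "\<dots> \<le> (\<Sum>t\<in>U. prob (bad t))" using bad_event by (intro measure_UNION_le finU) auto
  also have "\<dots> \<le> (\<Sum>t\<in>U. 2 * exp (- real n * \<eta>\<^sup>2 / 16))" by (intro sum_mono bad_prob)
  also have "\<dots> = real (card U) * (2 * exp (- real n * \<eta>\<^sup>2 / 16))" by simp
  also have "\<dots> \<le> (5 * (real (card V))\<^sup>2 * real q) * (2 * exp (- real n * \<eta>\<^sup>2 / 16))"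
    by (intro mult_right_mono cardU) auto
  finally have "prob (space M - E) \<le> 10 * (real (card V))\<^sup>2 * real q * exp (- real n * \<eta>\<^sup>2 / 16)" by simp
  thus ?thesis using prob_compl[OF E] by (simp add: q_def)
qed

end

section \<open>Rates\<close>

text \<open>
  The left-hand side is the size of the union bound over pairs of nodes and grid points. Its logarithm
  is \<open>O(ln n + n powr \<kappa> * ln n)\<close>.
\<close>

lemma union_bound_negligible:
  fixes p s :: "nat \<Rightarrow> nat" and \<gamma> \<kappa> \<epsilon> \<alpha> :: real
  assumes p: "(\<lambda>n. real (p n)) \<in> O(\<lambda>n. real n powr \<gamma>)"
    and s: "(\<lambda>n. real (s n)) \<in> O(\<lambda>n. real n powr \<kappa>)"
    and \<kappa>: "0 \<le> \<kappa>" "\<kappa> < 1" "\<kappa> < \<epsilon>" and \<alpha>: "\<alpha> > 0"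
  shows "\<forall>\<^sub>F n in sequentially. (real (p n))\<^sup>2 * (8 * real (s n) + 9) ^ (s n + 1) \<le> exp (\<alpha> * real n powr \<epsilon>)"
proof -
  obtain C1 where C1: "C1 > 0" "\<forall>\<^sub>F n in sequentially. real (p n) \<le> C1 * real n powr \<gamma>"
    using landau_o.bigE[OF p] by auto
  obtain C2 where C2: "C2 > 0" "\<forall>\<^sub>F n in sequentially. real (s n) \<le> C2 * real n powr \<kappa>"
    using landau_o.bigE[OF s] by auto
  define C where "C = max 1 C2"
  define h where "h n = 2 * ln C1 + 2 * \<gamma> * ln n + 2 * C * n powr \<kappa> * (ln (17 * C) + ln n)" for n :: real
  have e0: "\<epsilon> > 0" using \<kappa> by simp
  have "((\<lambda>n. 2 * ln C1 * n powr (- \<epsilon>) + 2 * \<gamma> * (ln n * n powr (- \<epsilon>))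
      + 2 * C * ln (17 * C) * n powr (- (\<epsilon> - \<kappa>)) + 2 * C * (ln n * n powr (- (\<epsilon> - \<kappa>)))) \<longlongrightarrow>
      2 * ln C1 * 0 + 2 * \<gamma> * 0 + 2 * C * ln (17 * C) * 0 + 2 * C * 0) at_top"
  proof -
    have 1: "((\<lambda>n::real. n powr (- \<beta>)) \<longlongrightarrow> 0) at_top" if "\<beta> > 0" for \<beta> :: real
      using that by real_asymp
    have 2: "((\<lambda>n::real. ln n * n powr (- \<beta>)) \<longlongrightarrow> 0) at_top" if "\<beta> > 0" for \<beta> :: real
      using that by real_asymp
    show ?thesis using e0 \<kappa> by (intro tendsto_intros 1 2) auto
  qed
  hence "\<forall>\<^sub>F n in at_top. 2 * ln C1 * n powr (- \<epsilon>) + 2 * \<gamma> * (ln n * n powr (- \<epsilon>))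
      + 2 * C * ln (17 * C) * n powr (- (\<epsilon> - \<kappa>)) + 2 * C * (ln n * n powr (- (\<epsilon> - \<kappa>))) < \<alpha>"
    using \<alpha> by (intro order_tendstoD(2)) auto
  hence "\<forall>\<^sub>F n in at_top. h n \<le> \<alpha> * n powr \<epsilon>"
    using eventually_gt_at_top[of 0]
  proof eventually_elim
    case (elim n)
    have k: "n powr (- (\<epsilon> - \<kappa>)) * n powr \<epsilon> = n powr \<kappa>" "n powr (- \<epsilon>) * n powr \<epsilon> = 1"
      using elim(2) by (simp_all flip: powr_add)
    have "h n = (2 * ln C1 * n powr (- \<epsilon>) + 2 * \<gamma> * (ln n * n powr (- \<epsilon>))
      + 2 * C * ln (17 * C) * n powr (- (\<epsilon> - \<kappa>)) + 2 * C * (ln n * n powr (- (\<epsilon> - \<kappa>)))) * n powr \<epsilon>"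
      unfolding h_def distrib_right mult.assoc k by (simp add: algebra_simps)
    also have "\<dots> \<le> \<alpha> * n powr \<epsilon>" using elim(1) by (intro mult_right_mono) auto
    finally show ?case .
  qed
  hence "\<forall>\<^sub>F n in sequentially. h (real n) \<le> \<alpha> * real n powr \<epsilon>"
    using filterlim_real_sequentially by (rule eventually_compose_filterlim)
  thus ?thesis using C1(2) C2(2) eventually_gt_at_top[of 0]
  proof eventually_elim
    case (elim n)
    have n: "real n \<ge> 1" using elim(4) by simp
    define x where "x = real n powr \<kappa>"
    have x: "1 \<le> x" "x \<le> real n"
    proof -
      show "1 \<le> x" unfolding x_def using n \<kappa> by (intro ge_one_powr_ge_zero) auto
      have "x \<le> real n powr 1" unfolding x_def using n \<kappa> by (intro powr_mono) auto
      thus "x \<le> real n" using n by simp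
    qed
    have C: "C \<ge> 1" by (simp add: C_def)
    have sC: "real (s n) \<le> C * x"
    proof -
      have "C2 * x \<le> C * x" using x by (intro mult_right_mono) (auto simp: C_def)
      thus ?thesis using elim(3) by (simp add: x_def)
    qed
    have Cx: "1 \<le> C * x" using C x by (metis mult_mono' mult_1 zero_le_one)
    have "C * x \<le> C * real n" using C x by (intro mult_left_mono) auto
    hence base: "8 * real (s n) + 9 \<le> 17 * C * real n" using sC Cx by linarith
    have lnb: "0 \<le> ln (17 * C * real n)" using C n by (intro ln_ge_zero) (smt (verit) mult_le_cancel_left1)
    have "(8 * real (s n) + 9) ^ (s n + 1) \<le> (17 * C * real n) ^ (s n + 1)" using base by (intro power_mono) auto
    also have "\<dots> = exp (real (s n + 1) * ln (17 * C * real n))"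
      using C n by (subst exp_of_nat_mult) auto
    also have "\<dots> \<le> exp (2 * C * x * (ln (17 * C) + ln (real n)))"
    proof -
      have "real (s n + 1) \<le> 2 * C * x" using sC Cx by simp
      hence "real (s n + 1) * ln (17 * C * real n) \<le> 2 * C * x * ln (17 * C * real n)"
        using lnb by (intro mult_right_mono) auto
      moreover have "ln (17 * C * real n) = ln (17 * C) + ln (real n)" using C n by (subst ln_mult_pos) auto
      ultimately show ?thesis by simp
    qed
    finally have S: "(8 * real (s n) + 9) ^ (s n + 1) \<le> exp (2 * C * x * (ln (17 * C) + ln (real n)))" .
    have "(real (p n))\<^sup>2 \<le> (C1 * real n powr \<gamma>)\<^sup>2" using elim(2) by (intro power_mono) auto
    also have "C1 * real n powr \<gamma> = exp (ln C1 + \<gamma> * ln (real n))"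
      using C1 n by (simp add: exp_add powr_def)
    also have "(exp (ln C1 + \<gamma> * ln (real n)))\<^sup>2 = exp (2 * ln C1 + 2 * \<gamma> * ln (real n))"
      by (simp flip: exp_of_nat_mult add: algebra_simps exp_double)
    finally have "(real (p n))\<^sup>2 * (8 * real (s n) + 9) ^ (s n + 1)
        \<le> exp (2 * ln C1 + 2 * \<gamma> * ln (real n)) * exp (2 * C * x * (ln (17 * C) + ln (real n)))"
      using S by (intro mult_mono) auto
    also have "\<dots> = exp (h (real n))" by (simp add: h_def x_def exp_add)
    also have "\<dots> \<le> exp (\<alpha> * real n powr \<epsilon>)" using elim(1) by simp
    finally show ?case .
  qed
qed

theorem corollary1:
  fixes p :: "nat \<Rightarrow> nat"
    and M :: "nat \<Rightarrow> 'w measure"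
    and X :: "nat \<Rightarrow> nat \<Rightarrow> 'w \<Rightarrow> real"
    and \<Sigma> K :: "nat \<Rightarrow> nat \<Rightarrow> nat \<Rightarrow> real"
    and D :: "nat \<Rightarrow> nat \<Rightarrow> nat \<Rightarrow> 'w \<Rightarrow> real"
    and theta_hat :: "nat \<Rightarrow> nat \<Rightarrow> 'w \<Rightarrow> nat \<Rightarrow> real"
    and E_hat :: "nat set \<Rightarrow> (nat \<Rightarrow> nat set) \<Rightarrow> (nat \<times> nat) set"
    and lam :: "nat \<Rightarrow> real"
    and \<gamma> v \<kappa> \<theta> \<delta> \<xi> \<delta>' \<epsilon> d :: real
  defines "V \<equiv> \<lambda>n. nodes (p n)"
    and "E \<equiv> \<lambda>n. edges (M n) (nodes (p n)) (X n)"
    and "nb \<equiv> \<lambda>n. ne (M n) (nodes (p n)) (X n)"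
    and "estimate \<equiv> \<lambda>n \<omega>. E_hat (nodes (p n)) (\<lambda>a. lasso_support (nodes (p n)) (theta_hat n a \<omega>))"
  assumes prob: "\<And>n. n \<ge> 1 \<Longrightarrow> prob_space (M n)"
    and gauss: "\<And>n. n \<ge> 1 \<Longrightarrow> gaussian_vector (M n) (V n) (X n) (\<Sigma> n)"
    and inverse: "\<And>n. n \<ge> 1 \<Longrightarrow> matrix_inverse_on (V n) (\<Sigma> n) (K n)"
    and data: "\<And>n. n \<ge> 1 \<Longrightarrow> iid_observations (M n) (V n) (X n) n (D n)"
    and A1: "\<gamma> > 0" "(\<lambda>n. real (p n)) \<in> O(\<lambda>n. real n powr \<gamma>)"
    and A2: "\<And>n a. n \<ge> 1 \<Longrightarrow> a \<in> V n \<Longrightarrow> prob_space.variance (M n) (X n a) = 1"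
      "v\<^sup>2 > 0"
      "\<And>n a. n \<ge> 1 \<Longrightarrow> a \<in> V n \<Longrightarrow>
         AE \<omega> in M n. cond_variance (M n) (generated_algebra (M n) (V n - {a}) (X n)) (X n a) \<omega> \<ge> v\<^sup>2"
    and A3: "0 \<le> \<kappa>" "\<kappa> < 1"
      "(\<lambda>n. real (SUP a\<in>V n. card (nb n a))) \<in> O(\<lambda>n. real n powr \<kappa>)"
    and A4: "\<And>n a b. n \<ge> 1 \<Longrightarrow> a \<in> V n \<Longrightarrow> b \<in> nb n a \<Longrightarrow>
         l1_norm (V n) (opt_coef (M n) (V n) (X n) a (nb n b - {a})) \<le> \<theta>"
    and A5: "\<delta> > 0" "\<xi> > \<kappa>"
      "\<And>n a b. n \<ge> 1 \<Longrightarrow> (a, b) \<in> E n \<Longrightarrow>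
         \<bar>partial_corr (K n) a b\<bar> \<ge> \<delta> * real n powr (- (1 - \<xi>) / 2)"
    and A6: "\<delta>' < 1"
      "\<And>n a b. n \<ge> 1 \<Longrightarrow> a \<in> V n \<Longrightarrow> b \<in> V n \<Longrightarrow> b \<noteq> a \<Longrightarrow> b \<notin> nb n a \<Longrightarrow>
         \<bar>sign_stat (M n) (V n) (X n) a b\<bar> < \<delta>'"
    and penalty: "\<kappa> < \<epsilon>" "\<epsilon> < \<xi>" "\<epsilon> \<le> 1" "d > 0"
      "(\<lambda>n. lam n / (d * real n powr (- (1 - \<epsilon>) / 2))) \<longlonglongrightarrow> 1"
    and lasso: "\<forall>\<^sub>F n in sequentially. \<forall>a\<in>V n. \<forall>\<omega>\<in>space (M n).
         lasso_solution n (V n) (\<lambda>i k. D n i k \<omega>) (lam n) a (theta_hat n a \<omega>)"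
    and E_hat: "E_hat = edges_and \<or> E_hat = edges_or"
    and event: "\<And>n. n \<ge> 1 \<Longrightarrow> {\<omega> \<in> space (M n). estimate n \<omega> = E n} \<in> sets (M n)"
  shows "\<exists>c>0. (\<lambda>n. 1 - measure (M n) {\<omega> \<in> space (M n). estimate n \<omega> = E n})
                 \<in> O(\<lambda>n. exp (- c * real n powr \<epsilon>))"
proof -
  \<comment> \<open>The second bound keeps \<open>40 * \<eta>\<close> below half of \<open>v\<^sup>2 / 2\<close>, the third keeps \<open>80 * \<eta>\<close> below the slack
    \<open>(1 - \<delta>') * lam\<close>, where \<open>lam\<close> is eventually at least half its asymptotic value.\<close>
  define \<tau> where "\<tau> = min (1 / 4) (min (v\<^sup>2 / 320) ((1 - \<delta>') * d / 320))"
  have \<tau>: "\<tau> > 0" "\<tau> \<le> 1 / 4" "320 * \<tau> \<le> v\<^sup>2" "320 * \<tau> \<le> (1 - \<delta>') * d"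
  proof -
    have "(1 - \<delta>') * d > 0" using A6(1) penalty(4) by simp
    thus "\<tau> > 0" using A2(2) by (simp add: \<tau>_def)
    show "\<tau> \<le> 1 / 4" by (simp add: \<tau>_def)
    have "\<tau> \<le> v\<^sup>2 / 320" "\<tau> \<le> (1 - \<delta>') * d / 320"
      unfolding \<tau>_def by (meson min.cobounded1 min.cobounded2 order_trans)+
    thus "320 * \<tau> \<le> v\<^sup>2" "320 * \<tau> \<le> (1 - \<delta>') * d" by simp_all
  qed
  have gapd: "(1 - \<delta>') * d > 0" using A6(1) penalty(4) by simp
  define \<eta> where "\<eta> n = \<tau> * real n powr (- (1 - \<epsilon>) / 2)" for n :: nat
  \<comment> \<open>Half of the exponent \<open>\<tau>\<^sup>2 / 16\<close> of a single deviation pays for the union bound.\<close>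
  define c where "c = \<tau>\<^sup>2 / 32"
  define s where "s n = (SUP a\<in>V n. card (nb n a))" for n
  have fin: "finite (V n)" for n by (simp add: V_def nodes_def)
  have cardV: "card (V n) = p n" for n by (simp add: V_def nodes_def)
  have lam_bounds: "\<forall>\<^sub>F n in sequentially. d / 2 * real n powr (- (1 - \<epsilon>) / 2) < lam n \<and> lam n < 2 * d * real n powr (- (1 - \<epsilon>) / 2)"
  proof -
    have "\<forall>\<^sub>F n in sequentially. lam n / (d * real n powr (- (1 - \<epsilon>) / 2)) > 1 / 2"
      "\<forall>\<^sub>F n in sequentially. lam n / (d * real n powr (- (1 - \<epsilon>) / 2)) < 2"
      by (rule order_tendstoD[OF penalty(5)]; simp)+
    thus ?thesis using eventually_gt_at_top[of 0]
    proof eventually_elim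
      case (elim n)
      have "d * real n powr (- (1 - \<epsilon>) / 2) > 0" using elim(3) penalty(4) by simp
      thus ?case using elim(1,2) by (simp add: pos_less_divide_eq pos_divide_less_eq)
    qed
  qed
  have growth: "\<forall>\<^sub>F n in sequentially. (d * (1 + \<bar>\<theta>\<bar>) + 40 * \<tau>) * 4 / (\<bar>v\<bar> * \<delta> * v\<^sup>2) < real n powr ((\<xi> - \<epsilon>) / 2)"
  proof -
    have "filterlim (\<lambda>n. real n powr ((\<xi> - \<epsilon>) / 2)) at_top sequentially"
      using penalty(2) by real_asymp
    thus ?thesis by (rule filterlim_at_top_dense[THEN iffD1, rule_format])
  qed
  have negl: "\<forall>\<^sub>F n in sequentially. (real (p n))\<^sup>2 * (8 * real (s n) + 9) ^ (s n + 1) \<le> exp (c * real n powr \<epsilon>)"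
    by (rule union_bound_negligible[OF A1(2) A3(3)[folded s_def] A3(1,2) penalty(1)]) (use \<tau> in \<open>simp add: c_def\<close>)
  have "\<forall>\<^sub>F n in sequentially. norm (1 - measure (M n) {\<omega> \<in> space (M n). estimate n \<omega> = E n})
      \<le> 10 * norm (exp (- c * real n powr \<epsilon>))"
    using lam_bounds growth negl lasso eventually_gt_at_top[of 0]
  proof eventually_elim
    case (elim n)
    have n: "n \<ge> 1" using elim(5) by simp
    interpret gaussian_family "M n" "V n" "X n" "\<Sigma> n" "K n"
      using prob[OF n] gauss[OF n] inverse[OF n] fin[of n]
      by (simp add: gaussian_family_def gaussian_family_axioms_def)
    have nb: "nb n = ne (M n) (V n) (X n)" by (simp add: nb_def V_def)
    have En: "E n = edges (M n) (V n) (X n)" by (simp add: E_def V_def)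
    define x where "x = real n powr (- (1 - \<epsilon>) / 2)"
    have x: "0 < x" "x \<le> 1"
    proof -
      show "0 < x" using n by (simp add: x_def)
      have "x \<le> real n powr 0" unfolding x_def using n penalty(3) by (intro powr_mono) auto
      thus "x \<le> 1" using n by simp
    qed
    have \<eta>: "\<eta> n = \<tau> * x" by (simp add: \<eta>_def x_def)
    have lamx: "d / 2 * x < lam n" "lam n < 2 * d * x" using elim(1) by (auto simp: x_def)
    have lam_pos: "lam n > 0"
      using lamx(1) x penalty(4) by (smt (verit) mult_pos_pos half_gt_zero)
    have \<eta>_le: "\<eta> n \<le> \<tau>" unfolding \<eta> using x \<tau> by (simp add: mult_left_le)
    have unit: "\<Sigma> n a a = 1" if "a \<in> V n" for a
      using A2(1)[OF n that] L_integrable(2)[of "unit_vec a"] L_square(2)[of "unit_vec a"]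
      by (simp add: L_unit[OF that] B_unit_unit[OF that that])
    have v: "v\<^sup>2 \<le> 1 / K n a a" if "a \<in> V n" for a
      using A2(3)[OF n that] by (rule innovation_variance_ge[OF that])
    have big: "lam n / 2 * (1 + \<theta>) + 40 * \<eta> n
        < \<bar>opt_coef (M n) (V n) (X n) a (ne (M n) (V n) (X n) a) b\<bar> * (v\<^sup>2 / 2 - 40 * \<eta> n)"
      if a: "a \<in> V n" and b: "b \<in> ne (M n) (V n) (X n) a" for a b
    proof -
      define y where "y = real n powr (- (1 - \<xi>) / 2)"
      define \<beta> where "\<beta> = \<bar>opt_coef (M n) (V n) (X n) a (ne (M n) (V n) (X n) a) b\<bar>"
      have "(a, b) \<in> E n" using b by (simp add: En ne_iff)
      hence "\<delta> * y \<le> \<bar>partial_corr (K n) a b\<bar>" using A5(3)[OF n] by (simp add: y_def)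
      hence "\<bar>v\<bar> * (\<delta> * y) \<le> \<bar>v\<bar> * \<bar>partial_corr (K n) a b\<bar>" by (intro mult_left_mono) auto
      also have "\<dots> \<le> \<beta>"
        unfolding \<beta>_def using b ne_subset[of a] by (intro partial_corr_le_opt_coef[OF a b v[OF a]] unit) auto
      finally have \<beta>: "\<bar>v\<bar> * (\<delta> * y) \<le> \<beta>" .
      have v0: "\<bar>v\<bar> > 0" using A2(2) by simp
      have yx: "y = x * real n powr ((\<xi> - \<epsilon>) / 2)"
      proof -
        have "- (1 - \<epsilon>) / 2 + (\<xi> - \<epsilon>) / 2 = - (1 - \<xi>) / 2" by (simp add: field_simps)
        thus ?thesis unfolding x_def y_def powr_add[symmetric] by (rule arg_cong[OF sym])
      qed
      have "lam n / 2 * (1 + \<theta>) \<le> lam n / 2 * (1 + \<bar>\<theta>\<bar>)" using lam_pos by (intro mult_left_mono) auto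
      also have "\<dots> \<le> d * x * (1 + \<bar>\<theta>\<bar>)" using lamx by (intro mult_right_mono) auto
      finally have "lam n / 2 * (1 + \<theta>) + 40 * \<eta> n \<le> (d * (1 + \<bar>\<theta>\<bar>) + 40 * \<tau>) * x"
        by (simp add: \<eta> algebra_simps)
      also have "\<dots> < (real n powr ((\<xi> - \<epsilon>) / 2) * (\<bar>v\<bar> * \<delta> * v\<^sup>2) / 4) * x"
      proof (rule mult_strict_right_mono[OF _ x(1)])
        have "\<bar>v\<bar> * \<delta> * v\<^sup>2 > 0" using v0 A5(1) A2(2) by simp
        thus "d * (1 + \<bar>\<theta>\<bar>) + 40 * \<tau> < real n powr ((\<xi> - \<epsilon>) / 2) * (\<bar>v\<bar> * \<delta> * v\<^sup>2) / 4"
          using elim(2) by (simp add: pos_divide_less_eq)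
      qed
      also have "\<dots> = (\<bar>v\<bar> * (\<delta> * y)) * (v\<^sup>2 / 4)" by (simp add: yx algebra_simps)
      also have "\<dots> \<le> \<beta> * (v\<^sup>2 / 2 - 40 * \<eta> n)"
      proof (intro mult_mono \<beta>)
        show "v\<^sup>2 / 4 \<le> v\<^sup>2 / 2 - 40 * \<eta> n" using \<eta>_le \<tau>(1,3) by linarith
      qed (auto simp: \<beta>_def)
      finally show ?thesis by (simp add: \<beta>_def)
    qed
    have "1 - prob {\<omega> \<in> space (M n). estimate n \<omega> = E n}
        \<le> 10 * (real (card (V n)))\<^sup>2 * (8 * real (s n) + 9) ^ (s n + 1) * exp (- real n * (\<eta> n)\<^sup>2 / 16)"
    proof (rule recovery_probability[OF data[OF n] n _ _ lam_pos unit v, where \<theta> = \<theta> and \<delta> = \<delta>' and \<psi> = "theta_hat n"])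
      show "0 \<le> \<eta> n" using x \<tau>(1) by (simp add: \<eta>)
      show "\<eta> n \<le> 1 / 4" using \<eta>_le \<tau>(2) by linarith
      show "card (ne (M n) (V n) (X n) a) \<le> s n" if "a \<in> V n" for a
        unfolding s_def nb using that fin by (intro cSUP_upper bdd_above_finite) auto
      show "l1_norm (V n) (opt_coef (M n) (V n) (X n) b (ne (M n) (V n) (X n) a - {b})) \<le> \<theta>"
        if "a \<in> V n" "b \<in> ne (M n) (V n) (X n) a" for a b
        using A4[OF n, of b a] that ne_sym[of b a] ne_subset[of a] unfolding nb by blast
      show "80 * \<eta> n < (1 - \<delta>') * lam n"
      proof -
        have "80 * \<eta> n \<le> (1 - \<delta>') * d / 4 * x" unfolding \<eta> using \<tau>(4) x by simp
        also have "\<dots> = ((1 - \<delta>') * d * x) / 4" by simp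
        also have "\<dots> < ((1 - \<delta>') * d * x) / 2" using mult_pos_pos[OF gapd x(1)] by linarith
        also have "\<dots> = (1 - \<delta>') * (d / 2 * x)" by simp
        also have "\<dots> \<le> (1 - \<delta>') * lam n" using lamx A6(1) by (intro mult_left_mono) auto
        finally show ?thesis .
      qed
      show "\<bar>sign_stat (M n) (V n) (X n) a b\<bar> \<le> \<delta>'"
        if "a \<in> V n" "b \<in> V n" "b \<noteq> a" "b \<notin> ne (M n) (V n) (X n) a" for a b
        using A6(2)[OF n that(1-3)] that(4) unfolding nb by simp
      show "lasso_solution n (V n) (\<lambda>i k. D n i k \<omega>) (lam n) a (theta_hat n a \<omega>)"
        if "a \<in> V n" "\<omega> \<in> space (M n)" for a \<omega> using elim(4) that by blast
      show "{\<omega> \<in> space (M n). estimate n \<omega> = E n} \<in> events" by (rule event[OF n])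
      fix \<omega> assume \<omega>: "\<omega> \<in> space (M n)"
        and supp: "\<And>a. a \<in> V n \<Longrightarrow> lasso_support (V n) (theta_hat n a \<omega>) = ne (M n) (V n) (X n) a"
      have "estimate n \<omega> = E_hat (V n) (\<lambda>a. lasso_support (V n) (theta_hat n a \<omega>))"
        by (simp add: estimate_def V_def)
      also have "\<dots> = E n"
      proof -
        have inV: "a \<in> V n" "b \<in> V n" if "(a, b) \<in> edges (M n) (V n) (X n)" for a b
          using that by (auto simp: edges_def)
        have edge: "b \<in> lasso_support (V n) (theta_hat n a \<omega>)" "a \<in> lasso_support (V n) (theta_hat n b \<omega>)"
          if "(a, b) \<in> edges (M n) (V n) (X n)" for a b
          using that edges_sym[OF that] inV[OF that] by (simp_all add: supp ne_iff)
        show ?thesis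
          using E_hat by (elim disjE)
            (auto simp: edges_and_def edges_or_def supp ne_iff En dest: edges_sym inV edge)
      qed
      finally show "\<omega> \<in> {\<omega> \<in> space (M n). estimate n \<omega> = E n}" using \<omega> by simp
    qed (use big in auto)
    also have "\<dots> = 10 * ((real (p n))\<^sup>2 * (8 * real (s n) + 9) ^ (s n + 1)) * exp (- real n * (\<eta> n)\<^sup>2 / 16)"
      by (simp add: cardV)
    also have "\<dots> \<le> 10 * exp (c * real n powr \<epsilon>) * exp (- real n * (\<eta> n)\<^sup>2 / 16)"
      using elim(3) by (intro mult_right_mono mult_left_mono) auto
    also have "\<dots> = 10 * exp (- c * real n powr \<epsilon>)"
    proof -
      have "x\<^sup>2 * real n = (x * x) * real n powr 1" using n by (simp add: power2_eq_square)
      also have "\<dots> = real n powr \<epsilon>" unfolding x_def powr_add[symmetric] by simp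
      finally have "real n * (\<eta> n)\<^sup>2 = \<tau>\<^sup>2 * real n powr \<epsilon>"
        by (simp add: \<eta> power_mult_distrib mult.commute mult.left_commute)
      thus ?thesis by (simp add: c_def field_simps flip: exp_add)
    qed
    finally show ?case using prob_le_1 by simp
  qed
  hence "(\<lambda>n. 1 - measure (M n) {\<omega> \<in> space (M n). estimate n \<omega> = E n}) \<in> O(\<lambda>n. exp (- c * real n powr \<epsilon>))"
    by (rule bigoI)
  moreover have "c > 0" using \<tau> by (simp add: c_def)
  ultimately show ?thesis by blast
qed

end
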